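(* Let $d\ge2$ be an integer, $\nu=d/2-1$, $\ell\in\{0,1,2,\dots\}$, $\mu=\ell+\nu$, $R>0$ and $\alpha>0$. Let $$\Delta_{\ell}(k)=\Bigl(\alpha+\frac{\ell}{R}\Bigr)J_{\mu}(kR)-kJ_{\mu+1}(kR),\qquad k>0,$$ and let $k_{\ell,1}<k_{\ell,2}<\cdots$ be its positive roots. Put $$\theta(z):=z-\frac{\mu\pi}{2}-\frac{\pi}{4},\qquad C_{\ell,d}(\alpha):=\alpha R+\ell-\frac{(2\ell+d)^{2}-1}{8}.$$ Then: 1. (Asymptotics of the characteristic determinant.) As $k\to+\infty$, $$\Delta_{\ell}(k)=-\sqrt{\frac{2k}{\pi R}}\,\Bigl[\sin\theta(kR)-\frac{C_{\ell,d}(\alpha)}{kR}\cos\theta(kR)+O\bigl((kR)^{-2}\bigr)\Bigr].$$ 2. (Universal spacing with second-order correction.) As $p\to\infty$, $$k_{\ell,p+1}-k_{\ell,p}=\frac{\pi}{R}\Bigl[1-\frac{C_{\ell,d}(\alpha)}{(k_{\ell,p}R)^{2}}+O\bigl((k_{\ell,p}R)^{-3}\bigr)\Bigr].$$ The leading-order term $\pi/R$ is independent of $\alpha$, $\ell$ and the boundary condition type: it coincides with the (leading-order, rescaled by $1/R$) spacing of consecutive positive zeros of Bessel functions.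
   Context: $J_\mu$ is the Bessel function of the first kind of order $\mu$. The roots $k_{\ell,p}=k_{\ell,p}(\alpha)$ are the resonant wavenumbers of the Laplacian on the ball $B_R(0)\subset\mathbb{R}^d$ with Robin condition $\partial_n u+\alpha u=0$ in the angular mode $\ell$. *)

theory Defs
  imports "HOL-Analysis.Analysis" "HOL-Library.Landau_Symbols"
begin

(* rGamma is the entire function 1/Gamma, so negative integer orders are covered as well.
   The formula is meant for x > 0: powr does not give the usual value at x = 0 or x < 0. *)
definition bessel_J :: "real \<Rightarrow> real \<Rightarrow> real" where
  "bessel_J \<mu> x =
     (x / 2) powr \<mu> * (\<Sum>m. (-1) ^ m / fact m * rGamma (real m + \<mu> + 1) * (x / 2) ^ (2 * m))"

definition mode_order :: "nat \<Rightarrow> nat \<Rightarrow> real" where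
  "mode_order d l = real l + (real d / 2 - 1)"

(* Up to a nonvanishing factor, this is u'(R) + \<alpha> u(R) for the radial part
   u(r) = r powr (1 - d/2) * J_\<mu>(k r), rewritten with x J_\<mu>'(x) = \<mu> J_\<mu>(x) - x J_{\<mu>+1}(x). *)
definition robin_det :: "nat \<Rightarrow> nat \<Rightarrow> real \<Rightarrow> real \<Rightarrow> real \<Rightarrow> real" where
  "robin_det d l R \<alpha> k =
     (\<alpha> + real l / R) * bessel_J (mode_order d l) (k * R)
       - k * bessel_J (mode_order d l + 1) (k * R)"

definition phase :: "nat \<Rightarrow> nat \<Rightarrow> real \<Rightarrow> real" where
  "phase d l z = z - mode_order d l * pi / 2 - pi / 4"

definition robin_const :: "nat \<Rightarrow> nat \<Rightarrow> real \<Rightarrow> real \<Rightarrow> real" where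
  "robin_const d l R \<alpha> = \<alpha> * R + real l - ((2 * real l + real d)^2 - 1) / 8"

(* Indexing starts at 1; the value z 0 is irrelevant. *)
definition enumerates_positive_zeros :: "(real \<Rightarrow> real) \<Rightarrow> (nat \<Rightarrow> real) \<Rightarrow> bool" where
  "enumerates_positive_zeros f z \<longleftrightarrow>
     strict_mono_on {1..} z \<and> z ` {1..} = {x. 0 < x \<and> f x = 0}"

end

theory Submission
  imports Defs "HOL-Complex_Analysis.Complex_Analysis" "HOL-Real_Asymp.Real_Asymp"
begin


text \<open>
  For \<open>\<lambda> = \<mu>\<^sup>2 - 1/4\<close> the function \<open>u(x) = \<surd>x J\<^sub>\<mu>(x)\<close> solves \<open>u'' + (1 - \<lambda>/x\<^sup>2) u = 0\<close>. A WKB ansatz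
  shows that, up to a common factor \<open>1 + O(x\<^sup>-\<^sup>2)\<close> and errors \<open>O(x\<^sup>-\<^sup>3)\<close>, the functions \<open>(1 - \<lambda>/(2x\<^sup>2)) u\<close>
  and \<open>u'\<close> equal \<open>A cos \<Theta>\<close> and \<open>-A sin \<Theta>\<close> with \<open>\<Theta> = x - \<phi> + \<lambda>/(2x)\<close>. The differential equation leaves
  \<open>A\<close> and \<open>\<phi>\<close> undetermined; the recurrence relations reduce them, for the integer and half-integer
  orders that occur, to \<open>J\<close> of order \<open>-1/2\<close>, which is elementary, and to \<open>J\<^sub>0\<close>, where they come from
  the method of stationary phase and the Fresnel integral.

  The determinant is a multiple of \<open>u' + (b/x) u\<close> at \<open>x = kR\<close> with a constant \<open>b\<close>. At its zeros
  \<open>tan \<Theta> = b/x + O(x\<^sup>-\<^sup>3)\<close>, hence \<open>x = \<phi> + n\<pi> + (b - \<lambda>/2)/x + O(x\<^sup>-\<^sup>3)\<close>, and taking differences yields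
  the spacing. The absence of an \<open>x\<^sup>-\<^sup>2\<close> term in this expansion is what makes the error \<open>O(x\<^sup>-\<^sup>3)\<close>.
\<close>

section \<open>The Bessel series\<close>

text \<open>Zeros are numbered from the smallest one on, so asymptotics alone do not suffice: only
  finitely many may lie in each interval (0, M], and in particular none may accumulate at 0.
  Splitting off a power of x leaves an entire function, and the identity theorem gives this
  finiteness. Far out there is exactly one zero per interval of length pi; the finitely many earlier
  zeros shift the index by an integer, which drops out of differences.

  Identifying A and \<phi> needs only an o(1) statement about u. The equation itself forces a
  complex amplitude to converge at rate x^-3, and its limit is unique, so any leading asymptotics
  are upgraded at once. This is why J of order 0 is treated only to leading order. For the zeros of
  J of arbitrary real order even the phase may stay unknown, because the spacing does not see it.

  The Fresnel integral is found through its square, as the Gaussian integral often is. This leaves a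
  sign open, which a bound on the imaginary part decides.\<close>

definition bessel_coeff :: "real \<Rightarrow> nat \<Rightarrow> real" where
  "bessel_coeff \<mu> m = (-1) ^ m / fact m * rGamma (real m + \<mu> + 1)"

text \<open>This is the Bessel-Clifford function at -t. In the variable t = (x/2)^2 the series is
  entire for every real order and differentiation merely raises the order. The general type lets
  real calculus and complex analyticity share one definition.\<close>

definition bessel_series :: "real \<Rightarrow> 'a \<Rightarrow> 'a::{real_normed_field,banach}" where
  "bessel_series \<mu> t = (\<Sum>m. of_real (bessel_coeff \<mu> m) * t ^ m)"

text \<open>From index N on the argument z is at least 1, where 1/Gamma(z + 1) = (1/Gamma(z))/z
  cannot grow in absolute value; a maximum covers the finitely many earlier indices, where z may be
  negative.\<close>

lemma rGamma_shift_bounded: "\<exists>B. \<forall>m::nat. \<bar>rGamma (real m + \<mu> + 1)\<bar> \<le> B"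
proof -
  define N where "N = nat \<lceil>\<bar>\<mu>\<bar>\<rceil>"
  have N: "real N \<ge> \<bar>\<mu>\<bar>" unfolding N_def by linarith
  define B where "B = Max ((\<lambda>m. \<bar>rGamma (real m + \<mu> + 1)\<bar>) ` {..N})"
  have low: "\<bar>rGamma (real m + \<mu> + 1)\<bar> \<le> B" if "m \<le> N" for m
    unfolding B_def using that by (intro Max_ge) auto
  have high: "\<bar>rGamma (real (N + j) + \<mu> + 1)\<bar> \<le> B" for j
  proof (induction j)
    case 0
    then show ?case using low[of N] by simp
  next
    case (Suc j)
    define z where "z = real (N + j) + \<mu> + 1"
    have z1: "z \<ge> 1" using N unfolding z_def by simp
    have "\<bar>rGamma (z + 1)\<bar> \<le> z * \<bar>rGamma (z + 1)\<bar>"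
      using z1 by (simp add: mult_le_cancel_right1)
    also have "\<dots> = \<bar>rGamma z\<bar>"
      using rGamma_plus1[of z] z1 by (metis abs_mult abs_of_nonneg order_trans zero_le_one)
    also have "\<dots> \<le> B" using Suc unfolding z_def .
    finally show ?case unfolding z_def by (simp add: algebra_simps)
  qed
  have "\<bar>rGamma (real m + \<mu> + 1)\<bar> \<le> B" for m
    using low[of m] high[of "m - N"] by (cases "m \<le> N") auto
  then show ?thesis by blast
qed

lemma bessel_series_summable:
  fixes t :: "'a::{real_normed_field,banach}"
  shows "summable (\<lambda>m. of_real (bessel_coeff \<mu> m) * t ^ m)"
proof -
  obtain B where B: "\<bar>rGamma (real m + \<mu> + 1)\<bar> \<le> B" for m
    using rGamma_shift_bounded by blast
  have s: "summable (\<lambda>m. B * (inverse (fact m) * norm t ^ m))"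
    by (intro summable_mult summable_exp)
  show ?thesis
  proof (rule summable_comparison_test'[OF s])
    fix m :: nat
    have "norm (of_real (bessel_coeff \<mu> m) * t ^ m) = \<bar>rGamma (real m + \<mu> + 1)\<bar> * (inverse (fact m) * norm t ^ m)"
      by (simp add: bessel_coeff_def norm_mult norm_power norm_divide abs_mult divide_inverse power_abs
          del: of_real_mult of_real_inverse)
    also have "\<dots> \<le> B * (inverse (fact m) * norm t ^ m)"
      by (intro mult_right_mono B) simp
    finally show "norm (of_real (bessel_coeff \<mu> m) * t ^ m) \<le> B * (inverse (fact m) * norm t ^ m)" .
  qed
qed

lemma bessel_series_deriv:
  fixes t :: "'a::{real_normed_field,banach}"
  shows "(bessel_series \<mu> has_field_derivative - bessel_series (\<mu> + 1) t) (at t)"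
proof -
  have "DERIV (\<lambda>x. \<Sum>n. of_real (bessel_coeff \<mu> n) * x ^ n) t :>
          (\<Sum>n. diffs (\<lambda>n. of_real (bessel_coeff \<mu> n)) n * t ^ n)"
    by (rule termdiffs_strong_converges_everywhere) (rule bessel_series_summable)
  moreover have d: "diffs (\<lambda>n. of_real (bessel_coeff \<mu> n)) n = - (of_real (bessel_coeff (\<mu> + 1) n) :: 'a)" for n
  proof -
    have "real (Suc n) * bessel_coeff \<mu> (Suc n) = - bessel_coeff (\<mu> + 1) n"
      by (simp add: bessel_coeff_def field_simps del: of_nat_Suc)
         (simp add: algebra_simps)
    then show ?thesis unfolding diffs_def
      by (metis of_real_minus of_real_mult of_real_of_nat_eq)
  qed
  ultimately show ?thesis
    unfolding bessel_series_def d by (simp add: suminf_minus bessel_series_summable)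
qed

text \<open>Coefficientwise this is 1/Gamma(z) = z/Gamma(z + 1) at z = m + \<mu> + 1: the summand
  \<mu> + 1 of the factor z gives the first term, the summand m an index shift and with it the
  factor t.\<close>

lemma bessel_series_rec:
  fixes t :: "'a::{real_normed_field,banach}"
  shows "bessel_series \<mu> t = of_real (\<mu> + 1) * bessel_series (\<mu> + 1) t - t * bessel_series (\<mu> + 2) t"
proof -
  let ?c = "\<lambda>\<mu> m. of_real (bessel_coeff \<mu> m) :: 'a"
  have c: "bessel_coeff \<mu> m = (\<mu> + 1) * bessel_coeff (\<mu> + 1) m + real m * bessel_coeff (\<mu> + 1) m" for m
  proof -
    have "rGamma (real m + \<mu> + 1) = (real m + \<mu> + 1) * rGamma (real m + (\<mu> + 1) + 1)"
      using rGamma_plus1[of "real m + \<mu> + 1"] by (simp add: add_ac)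
    then show ?thesis unfolding bessel_coeff_def by (simp only:) (simp add: field_simps)
  qed
  have s1: "summable (\<lambda>m. of_real (\<mu> + 1) * (?c (\<mu> + 1) m * t ^ m))"
    by (intro summable_mult bessel_series_summable)
  have e: "of_real (real (Suc m) * bessel_coeff (\<mu> + 1) (Suc m)) * t ^ Suc m = - t * (?c (\<mu> + 2) m * t ^ m)" for m
  proof -
    have "real (Suc m) * bessel_coeff (\<mu> + 1) (Suc m) = - bessel_coeff (\<mu> + 2) m"
      by (simp add: bessel_coeff_def field_simps del: of_nat_Suc)
         (simp add: algebra_simps)
    then show ?thesis by simp
  qed
  have "(\<lambda>m. - t * (?c (\<mu> + 2) m * t ^ m)) sums (- t * bessel_series (\<mu> + 2) t)"
    unfolding bessel_series_def by (intro sums_mult summable_sums bessel_series_summable)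
  then have "(\<lambda>m. of_real (real (Suc m) * bessel_coeff (\<mu> + 1) (Suc m)) * t ^ Suc m) sums (- t * bessel_series (\<mu> + 2) t)"
    by (simp only: e)
  \<comment> \<open>The term of index 0 carries the factor 0, so the shift of the index loses
    nothing.\<close>
  then have "(\<lambda>m. of_real (real m * bessel_coeff (\<mu> + 1) m) * t ^ m) sums (- t * bessel_series (\<mu> + 2) t)"
    using sums_Suc_iff[of "\<lambda>m. of_real (real m * bessel_coeff (\<mu> + 1) m) * t ^ m" "- t * bessel_series (\<mu> + 2) t"]
    by simp
  moreover have "(\<lambda>m. of_real (\<mu> + 1) * (?c (\<mu> + 1) m * t ^ m)) sums (of_real (\<mu> + 1) * bessel_series (\<mu> + 1) t)"
    unfolding bessel_series_def by (intro sums_mult summable_sums bessel_series_summable)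
  ultimately have "(\<lambda>m. of_real (\<mu> + 1) * (?c (\<mu> + 1) m * t ^ m) + of_real (real m * bessel_coeff (\<mu> + 1) m) * t ^ m) sums
      (of_real (\<mu> + 1) * bessel_series (\<mu> + 1) t + - t * bessel_series (\<mu> + 2) t)"
    by (rule sums_add[rotated])
  moreover have "of_real (\<mu> + 1) * (?c (\<mu> + 1) m * t ^ m) + of_real (real m * bessel_coeff (\<mu> + 1) m) * t ^ m = ?c \<mu> m * t ^ m" for m
    unfolding c[of m] by (simp add: algebra_simps)
  ultimately show ?thesis unfolding bessel_series_def[of \<mu>] by (simp add: sums_iff)
qed

lemma bessel_series_of_real:
  "bessel_series \<mu> (complex_of_real t) = complex_of_real (bessel_series \<mu> t)"
proof -
  have "(\<lambda>m. bessel_coeff \<mu> m * t ^ m) sums bessel_series \<mu> t"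
    using summable_sums[OF bessel_series_summable[of \<mu> t]] by (simp add: bessel_series_def)
  then have "(\<lambda>m. complex_of_real (bessel_coeff \<mu> m * t ^ m)) sums complex_of_real (bessel_series \<mu> t)"
    by (rule sums_of_real)
  then show ?thesis unfolding bessel_series_def[where 'a = complex] by (simp add: sums_iff)
qed

section \<open>Derivative and three-term recurrence of J\<close>

lemma bessel_J_series: "bessel_J \<mu> x = (x / 2) powr \<mu> * bessel_series \<mu> ((x / 2)\<^sup>2)"
  unfolding bessel_J_def bessel_series_def bessel_coeff_def by (simp add: power_mult)

lemma bessel_J_deriv:
  assumes "x > 0"
  shows "(bessel_J \<mu> has_real_derivative \<mu> / x * bessel_J \<mu> x - bessel_J (\<mu> + 1) x) (at x)"
proof -
  define P where "P = (x / 2) powr \<mu>"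
  have p: "((\<lambda>x. (x / 2) powr \<mu>) has_real_derivative \<mu> / x * P) (at x)"
    using assms by (auto intro!: derivative_eq_intros simp: P_def powr_diff)
  have q: "((\<lambda>x. (x / 2)\<^sup>2) has_real_derivative x / 2) (at x)"
    by (auto intro!: derivative_eq_intros)
  have b: "((\<lambda>x. bessel_series \<mu> ((x / 2)\<^sup>2)) has_real_derivative
             - bessel_series (\<mu> + 1) ((x / 2)\<^sup>2) * (x / 2)) (at x)"
    by (rule DERIV_chain2[OF bessel_series_deriv q])
  have [simp]: "(x / 2) powr (1 + \<mu>) = P * (x / 2)"
    using assms by (simp add: powr_add P_def)
  show ?thesis
    using DERIV_mult[OF p b] unfolding bessel_J_series[abs_def]
    by (simp add: P_def[symmetric] algebra_simps add.commute)
qed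

lemma bessel_J_rec:
  assumes "x > 0"
  shows "bessel_J (\<mu> + 2) x = 2 * (\<mu> + 1) / x * bessel_J (\<mu> + 1) x - bessel_J \<mu> x"
proof -
  have [simp]: "(x / 2) powr (\<mu> + 1) = (x / 2) powr \<mu> * (x / 2)" "(x / 2) powr (\<mu> + 2) = (x / 2) powr \<mu> * (x / 2)\<^sup>2"
    using assms powr_realpow[of "x/2" 2] by (simp_all only: powr_add) auto
  have T: "bessel_series \<mu> ((x/2)\<^sup>2) = (\<mu> + 1) * bessel_series (\<mu> + 1) ((x/2)\<^sup>2) - (x/2)\<^sup>2 * bessel_series (\<mu> + 2) ((x/2)\<^sup>2)"
    using bessel_series_rec[of \<mu> "(x/2)\<^sup>2"] by simp
  have "2 * (\<mu> + 1) / x * (P * (x / 2) * B) - P * ((\<mu> + 1) * B - (x/2)\<^sup>2 * C) = P * (x/2)\<^sup>2 * C" for P B C :: real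
    using assms by (simp add: field_simps)
  then show ?thesis by (simp add: bessel_J_series T)
qed


section \<open>The Fresnel integral\<close>

text \<open>Integration by parts. Since the integrand already contains \<open>\<psi>'\<close>,
  nothing is divided by \<open>\<psi>'\<close>, and a stationary point of \<psi> does no harm. Both
  applications have one at 0.\<close>

lemma oscillatory_integral_bound:
  fixes \<psi> m :: "real \<Rightarrow> real"
  assumes ab: "a \<le> b"
    and d\<psi>: "\<And>t. t \<in> {a..b} \<Longrightarrow> (\<psi> has_real_derivative \<psi>' t) (at t)"
    and dm: "\<And>t. t \<in> {a..b} \<Longrightarrow> (m has_real_derivative m' t) (at t)"
    and c\<psi>: "continuous_on {a..b} \<psi>'" and cm: "continuous_on {a..b} m'"
  obtains C where "C \<ge> 0" "\<And>X. X > 0 \<Longrightarrow> norm (integral {a..b} (\<lambda>t. cis (- (X * \<psi> t)) * of_real (\<psi>' t * m t))) \<le> C / X"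
proof -
  define C where "C = \<bar>m a\<bar> + \<bar>m b\<bar> + integral {a..b} (\<lambda>t. \<bar>m' t\<bar>)"
  have cc: "continuous_on {a..b} \<psi>" "continuous_on {a..b} m"
    by (intro continuous_at_imp_continuous_on ballI DERIV_isCont[OF d\<psi>] DERIV_isCont[OF dm]; simp)+
  have C: "C \<ge> 0" unfolding C_def
    by (intro add_nonneg_nonneg integral_nonneg integrable_continuous_real continuous_intros cm) auto
  show ?thesis
  proof (rule that[OF C])
    fix X :: real assume X: "X > 0"
    define g1 where "g1 t = cis (- (X * \<psi> t)) * of_real (\<psi>' t * m t)" for t
    define g2 where "g2 t = cis (- (X * \<psi> t)) * of_real (m' t)" for t
    have i1: "g1 integrable_on {a..b}" "g2 integrable_on {a..b}"
      unfolding g1_def[abs_def] g2_def[abs_def]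
      by (intro integrable_continuous_real continuous_intros cc c\<psi> cm)+
    have "((\<lambda>t. - \<i> * of_real X * g1 t + g2 t) has_integral
            cis (- (X * \<psi> b)) * of_real (m b) - cis (- (X * \<psi> a)) * of_real (m a)) {a..b}"
    proof (rule fundamental_theorem_of_calculus[OF ab])
      fix t assume t: "t \<in> {a..b}"
      have 1: "((\<lambda>t. cos (X * \<psi> t) * m t) has_real_derivative
          - X * \<psi>' t * sin (X * \<psi> t) * m t + cos (X * \<psi> t) * m' t) (at t)"
        by (auto intro!: derivative_eq_intros d\<psi>[OF t] dm[OF t])
      have 2: "((\<lambda>t. - (sin (X * \<psi> t) * m t)) has_real_derivative
          - X * \<psi>' t * cos (X * \<psi> t) * m t - sin (X * \<psi> t) * m' t) (at t)"
        by (auto intro!: derivative_eq_intros d\<psi>[OF t] dm[OF t])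
      have "((\<lambda>t. cis (- (X * \<psi> t)) * of_real (m t)) has_vector_derivative
          Complex (- X * \<psi>' t * sin (X * \<psi> t) * m t + cos (X * \<psi> t) * m' t)
            (- X * \<psi>' t * cos (X * \<psi> t) * m t - sin (X * \<psi> t) * m' t)) (at t)"
        using 1 2 by (simp add: has_vector_derivative_complex_iff has_real_derivative_iff_has_vector_derivative)
      also have "Complex (- X * \<psi>' t * sin (X * \<psi> t) * m t + cos (X * \<psi> t) * m' t)
            (- X * \<psi>' t * cos (X * \<psi> t) * m t - sin (X * \<psi> t) * m' t) = - \<i> * of_real X * g1 t + g2 t"
        by (simp add: g1_def g2_def complex_eq_iff)
      finally show "((\<lambda>t. cis (- (X * \<psi> t)) * of_real (m t)) has_vector_derivative - \<i> * of_real X * g1 t + g2 t) (at t within {a..b})"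
        by (rule has_vector_derivative_at_within)
    qed
    then have "integral {a..b} (\<lambda>t. - \<i> * of_real X * g1 t + g2 t) =
            cis (- (X * \<psi> b)) * of_real (m b) - cis (- (X * \<psi> a)) * of_real (m a)"
      by (rule integral_unique)
    also have "integral {a..b} (\<lambda>t. - \<i> * of_real X * g1 t + g2 t) = - \<i> * of_real X * integral {a..b} g1 + integral {a..b} g2"
      by (simp only: integral_add[OF integrable_on_mult_right[OF i1(1)] i1(2)] integral_mult_right)
    finally have eq: "\<i> * of_real X * integral {a..b} g1 =
       integral {a..b} g2 - cis (- (X * \<psi> b)) * of_real (m b) + cis (- (X * \<psi> a)) * of_real (m a)"
      by (simp add: algebra_simps)
    have "norm (integral {a..b} g2) \<le> integral {a..b} (\<lambda>t. \<bar>m' t\<bar>)"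
      by (rule Henstock_Kurzweil_Integration.integral_norm_bound_integral[OF i1(2)])
         (auto simp: g2_def norm_mult intro!: integrable_continuous_real continuous_intros cm)
    then have "norm (\<i> * of_real X * integral {a..b} g1) \<le> C"
      unfolding eq C_def
      by (intro order_trans[OF norm_triangle_ineq] order_trans[OF add_right_mono[OF norm_triangle_ineq4]])
         (simp add: norm_mult)
    then have "X * norm (integral {a..b} g1) \<le> C" using X by (simp add: norm_mult)
    then show "norm (integral {a..b} (\<lambda>t. cis (- (X * \<psi> t)) * of_real (\<psi>' t * m t))) \<le> C / X"
      using X by (simp add: g1_def[abs_def] field_simps)
  qed
qed

lemma one_plus_square_nonzero:
  fixes t :: real
  shows "1 + t\<^sup>2 \<noteq> 0" "1 + (complex_of_real t)\<^sup>2 \<noteq> 0"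
proof -
  have "1 + t\<^sup>2 > 0" by (intro add_pos_nonneg) auto
  then show 1: "1 + t\<^sup>2 \<noteq> 0" by simp
  have "1 + (complex_of_real t)\<^sup>2 = of_real (1 + t\<^sup>2)" by simp
  then show "1 + (complex_of_real t)\<^sup>2 \<noteq> 0" using 1 by (simp only: of_real_eq_0_iff not_False_eq_True)
qed

definition fresnel :: "real \<Rightarrow> complex" where
  "fresnel y = integral {0..y} (\<lambda>v. cis (- v\<^sup>2))"

text \<open>The functions \<open>fresnel\<^sup>2\<close> and \<open>\<i> fresnel_aux\<close> have the same derivative.\<close>
definition fresnel_aux :: "real \<Rightarrow> complex" where
  "fresnel_aux y = integral {0..1} (\<lambda>t. cis (- (y\<^sup>2 * (1 + t\<^sup>2))) / of_real (1 + t\<^sup>2))"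

lemma fresnel_deriv:
  assumes "0 \<le> y" "y \<le> b"
  shows "(fresnel has_vector_derivative cis (- y\<^sup>2)) (at y within {0..b})"
  unfolding fresnel_def[abs_def] using assms
  by (intro integral_has_vector_derivative continuous_intros) auto

lemma fresnel_scaled:
  assumes "0 \<le> y"
  shows "of_real y * integral {0..1} (\<lambda>t. cis (- (y * t)\<^sup>2)) = fresnel y"
proof -
  have "((\<lambda>t. y *\<^sub>R cis (- (y * t)\<^sup>2)) has_integral integral {y * 0..y * 1} (\<lambda>v. cis (- v\<^sup>2))) {0..1}"
    by (rule has_integral_substitution[where c = 0 and d = y])
       (use assms in \<open>auto intro!: derivative_eq_intros continuous_intros mult_left_le\<close>)
  then have "integral {0..1} (\<lambda>t. y *\<^sub>R cis (- (y * t)\<^sup>2)) = integral {y * 0..y * 1} (\<lambda>v. cis (- v\<^sup>2))"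
    by (rule integral_unique)
  then have "fresnel y = integral {0..1} (\<lambda>t. y *\<^sub>R cis (- (y * t)\<^sup>2))"
    by (simp only: fresnel_def mult_zero_right mult_1_right)
  also have "\<dots> = of_real y * integral {0..1} (\<lambda>t. cis (- (y * t)\<^sup>2))"
    by (simp only: scaleR_conv_of_real integral_mult_right)
  finally show ?thesis by simp
qed

text \<open>Differentiation under the integral cancels the denominator 1 + t^2. The exponential then
  factors into \<open>cis (- y\<^sup>2)\<close> and a part depending on y t only, which the
  substitution v = y t turns into \<open>fresnel y\<close>.\<close>

lemma fresnel_aux_deriv:
  assumes "0 \<le> y" "y \<le> b"
  shows "(fresnel_aux has_vector_derivative - 2 * \<i> * cis (- y\<^sup>2) * fresnel y) (at y within {0..b})"
proof -
  note ne = one_plus_square_nonzero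
  have "((\<lambda>y. integral (cbox 0 1) (\<lambda>t. cis (- (y\<^sup>2 * (1 + t\<^sup>2))) / of_real (1 + t\<^sup>2))) has_vector_derivative
     integral (cbox 0 1) (\<lambda>t. - 2 * \<i> * of_real y * cis (- (y\<^sup>2 * (1 + t\<^sup>2))))) (at y within {0..b})"
  proof (rule leibniz_rule_vector_derivative)
    fix x t :: real
    have 1: "((\<lambda>x. cos (x\<^sup>2 * (1 + t\<^sup>2)) / (1 + t\<^sup>2)) has_real_derivative - 2 * x * sin (x\<^sup>2 * (1 + t\<^sup>2))) (at x within {0..b})"
      using ne(1)[of t] by (auto intro!: derivative_eq_intros)
    have 2: "((\<lambda>x. - (sin (x\<^sup>2 * (1 + t\<^sup>2)) / (1 + t\<^sup>2))) has_real_derivative - 2 * x * cos (x\<^sup>2 * (1 + t\<^sup>2))) (at x within {0..b})"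
      using ne(1)[of t] by (auto intro!: derivative_eq_intros)
    have "((\<lambda>x. cis (- (x\<^sup>2 * (1 + t\<^sup>2))) / of_real (1 + t\<^sup>2)) has_vector_derivative
       Complex (- 2 * x * sin (x\<^sup>2 * (1 + t\<^sup>2))) (- 2 * x * cos (x\<^sup>2 * (1 + t\<^sup>2)))) (at x within {0..b})"
      using 1 2 by (simp add: has_vector_derivative_complex_iff has_real_derivative_iff_has_vector_derivative del: of_real_add)
    also have "Complex (- 2 * x * sin (x\<^sup>2 * (1 + t\<^sup>2))) (- 2 * x * cos (x\<^sup>2 * (1 + t\<^sup>2))) = - 2 * \<i> * of_real x * cis (- (x\<^sup>2 * (1 + t\<^sup>2)))"
      by (simp add: complex_eq_iff)
    finally show "((\<lambda>x. cis (- (x\<^sup>2 * (1 + t\<^sup>2))) / of_real (1 + t\<^sup>2)) has_vector_derivative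
       - 2 * \<i> * of_real x * cis (- (x\<^sup>2 * (1 + t\<^sup>2)))) (at x within {0..b})" .
  next
    fix x :: real
    show "(\<lambda>t. cis (- (x\<^sup>2 * (1 + t\<^sup>2))) / of_real (1 + t\<^sup>2)) integrable_on cbox 0 1"
      by (intro integrable_continuous continuous_intros) (use ne in auto)
  next
    show "continuous_on ({0..b} \<times> cbox 0 1) (\<lambda>(x, t). - 2 * \<i> * of_real x * cis (- (x\<^sup>2 * (1 + t\<^sup>2))))"
      unfolding case_prod_unfold by (intro continuous_intros)
  qed (use assms in auto)
  moreover have "integral (cbox 0 1) (\<lambda>t. - 2 * \<i> * of_real y * cis (- (y\<^sup>2 * (1 + t\<^sup>2)))) =
     - 2 * \<i> * cis (- y\<^sup>2) * fresnel y"
  proof -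
    have "- 2 * \<i> * of_real y * cis (- (y\<^sup>2 * (1 + t\<^sup>2))) = - 2 * \<i> * cis (- y\<^sup>2) * of_real y * cis (- (y * t)\<^sup>2)" for t
    proof -
      have "cis (- (y\<^sup>2 * (1 + t\<^sup>2))) = cis (- y\<^sup>2) * cis (- (y * t)\<^sup>2)"
        unfolding cis_mult by (simp add: algebra_simps power_mult_distrib)
      then show ?thesis by simp
    qed
    then have "integral (cbox 0 1) (\<lambda>t. - 2 * \<i> * of_real y * cis (- (y\<^sup>2 * (1 + t\<^sup>2)))) =
       - 2 * \<i> * cis (- y\<^sup>2) * of_real y * integral {0..1} (\<lambda>t. cis (- (y * t)\<^sup>2))"
      by (simp only: integral_mult_right cbox_interval)
    also have "\<dots> = - 2 * \<i> * cis (- y\<^sup>2) * fresnel y"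
      using fresnel_scaled[OF assms(1)] by (simp only: mult.assoc)
    finally show ?thesis .
  qed
  ultimately show ?thesis by (simp only: fresnel_aux_def[abs_def] cbox_interval)
qed

text \<open>The oscillatory version of a classical evaluation of the Gaussian integral. The constant
  pi/4 is the value at y = 0, the integral of 1/(1 + t^2) over [0, 1].\<close>

lemma fresnel_square:
  assumes "0 \<le> b"
  shows "(fresnel b)\<^sup>2 = \<i> * (fresnel_aux b - of_real (pi / 4))"
proof -
  have "((\<lambda>y. fresnel y * fresnel y - \<i> * fresnel_aux y) has_vector_derivative 0) (at y within {0..b})"
    if y: "y \<in> {0..b}" for y
  proof -
    have "((\<lambda>y. fresnel y * fresnel y - \<i> * fresnel_aux y) has_vector_derivative
        (fresnel y * cis (- y\<^sup>2) + cis (- y\<^sup>2) * fresnel y) - \<i> * (- 2 * \<i> * cis (- y\<^sup>2) * fresnel y)) (at y within {0..b})"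
      using y by (intro has_vector_derivative_diff has_vector_derivative_mult
          has_vector_derivative_mult_right fresnel_deriv fresnel_aux_deriv) auto
    then show ?thesis by (simp add: algebra_simps)
  qed
  then have "\<exists>c. \<forall>y\<in>{0..b}. fresnel y * fresnel y - \<i> * fresnel_aux y = c"
    by (rule has_vector_derivative_zero_constant[of "{0..b}", rotated]) auto
  then have "fresnel b * fresnel b - \<i> * fresnel_aux b = fresnel 0 * fresnel 0 - \<i> * fresnel_aux 0"
    using assms by force
  moreover have "fresnel_aux 0 = of_real (pi / 4)"
  proof -
    have "((\<lambda>t. inverse (1 + t\<^sup>2)) has_integral arctan 1 - arctan 0) {0..1}"
      by (intro fundamental_theorem_of_calculus)
         (auto simp flip: has_real_derivative_iff_has_vector_derivative intro!: derivative_eq_intros)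
    then have "((\<lambda>t. complex_of_real (inverse (1 + t\<^sup>2))) has_integral of_real (pi / 4)) {0..1}"
      by (intro has_integral_of_real) (simp add: arctan_one)
    then show ?thesis by (simp add: fresnel_aux_def integral_unique inverse_eq_divide)
  qed
  moreover have "fresnel 0 = 0" by (simp add: fresnel_def)
  ultimately show ?thesis by (simp add: power2_eq_square algebra_simps)
qed

text \<open>The trivial bound on the integral is only y. The square identity gives |fresnel y|^2
  \<le> 1 + pi/4 without any knowledge of the limit, and this uniform bound is what makes
  \<open>fresnel_aux\<close> decay.\<close>

lemma fresnel_bounded:
  assumes "0 \<le> y" shows "norm (fresnel y) \<le> 2"
proof -
  note ne = one_plus_square_nonzero
  have "norm (fresnel_aux y) \<le> integral {0..1} (\<lambda>t::real. 1)"
    unfolding fresnel_aux_def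
  proof (rule Henstock_Kurzweil_Integration.integral_norm_bound_integral)
    show "(\<lambda>t. cis (- (y\<^sup>2 * (1 + t\<^sup>2))) / complex_of_real (1 + t\<^sup>2)) integrable_on {0..1}"
      by (intro integrable_continuous_real continuous_intros) (use ne in auto)
    fix t :: real
    have "1 / (1 + t\<^sup>2) \<le> 1 / 1" by (intro frac_le) auto
    moreover have "\<bar>1 + t\<^sup>2\<bar> = 1 + t\<^sup>2" by (intro abs_of_nonneg add_nonneg_nonneg) auto
    ultimately show "norm (cis (- (y\<^sup>2 * (1 + t\<^sup>2))) / complex_of_real (1 + t\<^sup>2)) \<le> 1"
      by (simp only: norm_divide norm_cis norm_of_real div_by_1)
  qed auto
  then have "norm (fresnel_aux y) \<le> 1" by simp
  moreover have "norm (fresnel_aux y - of_real (pi / 4)) \<le> norm (fresnel_aux y) + pi / 4"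
    by (rule order_trans[OF norm_triangle_ineq4]) simp
  ultimately have "norm ((fresnel y)\<^sup>2) \<le> 2\<^sup>2"
    unfolding fresnel_square[OF assms] using pi_less_4 by (simp add: norm_mult)
  then show ?thesis by (simp only: norm_power) (rule power2_le_imp_le, auto)
qed

text \<open>Split 1/(1 + t^2) = 1 - t^2/(1 + t^2). The first part is fresnel y / y up to a factor of
  modulus one, hence at most 2/y. The second vanishes at the stationary point t = 0; writing it with
  the factor 2t, the derivative of t^2, makes integration by parts applicable.\<close>

lemma fresnel_aux_tendsto: "(fresnel_aux \<longlongrightarrow> 0) at_top"
proof -
  note ne = one_plus_square_nonzero
  obtain C where C: "C \<ge> 0" "\<And>X. X > 0 \<Longrightarrow>
     norm (integral {0..1} (\<lambda>t. cis (- (X * t\<^sup>2)) * of_real (2 * t * (t / (2 * (1 + t\<^sup>2)))))) \<le> C / X"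
  proof (rule oscillatory_integral_bound[where a = 0 and b = 1 and \<psi> = "\<lambda>t. t\<^sup>2" and \<psi>' = "\<lambda>t. 2 * t"
        and m = "\<lambda>t. t / (2 * (1 + t\<^sup>2))" and m' = "\<lambda>t. (1 - t\<^sup>2) / (2 * (1 + t\<^sup>2)\<^sup>2)"])
    fix t :: real
    show "((\<lambda>t. t / (2 * (1 + t\<^sup>2))) has_real_derivative (1 - t\<^sup>2) / (2 * (1 + t\<^sup>2)\<^sup>2)) (at t)"
      using ne[of t] by (auto intro!: derivative_eq_intros simp: divide_simps power2_eq_square) (simp add: algebra_simps)
  qed (use ne in \<open>auto intro!: derivative_eq_intros continuous_intros\<close>)
  have bound: "norm (fresnel_aux y) \<le> 2 / y + C / y\<^sup>2" if y: "y > 0" for y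
  proof -
    have "cis (- (y\<^sup>2 * (1 + t\<^sup>2))) / of_real (1 + t\<^sup>2) =
       cis (- y\<^sup>2) * (cis (- (y * t)\<^sup>2) - cis (- (y\<^sup>2 * t\<^sup>2)) * of_real (2 * t * (t / (2 * (1 + t\<^sup>2)))))" for t
    proof -
      have e1: "cis (- (y\<^sup>2 * (1 + t\<^sup>2))) = cis (- y\<^sup>2) * cis (- (y * t)\<^sup>2)"
        unfolding cis_mult by (simp add: algebra_simps power_mult_distrib)
      have "1 / (1 + t\<^sup>2) = 1 - 2 * t * (t / (2 * (1 + t\<^sup>2)))"
        using ne[of t] by (simp add: field_simps power2_eq_square)
      then have e2: "1 / of_real (1 + t\<^sup>2) = 1 - complex_of_real (2 * t * (t / (2 * (1 + t\<^sup>2))))"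
        by (metis of_real_1 of_real_diff of_real_divide)
      have "cis (- (y\<^sup>2 * (1 + t\<^sup>2))) / of_real (1 + t\<^sup>2) = cis (- y\<^sup>2) * (cis (- (y * t)\<^sup>2) * (1 / of_real (1 + t\<^sup>2)))"
        by (simp only: e1 times_divide_eq_right mult_1_right)
      then show ?thesis
        by (simp only: e2 right_diff_distrib mult_1_right power_mult_distrib)
    qed
    moreover have "2 + 2 * t\<^sup>2 \<noteq> 0" for t :: real
      by (metis add_pos_nonneg less_irrefl mult_nonneg_nonneg zero_le_numeral zero_le_power2 zero_less_numeral)
    ultimately have "fresnel_aux y = cis (- y\<^sup>2) * (integral {0..1} (\<lambda>t. cis (- (y * t)\<^sup>2)) -
       integral {0..1} (\<lambda>t. cis (- (y\<^sup>2 * t\<^sup>2)) * of_real (2 * t * (t / (2 * (1 + t\<^sup>2))))))"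
      unfolding fresnel_aux_def using ne
      by (simp only: integral_mult_right, subst integral_diff)
         (auto intro!: integrable_continuous_real continuous_intros simp del: of_real_mult of_real_divide)
    then have "norm (fresnel_aux y) \<le> norm (integral {0..1} (\<lambda>t. cis (- (y * t)\<^sup>2))) +
       norm (integral {0..1} (\<lambda>t. cis (- (y\<^sup>2 * t\<^sup>2)) * of_real (2 * t * (t / (2 * (1 + t\<^sup>2))))))"
      by (simp only: norm_mult norm_cis mult_1_left norm_triangle_ineq4)
    also have "norm (integral {0..1} (\<lambda>t. cis (- (y * t)\<^sup>2))) \<le> 2 / y"
    proof -
      have "y * norm (integral {0..1} (\<lambda>t. cis (- (y * t)\<^sup>2))) = norm (fresnel y)"
        using y fresnel_scaled[of y] by (metis abs_of_pos less_imp_le norm_mult norm_of_real)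
      then show ?thesis using fresnel_bounded[of y] y by (simp add: field_simps)
    qed
    also have "norm (integral {0..1} (\<lambda>t. cis (- (y\<^sup>2 * t\<^sup>2)) * of_real (2 * t * (t / (2 * (1 + t\<^sup>2)))))) \<le> C / y\<^sup>2"
      by (rule C(2)) (use y in simp)
    finally show ?thesis by simp
  qed
  show ?thesis
  proof (rule Lim_null_comparison)
    show "eventually (\<lambda>y. norm (fresnel_aux y) \<le> 2 / y + C / y\<^sup>2) at_top"
      using eventually_gt_at_top[of 0] by eventually_elim (rule bound)
    show "((\<lambda>y. 2 / y + C / y\<^sup>2) \<longlongrightarrow> 0) at_top" by real_asymp
  qed
qed

text \<open>This selects the right square root in the evaluation of the limit. With S = -Im fresnel,
  so that S' = sin(t^2), the comparison function (1 - cos(t^2))/(2t) is what one integration by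
  parts produces: it is nonnegative, and S minus it has the nonnegative derivative (1 -
  cos(t^2))/(2t^2).\<close>

lemma Im_fresnel_nonpos:
  assumes "y \<ge> 1"
  shows "Im (fresnel y) \<le> 0"
proof -
  define S where "S y = - Im (fresnel y)" for y
  have dS: "(S has_real_derivative sin (t\<^sup>2)) (at t)" if "t > 0" for t
  proof -
    have "(fresnel has_vector_derivative cis (- t\<^sup>2)) (at t within {0..t+1})"
      using that by (intro fresnel_deriv) auto
    then have "(fresnel has_vector_derivative cis (- t\<^sup>2)) (at t)"
      using that at_within_interior[of t "{0..t+1}"] by simp
    then show ?thesis unfolding S_def[abs_def]
      by (auto simp: has_vector_derivative_complex_iff has_real_derivative_iff_has_vector_derivative dest: has_vector_derivative_minus)
  qed
  have "S 1 - (1 - cos (1\<^sup>2)) / (2 * 1) \<le> S y - (1 - cos (y\<^sup>2)) / (2 * y)"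
  proof (rule DERIV_nonneg_imp_nondecreasing[OF assms])
    fix t :: real assume t: "1 \<le> t"
    have "((\<lambda>y. S y - (1 - cos (y\<^sup>2)) / (2 * y)) has_real_derivative (1 - cos (t\<^sup>2)) / (2 * t\<^sup>2)) (at t)"
      using t by (auto intro!: derivative_eq_intros dS simp: field_simps power2_eq_square)
    then show "\<exists>z. ((\<lambda>y. S y - (1 - cos (y\<^sup>2)) / (2 * y)) has_real_derivative z) (at t) \<and> 0 \<le> z"
      by (intro exI conjI, assumption) auto
  qed
  \<comment> \<open>The starting value at 1: inserting the factor v \<le> 1 makes the integrand v
    sin(v^2), which has an elementary primitive.\<close>
  moreover have "(1 - cos 1) / 2 \<le> S 1"
  proof -
    have "((\<lambda>v::real. v * sin (v\<^sup>2)) has_integral - cos (1\<^sup>2) / 2 - - cos (0\<^sup>2) / 2) {0..1}"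
      by (intro fundamental_theorem_of_calculus)
         (auto simp flip: has_real_derivative_iff_has_vector_derivative intro!: derivative_eq_intros)
    moreover have "((\<lambda>v. sin (v\<^sup>2)) has_integral S 1) {0..1}"
    proof -
      have "((\<lambda>v. cis (- v\<^sup>2)) has_integral fresnel 1) {0..1}"
        unfolding fresnel_def by (intro integrable_integral integrable_continuous_real continuous_intros)
      then have "((\<lambda>v. - Im (cis (- v\<^sup>2))) has_integral S 1) {0..1}"
        unfolding S_def by (intro has_integral_neg has_integral_Im)
      then show ?thesis by simp
    qed
    ultimately have "- cos (1\<^sup>2) / 2 - - cos (0\<^sup>2) / (2::real) \<le> S 1"
    proof (rule has_integral_le)
      fix v :: real assume v: "v \<in> {0..1}"
      then have "v\<^sup>2 \<le> 1" by (simp add: power_le_one)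
      then have "sin (v\<^sup>2) \<ge> 0" using pi_gt3 by (intro sin_ge_zero) auto
      then show "v * sin (v\<^sup>2) \<le> sin (v\<^sup>2)" using v by (intro mult_left_le_one_le) auto
    qed
    then show ?thesis by (simp add: field_simps)
  qed
  moreover have "(1 - cos (y\<^sup>2)) / (2 * y) \<ge> 0" using assms by (intro divide_nonneg_nonneg) auto
  ultimately have "0 \<le> S y" by (simp only: power_one mult_1_right)
  then show ?thesis by (simp add: S_def)
qed

text \<open>Factor fresnel^2 - L^2 = (fresnel - L)(fresnel + L). The left side equals \<i> times
  \<open>fresnel_aux\<close>, which tends to 0, while fresnel + L stays at distance at least c = -Im
  L from 0, because both imaginary parts are at most 0.\<close>

theorem fresnel_tendsto: "(fresnel \<longlongrightarrow> of_real (sqrt pi / 2) * cis (- pi / 4)) at_top"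
proof -
  define L where "L = of_real (sqrt pi / 2) * cis (- pi / 4)"
  have L2: "L\<^sup>2 = - \<i> * of_real (pi / 4)"
  proof -
    have "L\<^sup>2 = of_real ((sqrt pi / 2)\<^sup>2) * (cis (- pi / 4))\<^sup>2"
      unfolding L_def by (simp only: power_mult_distrib of_real_power)
    also have "(cis (- pi / 4))\<^sup>2 = cis (- (pi / 2))" by (simp add: power2_eq_square cis_mult)
    also have "\<dots> = - \<i>" by (simp add: complex_eq_iff)
    finally show ?thesis by (simp add: power_divide)
  qed
  define c where "c = - Im L"
  have c: "c > 0" by (simp add: c_def L_def sin_45)
  have "((\<lambda>y. fresnel y - L) \<longlongrightarrow> 0) at_top"
  proof (rule Lim_null_comparison)
    have "((\<lambda>y. norm (fresnel_aux y) / c) \<longlongrightarrow> 0 / c) at_top"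
      by (intro tendsto_intros tendsto_norm_zero fresnel_aux_tendsto) (use c in simp)
    then show "((\<lambda>y. norm (fresnel_aux y) / c) \<longlongrightarrow> 0) at_top" by simp
    show "eventually (\<lambda>y. norm (fresnel y - L) \<le> norm (fresnel_aux y) / c) at_top"
      using eventually_ge_at_top[of 1]
    proof eventually_elim
      case (elim y)
      have "c \<le> \<bar>Im (fresnel y + L)\<bar>" using Im_fresnel_nonpos[OF elim] by (simp add: c_def)
      also have "\<dots> \<le> norm (fresnel y + L)" by (rule abs_Im_le_cmod)
      finally have "norm (fresnel y - L) * c \<le> norm (fresnel y - L) * norm (fresnel y + L)"
        by (intro mult_left_mono) auto
      also have "\<dots> = norm ((fresnel y)\<^sup>2 - L\<^sup>2)"
        by (simp add: power2_eq_square algebra_simps flip: norm_mult)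
      also have "(fresnel y)\<^sup>2 - L\<^sup>2 = \<i> * fresnel_aux y"
        using fresnel_square[of y] elim by (simp add: L2 algebra_simps)
      finally show ?case using c by (simp add: norm_mult field_simps)
    qed
  qed
  then show ?thesis unfolding L_def by (rule LIM_zero_cancel)
qed


section \<open>The leading asymptotics of \<open>J\<^sub>0\<close>\<close>

text \<open>The derivative of sin t cos^(2m+1) t yields the reduction formula, and its boundary
  values vanish at both ends.\<close>

lemma wallis_integral:
  "((\<lambda>t. cos t ^ (2 * m)) has_integral pi / 2 * (fact (2 * m) / (4 ^ m * (fact m)\<^sup>2))) {0..pi/2}"
proof (induction m)
  case 0
  then show ?case using has_integral_const_real[of "1::real" 0 "pi/2"] by simp
next
  case (Suc m)
  define W where "W = pi / 2 * (fact (2 * m) / (4 ^ m * (fact m)\<^sup>2) :: real)"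
  have "((\<lambda>t. (2 * real m + 2) * cos t ^ (2 * Suc m) - (2 * real m + 1) * cos t ^ (2 * m)) has_integral
          sin (pi / 2) * cos (pi / 2) ^ (2 * m + 1) - sin 0 * cos 0 ^ (2 * m + 1)) {0..pi/2}"
  proof (intro fundamental_theorem_of_calculus)
    fix t :: real
    have "((\<lambda>t. sin t * cos t ^ (2 * m + 1)) has_real_derivative
       cos t * cos t ^ (2 * m + 1) + sin t * (real (2 * m + 1) * (cos t ^ (2 * m) * - sin t))) (at t)"
      by (rule derivative_eq_intros refl)+ simp
    also have "cos t * cos t ^ (2 * m + 1) + sin t * (real (2 * m + 1) * (cos t ^ (2 * m) * - sin t)) =
       cos t ^ (2 * Suc m) - (2 * real m + 1) * ((sin t)\<^sup>2 * cos t ^ (2 * m))"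
      by (simp add: algebra_simps power2_eq_square)
    also have "\<dots> = (2 * real m + 2) * cos t ^ (2 * Suc m) - (2 * real m + 1) * cos t ^ (2 * m)"
      by (simp only: sin_squared_eq) (simp add: algebra_simps power2_eq_square)
    finally show "((\<lambda>t. sin t * cos t ^ (2 * m + 1)) has_vector_derivative
        (2 * real m + 2) * cos t ^ (2 * Suc m) - (2 * real m + 1) * cos t ^ (2 * m)) (at t within {0..pi/2})"
      unfolding has_real_derivative_iff_has_vector_derivative by (rule has_vector_derivative_at_within)
  qed simp
  moreover have "((\<lambda>t. (2 * real m + 1) * cos t ^ (2 * m)) has_integral (2 * real m + 1) * W) {0..pi/2}"
    using Suc unfolding W_def by (rule has_integral_mult_right)
  ultimately have "((\<lambda>t. (2 * real m + 2) * cos t ^ (2 * Suc m) - (2 * real m + 1) * cos t ^ (2 * m) +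
       (2 * real m + 1) * cos t ^ (2 * m)) has_integral
       sin (pi / 2) * cos (pi / 2) ^ (2 * m + 1) - sin 0 * cos 0 ^ (2 * m + 1) + (2 * real m + 1) * W) {0..pi/2}"
    by (rule has_integral_add)
  then have "((\<lambda>t. (2 * real m + 2) * cos t ^ (2 * Suc m)) has_integral (2 * real m + 1) * W) {0..pi/2}"
    by simp
  then have "((\<lambda>t. inverse (2 * real m + 2) * ((2 * real m + 2) * cos t ^ (2 * Suc m))) has_integral
      inverse (2 * real m + 2) * ((2 * real m + 1) * W)) {0..pi/2}"
    by (rule has_integral_mult_right)
  moreover have "inverse (2 * real m + 2) * ((2 * real m + 2) * c) = c" for c
    by (simp add: field_simps)
  moreover have "inverse (2 * real m + 2) * ((2 * real m + 1) * W) =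
      pi / 2 * (fact (2 * Suc m) / (4 ^ Suc m * (fact (Suc m))\<^sup>2))"
    by (simp add: W_def divide_simps power2_eq_square) (simp add: algebra_simps)
  ultimately show ?case by (simp only:)
qed

text \<open>Expand the cosine and integrate termwise by Wallis' formula. The majorant (x^2)^i / i!
  gives uniform convergence, as (2i)! \<ge> i!.\<close>

lemma bessel_J_0_integral:
  assumes x: "x > 0"
  shows "((\<lambda>t. cos (x * cos t)) has_integral pi / 2 * bessel_J 0 x) {0..pi/2}"
proof -
  define g where "g i t = (-1) ^ i / fact (2 * i) * (x * cos t) ^ (2 * i)" for i t
  define c where "c i = pi / 2 * (bessel_coeff 0 i * ((x / 2)\<^sup>2) ^ i)" for i
  have u: "uniform_limit {0..pi/2} (\<lambda>n t. \<Sum>i<n. g i t) (\<lambda>t. \<Sum>i. g i t) sequentially"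
  proof (rule Weierstrass_m_test)
    show "summable (\<lambda>i. inverse (fact i) * (x\<^sup>2) ^ i)" by (rule summable_exp)
    fix i and t :: real
    have "\<bar>g i t\<bar> = (x\<^sup>2) ^ i * (\<bar>cos t\<bar> ^ (2 * i) / fact (2 * i))"
      by (simp add: g_def abs_mult power_abs power_mult_distrib power_mult)
    also have "\<dots> \<le> (x\<^sup>2) ^ i * (1 / fact i)"
      by (intro mult_left_mono frac_le power_le_one fact_mono) auto
    finally show "norm (g i t) \<le> inverse (fact i) * (x\<^sup>2) ^ i" by (simp add: field_simps)
  qed
  have gs: "(\<lambda>i. g i t) sums cos (x * cos t)" for t
    unfolding g_def by (rule cos_paired)
  have gi: "(g i has_integral c i) {0..pi/2}" for i
  proof -
    have "((\<lambda>t. (-1) ^ i / fact (2 * i) * x ^ (2 * i) * cos t ^ (2 * i)) has_integral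
       (-1) ^ i / fact (2 * i) * x ^ (2 * i) * (pi / 2 * (fact (2 * i) / (4 ^ i * (fact i)\<^sup>2)))) {0..pi/2}"
      by (rule has_integral_mult_right[OF wallis_integral])
    moreover have "(-1) ^ i / fact (2 * i) * x ^ (2 * i) * (pi / 2 * (fact (2 * i) / (4 ^ i * (fact i)\<^sup>2))) = c i"
    proof -
      have "rGamma (real i + 0 + 1) = inverse (fact i)"
        using Gamma_fact[of i, where 'a = real] by (simp add: rGamma_inverse_Gamma add.commute)
      moreover have "((x / 2)\<^sup>2) ^ i = x ^ (2 * i) / 4 ^ i"
        by (simp add: power_divide power_mult)
      ultimately show ?thesis
        by (simp add: c_def bessel_coeff_def power2_eq_square field_simps)
    qed
    ultimately show ?thesis by (simp add: g_def[abs_def] power_mult_distrib mult.assoc)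
  qed
  obtain I J where IJ: "\<And>n. ((\<lambda>t. \<Sum>i<n. g i t) has_integral I n) {0..pi/2}"
    "((\<lambda>t. \<Sum>i. g i t) has_integral J) {0..pi/2}" "I \<longlonglongrightarrow> J"
  proof (rule uniform_limit_integral_cbox[where a = 0 and b = "pi/2" and f = "\<lambda>n t. \<Sum>i<n. g i t"
        and g = "\<lambda>t. \<Sum>i. g i t" and F = sequentially])
    show "continuous_on (cbox 0 (pi / 2)) (\<lambda>t. \<Sum>i<n. g i t)" for n
      unfolding g_def by (intro continuous_intros)
  qed (use u in auto)
  have "I n = (\<Sum>i<n. c i)" for n
    using IJ(1)[of n] has_integral_sum[of "{..<n}" g c] gi by (intro has_integral_unique) auto
  then have "I = (\<lambda>n. \<Sum>i<n. c i)" by (rule ext)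
  with IJ(3) have "c sums J" by (simp only: sums_def)
  moreover have "c sums (pi / 2 * bessel_series 0 ((x / 2)\<^sup>2))"
    unfolding c_def
    using summable_sums[OF bessel_series_summable[of 0 "(x / 2)\<^sup>2"]]
    by (intro sums_mult) (simp add: bessel_series_def)
  ultimately have "J = pi / 2 * bessel_series 0 ((x / 2)\<^sup>2)"
    by (rule sums_unique2)
  then have "J = pi / 2 * bessel_J 0 x" using x by (simp add: bessel_J_series)
  moreover have "(\<lambda>t. \<Sum>i. g i t) = (\<lambda>t. cos (x * cos t))"
    using gs by (simp add: sums_iff)
  ultimately show ?thesis using IJ(2) by (simp only:)
qed

text \<open>Since 1 - cos t = 2 sin^2(t/2), the substitution v = sqrt(2x) sin(t/2) makes the phase
  exactly v^2 and sends pi/2 to sqrt x. It requires a factor cos(t/2); the remaining 1 - cos(t/2)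
  vanishes at the stationary point and contributes only O(1/x).\<close>

lemma stationary_phase_integral:
  "((\<lambda>x. of_real (sqrt x) * integral {0..pi/2} (\<lambda>t. cis (- (x * (1 - cos t))))) \<longlongrightarrow>
     of_real (sqrt (pi / 2)) * cis (- pi / 4)) at_top"
proof -
  \<comment> \<open>This is (1 - cos(t/2)) / sin t after cancelling sin(t/4) by the double-angle
    formulas. In this form the quotient is smooth at t = 0, and its denominator has no zero on
    [0, pi/2].\<close>
  define m where "m t = sin (t / 4) / (2 * cos (t / 4) * cos (t / 2))" for t :: real
  define m' where "m' t = (cos (t / 4) / 4 * (2 * cos (t / 4) * cos (t / 2)) -
     sin (t / 4) * (- sin (t / 4) / 2 * cos (t / 2) - cos (t / 4) * sin (t / 2))) /
       (2 * cos (t / 4) * cos (t / 2))\<^sup>2" for t :: real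
  have pos: "cos (t / 4) > 0" "cos (t / 2) > 0" if "t \<in> {0..pi/2}" for t :: real
  proof -
    have "0 \<le> t" "t \<le> pi / 2" using that by auto
    with pi_gt_zero show "cos (t / 4) > 0" "cos (t / 2) > 0" by (intro cos_gt_zero_pi; linarith)+
  qed
  obtain C where C: "C \<ge> 0" "\<And>X. X > 0 \<Longrightarrow>
     norm (integral {0..pi/2} (\<lambda>t. cis (- (X * (1 - cos t))) * of_real (sin t * m t))) \<le> C / X"
  proof (rule oscillatory_integral_bound[where a = 0 and b = "pi/2" and \<psi> = "\<lambda>t. 1 - cos t" and \<psi>' = sin
        and m = m and m' = m'])
    fix t :: real assume t: "t \<in> {0..pi/2}"
    show "(m has_real_derivative m' t) (at t)"
      unfolding m_def[abs_def] m'_def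
      using pos[OF t] by (auto intro!: derivative_eq_intros simp: power2_eq_square) 
  next
    show "continuous_on {0..pi/2} m'"
      unfolding m'_def by (intro continuous_intros) (use pos in \<open>simp; force\<close>)+
  qed (auto intro!: derivative_eq_intros continuous_intros)
  have m: "sin t * m t = 1 - cos (t / 2)" if t: "t \<in> {0..pi/2}" for t
  proof -
    have "sin t = 2 * sin (t / 2) * cos (t / 2)" using sin_double[of "t / 2"] by simp
    moreover have "sin (t / 2) = 2 * sin (t / 4) * cos (t / 4)" using sin_double[of "t / 4"] by simp
    moreover have "1 - cos (t / 2) = 2 * (sin (t / 4))\<^sup>2" using cos_double_sin[of "t / 4"] by simp
    ultimately show ?thesis using pos[OF t] by (simp add: m_def power2_eq_square)
  qed
  define G where "G x = integral {0..pi/2} (\<lambda>t. cis (- (x * (1 - cos t))))" for x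
  define H where "H x = integral {0..pi/2} (\<lambda>t. cis (- (x * (1 - cos t))) * of_real (sin t * m t))" for x
  have main: "of_real (sqrt x) * G x = of_real (sqrt 2) * fresnel (sqrt x) + of_real (sqrt x) * H x" if x: "x > 0" for x
  proof -
    define s where "s = sqrt (2 * x)"
    have s: "s > 0" "s\<^sup>2 = 2 * x" using x by (simp_all add: s_def)
    have "((\<lambda>t. (s * cos (t / 2) / 2) *\<^sub>R cis (- (s * sin (t / 2))\<^sup>2)) has_integral
       integral {s * sin (0 / 2)..s * sin (pi / 2 / 2)} (\<lambda>v. cis (- v\<^sup>2))) {0..pi/2}"
    proof (rule has_integral_substitution[where c = "-s" and d = s])
      show "(\<lambda>t. s * sin (t / 2)) ` {0..pi / 2} \<subseteq> {- s..s}"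
      proof -
        have "\<bar>s * sin (t / 2)\<bar> \<le> s" for t :: real using s by (simp add: abs_mult mult_left_le)
        then show ?thesis by (auto simp: abs_le_iff minus_le_iff)
      qed
    qed (use s in \<open>auto intro!: derivative_eq_intros continuous_intros mult_nonneg_nonneg sin_ge_zero simp: field_simps\<close>)
    also have "s * sin (0 / 2) = 0" by simp
    also have "s * sin (pi / 2 / 2) = sqrt x"
      using x by (simp add: s_def sin_45 real_sqrt_mult)
    also have "(\<lambda>t. (s * cos (t / 2) / 2) *\<^sub>R cis (- (s * sin (t / 2))\<^sup>2)) =
      (\<lambda>t. of_real (s / 2) * (cis (- (x * (1 - cos t))) * of_real (cos (t / 2))))"
    proof
      fix t :: real
      have "1 - cos t = 2 * (sin (t / 2))\<^sup>2" using cos_double_sin[of "t / 2"] by simp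
      then show "(s * cos (t / 2) / 2) *\<^sub>R cis (- (s * sin (t / 2))\<^sup>2) =
        of_real (s / 2) * (cis (- (x * (1 - cos t))) * of_real (cos (t / 2)))"
        by (simp add: power_mult_distrib s(2) scaleR_conv_of_real mult_ac)
    qed
    finally have F: "of_real (s / 2) * integral {0..pi/2} (\<lambda>t. cis (- (x * (1 - cos t))) * of_real (cos (t / 2))) = fresnel (sqrt x)"
      unfolding fresnel_def integral_mult_right[symmetric] by (rule integral_unique)
    have "G x = integral {0..pi/2} (\<lambda>t. cis (- (x * (1 - cos t))) * of_real (cos (t / 2)) +
          cis (- (x * (1 - cos t))) * of_real (1 - cos (t / 2)))"
      unfolding G_def by (simp add: algebra_simps)
    also have "\<dots> = integral {0..pi/2} (\<lambda>t. cis (- (x * (1 - cos t))) * of_real (cos (t / 2))) +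
        integral {0..pi/2} (\<lambda>t. cis (- (x * (1 - cos t))) * of_real (1 - cos (t / 2)))"
      by (intro integral_add integrable_continuous_real continuous_intros) auto
    also have "integral {0..pi/2} (\<lambda>t. cis (- (x * (1 - cos t))) * of_real (1 - cos (t / 2))) = H x"
      unfolding H_def by (rule integral_cong) (simp only: m)
    finally have "of_real (sqrt x) * G x = of_real (sqrt x) *
       integral {0..pi/2} (\<lambda>t. cis (- (x * (1 - cos t))) * of_real (cos (t / 2))) + of_real (sqrt x) * H x"
      by (simp only: distrib_left)
    moreover have "sqrt x = sqrt 2 * (s / 2)"
      using x by (simp add: s_def real_sqrt_mult)
    then have "of_real (sqrt x) * integral {0..pi/2} (\<lambda>t. cis (- (x * (1 - cos t))) * of_real (cos (t / 2))) =
        of_real (sqrt 2) * fresnel (sqrt x)"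
      unfolding F[symmetric] by (simp only: of_real_mult mult.assoc)
    ultimately show ?thesis by (simp only:)
  qed
  have "((\<lambda>x. of_real (sqrt 2) * fresnel (sqrt x) + of_real (sqrt x) * H x) \<longlongrightarrow>
      of_real (sqrt 2) * (of_real (sqrt pi / 2) * cis (- pi / 4)) + 0) at_top"
  proof (intro tendsto_add tendsto_mult tendsto_const)
    show "((\<lambda>x. fresnel (sqrt x)) \<longlongrightarrow> of_real (sqrt pi / 2) * cis (- pi / 4)) at_top"
      by (rule filterlim_compose[OF fresnel_tendsto]) real_asymp
    show "((\<lambda>x. of_real (sqrt x) * H x) \<longlongrightarrow> 0) at_top"
    proof (rule Lim_null_comparison)
      show "eventually (\<lambda>x. norm (of_real (sqrt x) * H x) \<le> sqrt x * (C / x)) at_top"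
        using eventually_gt_at_top[of 0]
      proof eventually_elim
        case (elim x)
        have "sqrt x * norm (H x) \<le> sqrt x * (C / x)"
          unfolding H_def using elim by (intro mult_left_mono C(2)) auto
        then show ?case using elim by (simp add: norm_mult)
      qed
      show "((\<lambda>x. sqrt x * (C / x)) \<longlongrightarrow> 0) at_top" by real_asymp
    qed
  qed
  moreover have "sqrt 2 * (sqrt pi / 2) = sqrt (pi / 2)"
    by (simp add: real_sqrt_divide field_simps)
  then have "of_real (sqrt 2) * (of_real (sqrt pi / 2) * cis (- pi / 4)) + 0 = of_real (sqrt (pi / 2)) * cis (- pi / 4)"
    by (metis add.right_neutral mult.assoc of_real_mult)
  moreover have "eventually (\<lambda>x. of_real (sqrt 2) * fresnel (sqrt x) + of_real (sqrt x) * H x = of_real (sqrt x) * G x) at_top"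
    using eventually_gt_at_top[of 0] by eventually_elim (simp only: main)
  ultimately show ?thesis unfolding G_def by (simp only:) (rule Lim_transform_eventually)
qed

text \<open>Multiplication by \<open>cis x\<close> changes the phase -x(1 - cos t) into x cos t, so
  the real part is the integral representation of J of order 0. Having modulus one, the factor
  preserves the error.\<close>

lemma bessel_J_0_asymptotics:
  "((\<lambda>x. sqrt x * bessel_J 0 x - sqrt (2 / pi) * cos (x - pi / 4)) \<longlongrightarrow> 0) at_top"
proof -
  define G where "G x = integral {0..pi/2} (\<lambda>t. cis (- (x * (1 - cos t))))" for x
  define L where "L = of_real (sqrt (pi / 2)) * cis (- pi / 4)"
  have "((\<lambda>x. of_real (sqrt x) * G x - L) \<longlongrightarrow> 0) at_top"
    using stationary_phase_integral unfolding G_def L_def by (rule LIM_zero)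
  from tendsto_norm_zero[OF this]
  have "((\<lambda>x. norm (cis x * (of_real (sqrt x) * G x - L))) \<longlongrightarrow> 0) at_top"
    by (simp only: norm_mult norm_cis mult_1_left)
  then have "((\<lambda>x. cis x * (of_real (sqrt x) * G x - L)) \<longlongrightarrow> 0) at_top"
    by (rule tendsto_norm_zero_cancel)
  then have "((\<lambda>x. Re (cis x * (of_real (sqrt x) * G x - L))) \<longlongrightarrow> Re 0) at_top"
    by (rule tendsto_Re)
  then have lim: "((\<lambda>x. 2 / pi * Re (cis x * (of_real (sqrt x) * G x - L))) \<longlongrightarrow> 0) at_top"
    by (intro tendsto_mult_right_zero) simp
  have "2 / pi * Re (cis x * (of_real (sqrt x) * G x - L)) = sqrt x * bessel_J 0 x - sqrt (2 / pi) * cos (x - pi / 4)"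
    if x: "x > 0" for x
  proof -
    have "((\<lambda>t. cis (- (x * (1 - cos t)))) has_integral G x) {0..pi/2}"
      unfolding G_def by (intro integrable_integral integrable_continuous_real continuous_intros)
    then have "((\<lambda>t. Re (cis x * cis (- (x * (1 - cos t))))) has_integral Re (cis x * G x)) {0..pi/2}"
      by (intro has_integral_Re has_integral_mult_right)
    then have "((\<lambda>t. cos (x * cos t)) has_integral Re (cis x * G x)) {0..pi/2}"
      unfolding cis_mult by (simp add: algebra_simps)
    then have R: "Re (cis x * G x) = pi / 2 * bessel_J 0 x"
      using bessel_J_0_integral[OF x] has_integral_unique by blast
    have "cis x * L = of_real (sqrt (pi / 2)) * cis (x - pi / 4)"
      unfolding L_def by (simp add: cis_mult mult_ac)
    then have ReL: "Re (cis x * L) = sqrt (pi / 2) * cos (x - pi / 4)" by simp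
    have ReG: "Re (cis x * (of_real (sqrt x) * G x)) = sqrt x * (pi / 2 * bessel_J 0 x)"
      unfolding R[symmetric] by (simp add: algebra_simps)
    have c: "2 / pi * sqrt (pi / 2) = sqrt (2 / pi)"
    proof -
      have "2 / pi * sqrt (pi / 2) = sqrt ((2 / pi)\<^sup>2 * (pi / 2))"
        using pi_gt_zero by (simp only: real_sqrt_mult) simp
      also have "(2 / pi)\<^sup>2 * (pi / 2) = 2 / pi" by (simp add: power2_eq_square)
      finally show ?thesis .
    qed
    have "2 / pi * Re (cis x * (of_real (sqrt x) * G x - L)) =
        2 / pi * (sqrt x * (pi / 2 * bessel_J 0 x) - sqrt (pi / 2) * cos (x - pi / 4))"
      by (simp only: right_diff_distrib[of "cis x"] minus_complex.sel ReG ReL)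
    also have "\<dots> = sqrt x * bessel_J 0 x - (2 / pi * sqrt (pi / 2)) * cos (x - pi / 4)"
      by (simp add: field_simps)
    finally show ?thesis unfolding c .
  qed
  then show ?thesis
    by (intro Lim_transform_eventually[OF lim] eventually_mono[OF eventually_gt_at_top[of 0]]) auto
qed


section \<open>Solutions of the perturbed oscillator equation\<close>

lemma norm_diff_le_of_deriv_bound:
  fixes f :: "real \<Rightarrow> complex"
  assumes d: "\<And>x. x \<ge> 1 \<Longrightarrow> (f has_vector_derivative f' x) (at x)"
    and b: "\<And>x. x \<ge> 1 \<Longrightarrow> norm (f' x) \<le> B / x ^ 4"
    and xy: "1 \<le> x" "x \<le> y"
  shows "norm (f y - f x) \<le> B / x ^ 3"
proof (cases "x = y")
  case True
  have "0 \<le> B / 1 ^ 4" using order_trans[OF norm_ge_zero b[of 1]] by simp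
  then show ?thesis using True xy by simp
next
  case False
  have "0 \<le> B / 1 ^ 4" using order_trans[OF norm_ge_zero b[of 1]] by simp
  then have B: "B \<ge> 0" by simp
  define \<phi> where "\<phi> t = - B / (3 * t ^ 3)" for t :: real
  have d\<phi>: "(\<phi> has_real_derivative B / t ^ 4) (at t)" if "t \<ge> 1" for t
    unfolding \<phi>_def[abs_def]
    using that by (auto intro!: derivative_eq_intros simp: divide_simps eval_nat_numeral)
  have "norm (f y - f x) \<le> \<phi> y - \<phi> x"
  proof (rule differentiable_bound_general[where f' = f' and \<phi>' = "\<lambda>t. B / t ^ 4"])
    show "x < y" using False xy by simp
    show "continuous_on {x..y} f"
      by (intro continuous_at_imp_continuous_on ballI has_vector_derivative_continuous[OF d])
        (use xy in auto)
    show "continuous_on {x..y} \<phi>"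
      by (intro continuous_at_imp_continuous_on ballI DERIV_isCont[OF d\<phi>]) (use xy in auto)
    fix t assume t: "x < t" "t < y"
    then show "(f has_vector_derivative f' t) (at t)" using d xy by auto
    show "(\<phi> has_vector_derivative B / t ^ 4) (at t)"
      unfolding has_real_derivative_iff_has_vector_derivative[symmetric]
      using d\<phi> t xy by auto
    show "norm (f' t) \<le> B / t ^ 4" using b t xy by auto
  qed
  also have "\<dots> = B / (3 * x ^ 3) - B / (3 * y ^ 3)" by (simp add: \<phi>_def)
  also have "\<dots> \<le> B / (3 * x ^ 3)" using B xy by simp
  also have "\<dots> \<le> B / x ^ 3" using B xy by (intro divide_left_mono) auto
  finally show ?thesis .
qed

text \<open>The increments are bounded by a tail of the integral of B/t^4. Sampling at integers is
  enough to find L, because the increment bound compares any x with all later sample points.\<close>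

lemma limit_of_deriv_bound:
  fixes f :: "real \<Rightarrow> complex"
  assumes d: "\<And>x. x \<ge> 1 \<Longrightarrow> (f has_vector_derivative f' x) (at x)"
    and b: "\<And>x. x \<ge> 1 \<Longrightarrow> norm (f' x) \<le> B / x ^ 4"
  obtains L where "\<And>x. x \<ge> 1 \<Longrightarrow> norm (f x - L) \<le> B / x ^ 3"
proof -
  have bd: "norm (f y - f x) \<le> B / x ^ 3" if "1 \<le> x" "x \<le> y" for x y
    by (rule norm_diff_le_of_deriv_bound[OF d b that])
  have z: "((\<lambda>n. B / real (Suc n) ^ 3) \<longlongrightarrow> 0) sequentially" by real_asymp
  have "Cauchy (\<lambda>n. f (real (Suc n)))"
  proof (rule metric_CauchyI)
    fix e :: real assume e: "e > 0"
    have "eventually (\<lambda>n. dist (B / real (Suc n) ^ 3) 0 < e / 2) sequentially"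
      by (rule tendstoD[OF z]) (use e in simp)
    then have "eventually (\<lambda>n. norm (B / real (Suc n) ^ 3) < e / 2) sequentially"
      by (simp only: dist_norm diff_zero)
    then obtain N where N: "\<And>n. n \<ge> N \<Longrightarrow> norm (B / real (Suc n) ^ 3) < e / 2"
      by (auto simp: eventually_sequentially)
    have N': "norm (f (real (Suc n)) - f (real (Suc N))) < e / 2" if "n \<ge> N" for n
      
    proof -
      have "norm (f (real (Suc n)) - f (real (Suc N))) \<le> B / real (Suc N) ^ 3"
        using that by (intro bd) auto
      also have "\<dots> < e / 2" using N[of N] by (simp only: real_norm_def abs_less_iff order_refl)
      finally show ?thesis .
    qed
    show "\<exists>M. \<forall>m\<ge>M. \<forall>n\<ge>M. dist (f (real (Suc m))) (f (real (Suc n))) < e"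
      using N' by (metis dist_commute dist_norm dist_triangle_half_r)
  qed
  then obtain L where L: "(\<lambda>n. f (real (Suc n))) \<longlonglongrightarrow> L"
    using Cauchy_convergent_iff convergent_def by blast
  have "norm (f x - L) \<le> B / x ^ 3" if x: "x \<ge> 1" for x
  proof (rule tendsto_upperbound)
    show "(\<lambda>n. norm (f x - f (real (Suc n)))) \<longlonglongrightarrow> norm (f x - L)"
      by (intro tendsto_intros L)
    have "eventually (\<lambda>n. real (Suc n) \<ge> x) sequentially" by real_asymp
    then show "eventually (\<lambda>n. norm (f x - f (real (Suc n))) \<le> B / x ^ 3) sequentially"
      by eventually_elim (use bd[OF x] in \<open>simp add: norm_minus_commute[of "f x"]\<close>)
  qed simp
  then show ?thesis using that by blast
qed

text \<open>Here \<open>v\<close> stands for \<open>u'\<close>, so that \<open>K = A \<i> exp (- \<i> \<phi>)\<close> encodes \<open>u \<approx> A cos (x - \<phi>)\<close>.\<close>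
definition oscillates_like :: "complex \<Rightarrow> (real \<Rightarrow> real) \<Rightarrow> (real \<Rightarrow> real) \<Rightarrow> bool" where
  "oscillates_like K u v \<longleftrightarrow> ((\<lambda>x. Complex (v x) (u x) - K * cis x) \<longlongrightarrow> 0) at_top"

section \<open>Energy bounds and the limiting amplitude\<close>

locale perturbed_oscillator =
  fixes lam :: real and u v :: "real \<Rightarrow> real"
  assumes du: "x > 0 \<Longrightarrow> (u has_real_derivative v x) (at x)"
    and dv: "x > 0 \<Longrightarrow> (v has_real_derivative - (1 - lam / x\<^sup>2) * u x) (at x)"
begin

definition energy :: "real \<Rightarrow> real" where "energy x = (u x)\<^sup>2 + (v x)\<^sup>2"

lemma energy_deriv:
  assumes "x > 0"
  shows "(energy has_real_derivative 2 * lam / x\<^sup>2 * (u x * v x)) (at x)"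
  unfolding energy_def[abs_def]
  using assms by (auto intro!: derivative_eq_intros du dv simp: field_simps)

lemma energy_deriv_bound:
  shows "\<bar>2 * lam / x\<^sup>2 * (u x * v x)\<bar> \<le> \<bar>lam\<bar> / x\<^sup>2 * energy x"
proof -
  have "2 * \<bar>u x * v x\<bar> \<le> energy x"
    using sum_squares_bound[of "\<bar>u x\<bar>" "\<bar>v x\<bar>"] by (simp add: energy_def abs_mult)
  then have "\<bar>lam\<bar> / x\<^sup>2 * (2 * \<bar>u x * v x\<bar>) \<le> \<bar>lam\<bar> / x\<^sup>2 * energy x"
    by (intro mult_left_mono) auto
  then show ?thesis by (simp add: abs_mult mult_ac)
qed

text \<open>The relative rate of change of the energy is at most |lam|/x^2, which is integrable at
  infinity. The factor exp(c/x) integrates this rate: the product is nondecreasing for c = -|lam|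
  and nonincreasing for c = |lam|. The first keeps solutions from dying out, the second bounds
  them.\<close>

lemma energy_weighted_deriv:
  assumes "x > 0"
  shows "((\<lambda>x. energy x * exp (c / x)) has_real_derivative
     (2 * lam / x\<^sup>2 * (u x * v x) - c / x\<^sup>2 * energy x) * exp (c / x)) (at x)"
  using assms by (auto intro!: derivative_eq_intros energy_deriv simp: field_simps power2_eq_square)

lemma energy_lower:
  assumes "0 < a" "a \<le> x"
  shows "energy a * exp (- \<bar>lam\<bar> / a) \<le> energy x"
proof -
  have "energy a * exp (- \<bar>lam\<bar> / a) \<le> energy x * exp (- \<bar>lam\<bar> / x)"
  proof (rule DERIV_nonneg_imp_nondecreasing[OF \<open>a \<le> x\<close>])
    fix t assume "a \<le> t"
    then have "t > 0" using assms by simp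
    then show "\<exists>y. ((\<lambda>x. energy x * exp (- \<bar>lam\<bar> / x)) has_real_derivative y) (at t) \<and> 0 \<le> y"
      using energy_weighted_deriv[of t "- \<bar>lam\<bar>"] abs_le_D1[OF energy_deriv_bound[of t]] abs_le_D2[OF energy_deriv_bound[of t]]
      by (intro exI[of _ "(2 * lam / t\<^sup>2 * (u t * v t) - (- \<bar>lam\<bar>) / t\<^sup>2 * energy t) * exp ((- \<bar>lam\<bar>) / t)"] conjI
            mult_nonneg_nonneg) auto
  qed
  also have "\<dots> \<le> energy x * 1"
    using assms by (intro mult_left_mono) (auto simp: energy_def)
  finally show ?thesis by simp
qed

lemma energy_upper:
  assumes "1 \<le> x"
  shows "energy x \<le> energy 1 * exp \<bar>lam\<bar>"
proof -
  have "energy x * 1 \<le> energy x * exp (\<bar>lam\<bar> / x)"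
    using assms by (intro mult_left_mono) (auto simp: energy_def)
  also have "\<dots> \<le> energy 1 * exp (\<bar>lam\<bar> / 1)"
  proof (rule DERIV_nonpos_imp_nonincreasing[OF \<open>1 \<le> x\<close>])
    fix t :: real assume "1 \<le> t"
    then have "t > 0" using assms by simp
    then show "\<exists>y. ((\<lambda>x. energy x * exp (\<bar>lam\<bar> / x)) has_real_derivative y) (at t) \<and> y \<le> 0"
      using energy_weighted_deriv[of t "\<bar>lam\<bar>"] abs_le_D1[OF energy_deriv_bound[of t]] abs_le_D2[OF energy_deriv_bound[of t]]
      by (intro exI[of _ "(2 * lam / t\<^sup>2 * (u t * v t) - (\<bar>lam\<bar>) / t\<^sup>2 * energy t) * exp ((\<bar>lam\<bar>) / t)"] conjI
            mult_nonpos_nonneg) auto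
  qed
  finally show ?thesis by simp
qed

lemma u_bounded: obtains U where "U \<ge> 0" "\<And>x. x \<ge> 1 \<Longrightarrow> \<bar>u x\<bar> \<le> U"
proof
  show "sqrt (energy 1 * exp \<bar>lam\<bar>) \<ge> 0" by (simp add: energy_def)
  fix x :: real assume "x \<ge> 1"
  then have "(u x)\<^sup>2 \<le> energy 1 * exp \<bar>lam\<bar>"
    using energy_upper[of x] by (auto simp: energy_def intro: order_trans[rotated])
  then show "\<bar>u x\<bar> \<le> sqrt (energy 1 * exp \<bar>lam\<bar>)" by (rule real_le_rsqrt[OF order_trans, rotated]) simp
qed

text \<open>With \<open>m = - \<i> + \<i> lam / (2 x\<^sup>2) - lam / (2 x\<^sup>3)\<close>, an approximate solution of the Riccati
  equation \<open>m' + m\<^sup>2 + 1 - lam / x\<^sup>2 = 0\<close> with residual \<open>O(x\<^sup>-\<^sup>4)\<close>, the function below is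
  \<open>(u' - m u) exp (\<integral> m)\<close>; hence it converges with error \<open>O(x\<^sup>-\<^sup>3)\<close>.\<close>
definition amplitude :: "real \<Rightarrow> complex" where
  "amplitude x = Complex (v x + lam / (2 * x ^ 3) * u x) ((1 - lam / (2 * x\<^sup>2)) * u x) *
     (cis (- (x + lam / (2 * x))) * of_real (exp (lam / (4 * x\<^sup>2))))"

text \<open>In the derivative of (u' - m u) exp(integral of m) the terms with u' cancel, leaving
  -(m' + m^2 + 1 - lam/x^2) u times the exponential. The \<open>Complex\<close> factor is minus this
  Riccati residual; m is chosen so that all its terms up to x^-3 vanish.\<close>

lemma amplitude_deriv:
  assumes x: "x > 0"
  shows "(amplitude has_vector_derivative
     of_real (u x) * Complex (lam\<^sup>2 / (4 * x ^ 4) - lam\<^sup>2 / (4 * x ^ 6) - 3 * lam / (2 * x ^ 4))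
       (lam\<^sup>2 / (2 * x ^ 5)) *
     (cis (- (x + lam / (2 * x))) * of_real (exp (lam / (4 * x\<^sup>2))))) (at x)"
proof -
  define p q where "p x = v x + lam / (2 * x ^ 3) * u x" and "q x = (1 - lam / (2 * x\<^sup>2)) * u x" for x
  define s1 s2 where "s1 x = lam / (4 * x\<^sup>2)" and "s2 x = x + lam / (2 * x)" for x
  define p' where "p' = - (1 - lam / x\<^sup>2) * u x + lam / (2 * x ^ 3) * v x - 3 * lam / (2 * x ^ 4) * u x"
  define q' where "q' = (1 - lam / (2 * x\<^sup>2)) * v x + lam / x ^ 3 * u x"
  have dp: "(p has_real_derivative p') (at x)"
    unfolding p_def[abs_def]
    using x by (auto intro!: derivative_eq_intros du dv simp: p'_def field_simps eval_nat_numeral)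
  have dq: "(q has_real_derivative q') (at x)"
    unfolding q_def[abs_def]
    using x by (auto intro!: derivative_eq_intros du dv simp: q'_def field_simps eval_nat_numeral)
  have ds1: "(s1 has_real_derivative - lam / (2 * x ^ 3)) (at x)"
    unfolding s1_def[abs_def]
    using x by (auto intro!: derivative_eq_intros simp: field_simps eval_nat_numeral)
  have ds2: "(s2 has_real_derivative 1 - lam / (2 * x\<^sup>2)) (at x)"
    unfolding s2_def[abs_def]
    using x by (auto intro!: derivative_eq_intros simp: field_simps eval_nat_numeral)
  define e where "e x = exp (s1 x)" for x
  have de: "(e has_real_derivative - lam / (2 * x ^ 3) * e x) (at x)"
    unfolding e_def[abs_def] by (rule derivative_eq_intros ds1 refl)+ simp
  define A B where "A x = (p x * cos (s2 x) + q x * sin (s2 x)) * e x"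
    and "B x = (q x * cos (s2 x) - p x * sin (s2 x)) * e x" for x
  define P where "P = (lam\<^sup>2 / (4 * x ^ 4) - lam\<^sup>2 / (4 * x ^ 6) - 3 * lam / (2 * x ^ 4)) * u x"
  define Q where "Q = lam\<^sup>2 / (2 * x ^ 5) * u x"
  have P: "P = p' + (1 - lam / (2 * x\<^sup>2)) * q x - lam / (2 * x ^ 3) * p x"
    using x by (simp add: P_def p'_def p_def q_def field_simps) (simp add: algebra_simps eval_nat_numeral)
  have Q: "Q = q' - (1 - lam / (2 * x\<^sup>2)) * p x - lam / (2 * x ^ 3) * q x"
    using x by (simp add: Q_def q'_def p_def q_def field_simps) (simp add: algebra_simps eval_nat_numeral)
  have dA: "(A has_real_derivative (P * cos (s2 x) + Q * sin (s2 x)) * e x) (at x)"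
    unfolding A_def[abs_def] P Q
    by (auto intro!: derivative_eq_intros dp dq ds2 de simp: algebra_simps)
  have dB: "(B has_real_derivative (Q * cos (s2 x) - P * sin (s2 x)) * e x) (at x)"
    unfolding B_def[abs_def] P Q
    by (auto intro!: derivative_eq_intros dp dq ds2 de simp: algebra_simps)
  have "amplitude x = Complex (p x) (q x) * (cis (- s2 x) * of_real (e x))" for x
    by (simp only: amplitude_def p_def q_def s1_def s2_def e_def)
  then have a: "amplitude x = Complex (A x) (B x)" for x
    by (simp add: A_def B_def complex_eq_iff algebra_simps)
  have "((\<lambda>x. Complex (A x) (B x)) has_vector_derivative
      Complex ((P * cos (s2 x) + Q * sin (s2 x)) * e x) ((Q * cos (s2 x) - P * sin (s2 x)) * e x)) (at x)"
    using dA dB by (simp add: has_vector_derivative_complex_iff has_real_derivative_iff_has_vector_derivative)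
  also have "Complex ((P * cos (s2 x) + Q * sin (s2 x)) * e x) ((Q * cos (s2 x) - P * sin (s2 x)) * e x) =
     of_real (u x) * Complex (lam\<^sup>2 / (4 * x ^ 4) - lam\<^sup>2 / (4 * x ^ 6) - 3 * lam / (2 * x ^ 4))
       (lam\<^sup>2 / (2 * x ^ 5)) * (cis (- s2 x) * of_real (e x))"
    by (simp add: P_def Q_def complex_eq_iff algebra_simps)
  finally show ?thesis by (simp add: a[abs_def] s2_def e_def s1_def)
qed

lemma amplitude_limit:
  obtains K B where "B \<ge> 0" "\<And>x. x \<ge> 1 \<Longrightarrow> norm (amplitude x - K) \<le> B / x ^ 3"
proof -
  obtain U where U: "U \<ge> 0" "\<And>x. x \<ge> 1 \<Longrightarrow> \<bar>u x\<bar> \<le> U" using u_bounded by blast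
  \<comment> \<open>For x \<ge> 1 the residual is at most (lam^2 + 3|lam|/2)/x^4, rounded up to
    2|lam| in the second term, and the real exponential is at most exp |lam|.\<close>
  define D where "D = U * (lam\<^sup>2 + 2 * \<bar>lam\<bar>) * exp \<bar>lam\<bar>"
  have D: "D \<ge> 0" using U by (simp add: D_def)
  show ?thesis
  proof (rule limit_of_deriv_bound[of amplitude _ D])
    fix x :: real assume x: "1 \<le> x"
    show "(amplitude has_vector_derivative
     of_real (u x) * Complex (lam\<^sup>2 / (4 * x ^ 4) - lam\<^sup>2 / (4 * x ^ 6) - 3 * lam / (2 * x ^ 4))
       (lam\<^sup>2 / (2 * x ^ 5)) *
     (cis (- (x + lam / (2 * x))) * of_real (exp (lam / (4 * x\<^sup>2))))) (at x)"
      using amplitude_deriv x by simp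
    have p: "x ^ 4 \<le> x ^ 6" "x ^ 4 \<le> x ^ 5" using x by (auto intro: power_increasing)
    have "cmod (Complex (lam\<^sup>2 / (4 * x ^ 4) - lam\<^sup>2 / (4 * x ^ 6) - 3 * lam / (2 * x ^ 4)) (lam\<^sup>2 / (2 * x ^ 5)))
       \<le> \<bar>lam\<^sup>2 / (4 * x ^ 4) - lam\<^sup>2 / (4 * x ^ 6) - 3 * lam / (2 * x ^ 4)\<bar> + \<bar>lam\<^sup>2 / (2 * x ^ 5)\<bar>"
      by (rule order_trans[OF cmod_le]) simp
    also have "\<dots> \<le> (lam\<^sup>2 / (4 * x ^ 4) + lam\<^sup>2 / (4 * x ^ 6) + 3 * \<bar>lam\<bar> / (2 * x ^ 4)) + lam\<^sup>2 / (2 * x ^ 5)"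
      using x by (intro add_mono order_trans[OF abs_triangle_ineq4] ) auto
    also have "\<dots> \<le> (lam\<^sup>2 / (4 * x ^ 4) + lam\<^sup>2 / (4 * x ^ 4) + 3 * \<bar>lam\<bar> / (2 * x ^ 4)) + lam\<^sup>2 / (2 * x ^ 4)"
      using x p by (intro add_mono divide_left_mono order_refl mult_left_mono) auto
    also have "\<dots> = (lam\<^sup>2 + 3 / 2 * \<bar>lam\<bar>) / x ^ 4" using x by (simp add: field_simps)
    also have "\<dots> \<le> (lam\<^sup>2 + 2 * \<bar>lam\<bar>) / x ^ 4" using x by (intro divide_right_mono) auto
    finally have c: "cmod (Complex (lam\<^sup>2 / (4 * x ^ 4) - lam\<^sup>2 / (4 * x ^ 6) - 3 * lam / (2 * x ^ 4)) (lam\<^sup>2 / (2 * x ^ 5)))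
      \<le> (lam\<^sup>2 + 2 * \<bar>lam\<bar>) / x ^ 4" .
    have "lam / (4 * x\<^sup>2) \<le> \<bar>lam\<bar> / 1"
      using x one_le_power[of x 2] by (intro frac_le) linarith+
    then have e: "exp (lam / (4 * x\<^sup>2)) \<le> exp \<bar>lam\<bar>" by simp
    have "\<bar>u x\<bar> * cmod (Complex (lam\<^sup>2 / (4 * x ^ 4) - lam\<^sup>2 / (4 * x ^ 6) - 3 * lam / (2 * x ^ 4)) (lam\<^sup>2 / (2 * x ^ 5)))
       * exp (lam / (4 * x\<^sup>2)) \<le> U * ((lam\<^sup>2 + 2 * \<bar>lam\<bar>) / x ^ 4) * exp \<bar>lam\<bar>"
      using x U by (intro mult_mono c e) auto
    then show "norm (of_real (u x) * Complex (lam\<^sup>2 / (4 * x ^ 4) - lam\<^sup>2 / (4 * x ^ 6) - 3 * lam / (2 * x ^ 4))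
       (lam\<^sup>2 / (2 * x ^ 5)) *
     (cis (- (x + lam / (2 * x))) * of_real (exp (lam / (4 * x\<^sup>2))))) \<le> D / x ^ 4"
      by (simp add: norm_mult D_def)
  qed (use that D in blast)
qed

end


lemma Bfun_zero_mult:
  fixes f g :: "real \<Rightarrow> real"
  assumes "(f \<longlongrightarrow> 0) F" "Bfun g F"
  shows "((\<lambda>x. f x * g x) \<longlongrightarrow> 0) F"
  using bounded_bilinear.Zfun_prod_Bfun[OF bounded_bilinear_mult] assms
  by (simp add: tendsto_Zfun_iff)

context perturbed_oscillator
begin

lemma amplitude_eq:
  "Complex (v x + lam / (2 * x ^ 3) * u x) ((1 - lam / (2 * x\<^sup>2)) * u x) * of_real (exp (lam / (4 * x\<^sup>2))) =
     amplitude x * cis (x + lam / (2 * x))"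
proof -
  have "cis (- (x + lam / (2 * x))) * cis (x + lam / (2 * x)) = 1"
    by (simp add: cis_mult)
  moreover have "amplitude x * cis (x + lam / (2 * x)) =
    Complex (v x + lam / (2 * x ^ 3) * u x) ((1 - lam / (2 * x\<^sup>2)) * u x) * of_real (exp (lam / (4 * x\<^sup>2))) *
      (cis (- (x + lam / (2 * x))) * cis (x + lam / (2 * x)))"
    unfolding amplitude_def by (simp only: mult_ac)
  ultimately show ?thesis by simp
qed

lemma oscillates_like_if_amplitude_tendsto:
  assumes "(amplitude \<longlongrightarrow> K) at_top"
  shows "oscillates_like K u v"
proof -
  obtain U where U: "\<And>x. x \<ge> 1 \<Longrightarrow> \<bar>u x\<bar> \<le> U" using u_bounded by blast
  have Bu: "Bfun u at_top"
    by (rule BfunI[of _ U]) (use U in \<open>auto simp: eventually_at_top_linorder\<close>)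
  have c: "((\<lambda>x. cis (lam / (2 * x)) * of_real (exp (- lam / (4 * x\<^sup>2)))) \<longlongrightarrow> 1) at_top"
  proof -
    have "((\<lambda>x. lam / (2 * x)) \<longlongrightarrow> 0) at_top" "((\<lambda>x. - lam / (4 * x\<^sup>2)) \<longlongrightarrow> 0) at_top"
      by real_asymp+
    then have "((\<lambda>x. cis (lam / (2 * x)) * of_real (exp (- lam / (4 * x\<^sup>2)))) \<longlongrightarrow> cis 0 * of_real (exp 0)) at_top"
      by (intro tendsto_intros)
    then show ?thesis by simp
  qed
  \<comment> \<open>The slowly varying corrections of phase and size tend to 1 and are undone here.
    The remaining factor \<open>cis x\<close> has modulus one and cannot spoil the limit.\<close>
  define W where "W x = amplitude x * (cis (lam / (2 * x)) * of_real (exp (- lam / (4 * x\<^sup>2)))) - K" for x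
  have "(W \<longlongrightarrow> K * 1 - K) at_top"
    unfolding W_def[abs_def] by (intro tendsto_intros assms c)
  then have "((\<lambda>x. norm (W x)) \<longlongrightarrow> 0) at_top" by (simp add: tendsto_norm_zero)
  then have "((\<lambda>x. norm (cis x * W x)) \<longlongrightarrow> 0) at_top" by (simp add: norm_mult)
  then have z1: "((\<lambda>x. cis x * W x) \<longlongrightarrow> 0) at_top" by (rule tendsto_norm_zero_cancel)
  have z2: "((\<lambda>x. lam / (2 * x ^ 3) * u x) \<longlongrightarrow> 0) at_top"
    by (rule Bfun_zero_mult[OF _ Bu]) real_asymp
  have z3: "((\<lambda>x. lam / (2 * x\<^sup>2) * u x) \<longlongrightarrow> 0) at_top"
    by (rule Bfun_zero_mult[OF _ Bu]) real_asymp
  have "((\<lambda>x. Complex (- (lam / (2 * x ^ 3) * u x)) (lam / (2 * x\<^sup>2) * u x)) \<longlongrightarrow> Complex (- 0) 0) at_top"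
    by (intro tendsto_Complex tendsto_minus z2 z3)
  from tendsto_add[OF z1 this]
  have lim: "((\<lambda>x. cis x * W x + Complex (- (lam / (2 * x ^ 3) * u x)) (lam / (2 * x\<^sup>2) * u x)) \<longlongrightarrow> 0) at_top"
    by (simp flip: zero_complex.code)
  have "cis x * W x + Complex (- (lam / (2 * x ^ 3) * u x)) (lam / (2 * x\<^sup>2) * u x) = Complex (v x) (u x) - K * cis x" for x
  proof -
    have "amplitude x * (cis x * cis (lam / (2 * x))) * of_real (exp (- lam / (4 * x\<^sup>2))) =
       Complex (v x + lam / (2 * x ^ 3) * u x) ((1 - lam / (2 * x\<^sup>2)) * u x) *
       (of_real (exp (lam / (4 * x\<^sup>2))) * of_real (exp (- lam / (4 * x\<^sup>2))))"
      unfolding cis_mult amplitude_eq[symmetric] by (simp only: mult_ac)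
    also have "of_real (exp (lam / (4 * x\<^sup>2))) * of_real (exp (- lam / (4 * x\<^sup>2))) = (1::complex)"
      by (simp flip: of_real_mult exp_add)
    finally have "cis x * (amplitude x * (cis (lam / (2 * x)) * of_real (exp (- lam / (4 * x\<^sup>2))))) =
       Complex (v x + lam / (2 * x ^ 3) * u x) ((1 - lam / (2 * x\<^sup>2)) * u x)"
      by (simp only: mult_ac mult_1_right mult_1_left)
    then have "cis x * W x = Complex (v x + lam / (2 * x ^ 3) * u x) ((1 - lam / (2 * x\<^sup>2)) * u x) - cis x * K"
      unfolding W_def right_diff_distrib by (simp only:)
    then show ?thesis by (simp add: complex_eq_iff algebra_simps)
  qed
  then show ?thesis using lim unfolding oscillates_like_def by (simp only:)
qed

end

lemma tendsto_zero_of_cis_multiple: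
  assumes "((\<lambda>x. L * cis x) \<longlongrightarrow> 0) at_top"
  shows "L = 0"
proof -
  have "((\<lambda>x::real. norm L) \<longlongrightarrow> 0) at_top"
    using tendsto_norm_zero[OF assms] by (simp add: norm_mult)
  then show ?thesis by (simp add: tendsto_const_iff)
qed

lemma oscillates_like_unique:
  assumes "oscillates_like K u v" "oscillates_like L u v"
  shows "K = L"
proof -
  have "((\<lambda>x. (L - K) * cis x) \<longlongrightarrow> 0) at_top"
    using tendsto_diff[OF assms[unfolded oscillates_like_def]] by (simp add: algebra_simps)
  then show ?thesis using tendsto_zero_of_cis_multiple by fastforce
qed

context perturbed_oscillator
begin

text \<open>The limit of the amplitude is one admissible K, and K is unique. Hence a K found by any
  other means, with an error of mere o(1), inherits the rate x^-3.\<close>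

lemma ex_oscillates_like: "\<exists>K. oscillates_like K u v"
  and amplitude_bound:
    "oscillates_like K u v \<Longrightarrow> \<exists>B\<ge>0. \<forall>x\<ge>1. norm (amplitude x - K) \<le> B / x ^ 3"
proof -
  obtain L B where LB: "B \<ge> 0" "\<And>x. x \<ge> 1 \<Longrightarrow> norm (amplitude x - L) \<le> B / x ^ 3"
    by (rule amplitude_limit) blast
  have "((\<lambda>x. amplitude x - L) \<longlongrightarrow> 0) at_top"
  proof (rule Lim_null_comparison)
    show "eventually (\<lambda>x. norm (amplitude x - L) \<le> B / x ^ 3) at_top"
      by (rule eventually_mono[OF eventually_ge_at_top[of 1]]) (rule LB(2))
    show "((\<lambda>x. B / x ^ 3) \<longlongrightarrow> 0) at_top" by real_asymp
  qed
  then have L: "oscillates_like L u v"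
    by (rule oscillates_like_if_amplitude_tendsto[OF LIM_zero_cancel])
  then show "\<exists>K. oscillates_like K u v" by blast
  show "\<exists>B\<ge>0. \<forall>x\<ge>1. norm (amplitude x - K) \<le> B / x ^ 3" if "oscillates_like K u v"
    using oscillates_like_unique[OF that L] LB by (intro exI[of _ B]) simp
qed

text \<open>K = 0 would send the energy to 0, against its positive lower bound.\<close>

lemma oscillates_like_nonzero:
  assumes K: "oscillates_like K u v" and a: "a > 0" "u a \<noteq> 0"
  shows "K \<noteq> 0"
proof
  assume "K = 0"
  then have "((\<lambda>x. norm (Complex (v x) (u x))) \<longlongrightarrow> 0) at_top"
    using K by (simp add: oscillates_like_def tendsto_norm_zero)
  then have "((\<lambda>x. (norm (Complex (v x) (u x)))\<^sup>2) \<longlongrightarrow> 0\<^sup>2) at_top"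
    by (intro tendsto_power)
  then have "(energy \<longlongrightarrow> 0) at_top"
    by (simp add: cmod_power2 energy_def[abs_def] add.commute)
  moreover have "eventually (\<lambda>x. energy a * exp (- \<bar>lam\<bar> / a) \<le> energy x) at_top"
    using eventually_ge_at_top[of a] by eventually_elim (use energy_lower a in blast)
  ultimately have "energy a * exp (- \<bar>lam\<bar> / a) \<le> 0"
    by (intro tendsto_lowerbound) auto
  moreover have "energy a > 0" using a by (simp add: energy_def add_pos_nonneg)
  ultimately show False by (simp add: mult_le_0_iff)
qed

text \<open>The positive exponential is left on the left-hand side: it does not affect zeros, and
  without dividing it out the remaining relation is accurate to x^-3.\<close>

lemma mixed_derivative_bound:
  assumes K: "oscillates_like (of_real A * \<i> * cis (- \<phi>)) u v"
  obtains D where "\<And>x. x \<ge> 1 \<Longrightarrow>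
    \<bar>exp (lam / (4 * x\<^sup>2)) * (v x + b / x * u x) -
       A * (b / x * cos (x - \<phi> + lam / (2 * x)) - sin (x - \<phi> + lam / (2 * x)))\<bar> \<le> D / x ^ 3"
proof -
  obtain B where B: "B \<ge> 0" "\<And>x. x \<ge> 1 \<Longrightarrow> norm (amplitude x - of_real A * \<i> * cis (- \<phi>)) \<le> B / x ^ 3"
    using amplitude_bound[OF K] by blast
  obtain U where U: "U \<ge> 0" "\<And>x. x \<ge> 1 \<Longrightarrow> \<bar>u x\<bar> \<le> U" using u_bounded by blast
  define D where "D = B + \<bar>b\<bar> * B + exp \<bar>lam\<bar> * (\<bar>lam\<bar> / 2 * U) + exp \<bar>lam\<bar> * (\<bar>b\<bar> * \<bar>lam\<bar> / 2 * U)"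
  show ?thesis
  proof (rule that[of D])
    fix x :: real assume x: "x \<ge> 1"
    define e where "e = exp (lam / (4 * x\<^sup>2))"
    define T where "T = x - \<phi> + lam / (2 * x)"
    define p q where "p = v x + lam / (2 * x ^ 3) * u x" and "q = (1 - lam / (2 * x\<^sup>2)) * u x"
    define w where "w = (amplitude x - of_real A * \<i> * cis (- \<phi>)) * cis (x + lam / (2 * x))"
    have w: "cmod w \<le> B / x ^ 3" using B(2)[OF x] by (simp add: w_def norm_mult)
    have "w = Complex p q * of_real e - of_real A * \<i> * (cis (- \<phi>) * cis (x + lam / (2 * x)))"
      unfolding w_def p_def q_def e_def amplitude_eq by (simp add: algebra_simps)
    also have "cis (- \<phi>) * cis (x + lam / (2 * x)) = cis T"
      unfolding cis_mult T_def by (simp add: algebra_simps)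
    finally have weq: "w = Complex p q * of_real e - of_real A * \<i> * cis T" .
    have "Re w = e * p + A * sin T" "Im w = e * q - A * cos T"
      unfolding weq by simp_all
    then have pq: "\<bar>e * p + A * sin T\<bar> \<le> B / x ^ 3" "\<bar>e * q - A * cos T\<bar> \<le> B / x ^ 3"
      using w abs_Re_le_cmod[of w] abs_Im_le_cmod[of w] by linarith+
    have "lam / (4 * x\<^sup>2) \<le> \<bar>lam\<bar> / 1"
      using x one_le_power[of x 2] by (intro frac_le) linarith+
    then have e: "0 \<le> e" "e \<le> exp \<bar>lam\<bar>" by (simp_all add: e_def)
    have t2: "\<bar>b / x * (e * q - A * cos T)\<bar> \<le> \<bar>b\<bar> * B / x ^ 3"
    proof -
      have "\<bar>b / x * (e * q - A * cos T)\<bar> \<le> \<bar>b\<bar> / 1 * (B / x ^ 3)"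
        unfolding abs_mult by (intro mult_mono pq) (use x in \<open>auto simp: abs_divide intro!: divide_left_mono[of 1, simplified]\<close>)
      then show ?thesis by simp
    qed
    have t3: "\<bar>e * (lam / (2 * x ^ 3) * u x)\<bar> \<le> exp \<bar>lam\<bar> * (\<bar>lam\<bar> / 2 * U) / x ^ 3"
    proof -
      have "\<bar>e * (lam / (2 * x ^ 3) * u x)\<bar> = e * (\<bar>lam\<bar> / (2 * x ^ 3) * \<bar>u x\<bar>)"
        using x e by (simp add: abs_mult)
      also have "\<dots> \<le> exp \<bar>lam\<bar> * (\<bar>lam\<bar> / (2 * x ^ 3) * U)"
        using x e U by (intro mult_mono) auto
      finally show ?thesis by simp
    qed
    have t4: "\<bar>e * (b * lam / (2 * x ^ 3) * u x)\<bar> \<le> exp \<bar>lam\<bar> * (\<bar>b\<bar> * \<bar>lam\<bar> / 2 * U) / x ^ 3"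
    proof -
      have "\<bar>e * (b * lam / (2 * x ^ 3) * u x)\<bar> = e * (\<bar>b\<bar> * \<bar>lam\<bar> / (2 * x ^ 3) * \<bar>u x\<bar>)"
        using x e by (simp add: abs_mult)
      also have "\<dots> \<le> exp \<bar>lam\<bar> * (\<bar>b\<bar> * \<bar>lam\<bar> / (2 * x ^ 3) * U)"
        using x e U by (intro mult_mono) auto
      finally show ?thesis by simp
    qed
    have abs4: "\<bar>a + b - c + d\<bar> \<le> a' + b' + c' + d'"
      if "\<bar>a\<bar> \<le> a'" "\<bar>b\<bar> \<le> b'" "\<bar>c\<bar> \<le> c'" "\<bar>d\<bar> \<le> d'" for a b c d a' b' c' d' :: real
      using that by linarith
    \<comment> \<open>Passing from u and v to the corrected q and p leaves two multiples of u, each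
      already of order x^-3.\<close>
    have "e * (v x + b / x * u x) - A * (b / x * cos T - sin T) =
       (e * p + A * sin T) + b / x * (e * q - A * cos T) - e * (lam / (2 * x ^ 3) * u x)
         + e * (b * lam / (2 * x ^ 3) * u x)"
      using x by (simp add: p_def q_def field_simps) (simp add: algebra_simps eval_nat_numeral)
    then have "\<bar>e * (v x + b / x * u x) - A * (b / x * cos T - sin T)\<bar> \<le>
       B / x ^ 3 + \<bar>b\<bar> * B / x ^ 3 + exp \<bar>lam\<bar> * (\<bar>lam\<bar> / 2 * U) / x ^ 3 + exp \<bar>lam\<bar> * (\<bar>b\<bar> * \<bar>lam\<bar> / 2 * U) / x ^ 3"
      using abs4[OF pq(1) t2 t3 t4] by (simp only:)
    also have "\<dots> = D / x ^ 3" by (simp add: D_def add_divide_distrib)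
    finally show "\<bar>exp (lam / (4 * x\<^sup>2)) * (v x + b / x * u x) -
       A * (b / x * cos (x - \<phi> + lam / (2 * x)) - sin (x - \<phi> + lam / (2 * x)))\<bar> \<le> D / x ^ 3"
      unfolding e_def T_def .
  qed
qed

end


section \<open>Enumerating zeros\<close>

text \<open>Write b as a composed with some \<sigma>; then \<sigma> is strictly increasing on the
  naturals, so n \<le> \<sigma> n.\<close>

lemma strict_mono_same_range_le:
  fixes a b :: "nat \<Rightarrow> real"
  assumes a: "strict_mono a" and b: "strict_mono b" and r: "range b \<subseteq> range a"
  shows "a n \<le> b n"
proof -
  from r have "\<exists>\<sigma>. \<forall>n. b n = a (\<sigma> n)" by (intro choice) auto
  then obtain \<sigma> where \<sigma>: "\<And>n. b n = a (\<sigma> n)" by blast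
  have "strict_mono \<sigma>"
    using a b by (auto simp: strict_mono_def \<sigma>) (metis \<sigma> a strict_mono_less)
  then have "n \<le> \<sigma> n" by (rule strict_mono_imp_increasing)
  then show ?thesis unfolding \<sigma> using a by (simp add: strict_mono_less_eq)
qed

text \<open>This carries asymptotics from one constructed enumeration over to every other one.
  Nothing can be said at index 0, so sequences are compared after a shift by one.\<close>

lemma enumerates_positive_zeros_unique:
  assumes "enumerates_positive_zeros f y" "enumerates_positive_zeros f z" "p \<ge> 1"
  shows "y p = z p"
proof -
  have shift: "strict_mono (\<lambda>n. z (Suc n))" "range (\<lambda>n. z (Suc n)) = {x. 0 < x \<and> f x = 0}"
    if "enumerates_positive_zeros f z" for z
  proof -
    show "strict_mono (\<lambda>n. z (Suc n))"
      using that by (auto simp: enumerates_positive_zeros_def strict_mono_on_def strict_mono_def)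
    have "range (\<lambda>n. z (Suc n)) = z ` range Suc" by auto
    also have "range Suc = {1..}"
      by (auto simp: image_iff Suc_le_eq gr0_conv_Suc)
    finally show "range (\<lambda>n. z (Suc n)) = {x. 0 < x \<and> f x = 0}"
      using that by (simp add: enumerates_positive_zeros_def)
  qed
  have "y (Suc n) = z (Suc n)" for n
    using strict_mono_same_range_le[OF shift(1)[OF assms(1)] shift(1)[OF assms(2)], of n]
      strict_mono_same_range_le[OF shift(1)[OF assms(2)] shift(1)[OF assms(1)], of n]
      shift(2)[OF assms(1)] shift(2)[OF assms(2)]
    by (intro antisym) auto
  from this[of "p - 1"] show ?thesis using assms(3) by simp
qed

lemma enumerates_positive_zeros_scale:
  assumes "enumerates_positive_zeros f z" "R > 0"
    and g: "\<And>x. x > 0 \<Longrightarrow> g x = 0 \<longleftrightarrow> f (x * R) = 0"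
  shows "enumerates_positive_zeros g (\<lambda>p. z p / R)"
proof -
  have "strict_mono_on {1..} (\<lambda>p. z p / R)"
    using assms by (auto simp: enumerates_positive_zeros_def strict_mono_on_def divide_strict_right_mono)
  moreover have "(\<lambda>p. z p / R) ` {1..} = (\<lambda>x. x / R) ` {x. 0 < x \<and> f x = 0}"
    using assms(1) image_image[of "\<lambda>x. x / R" z "{1..}"] by (simp add: enumerates_positive_zeros_def)
  moreover have "(\<lambda>x. x / R) ` {x. 0 < x \<and> f x = 0} = {x. 0 < x \<and> g x = 0}"
  proof (intro set_eqI iffI)
    fix x assume "x \<in> {x. 0 < x \<and> g x = 0}"
    then show "x \<in> (\<lambda>x. x / R) ` {x. 0 < x \<and> f x = 0}"
      using g[of x] assms(2) by (intro image_eqI[of _ _ "x * R"]) auto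
  qed (use g assms(2) in auto)
  ultimately show ?thesis by (simp add: enumerates_positive_zeros_def)
qed

text \<open>The window of length pi is cut at pi/4: to the left the derivative of g is positive
  because cos exceeds 1/2, to the right g itself is positive because sin exceeds 1/2. Both rest on
  1/2 < sqrt 2 / 2, which explains the tolerance and the asymmetric window.\<close>

lemma exactly_one_zero:
  fixes g g' :: "real \<Rightarrow> real"
  assumes d: "\<And>t. - pi / 4 \<le> t \<Longrightarrow> t \<le> pi / 4 \<Longrightarrow> (g has_real_derivative g' t) (at t)"
    and s: "\<And>t. - pi / 4 \<le> t \<Longrightarrow> t \<le> 3 * pi / 4 \<Longrightarrow> \<bar>g t - sin t\<bar> < 1 / 2"
    and c: "\<And>t. - pi / 4 \<le> t \<Longrightarrow> t \<le> pi / 4 \<Longrightarrow> \<bar>g' t - cos t\<bar> < 1 / 2"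
  shows "\<exists>\<tau>. -pi/4 < \<tau> \<and> \<tau> < pi/4 \<and> (\<forall>t. - pi / 4 \<le> t \<and> t \<le> 3 * pi / 4 \<longrightarrow> (g t = 0 \<longleftrightarrow> t = \<tau>))"
proof -
  have h: "1 < sqrt (2 :: real)" by simp
  have cos_ge: "cos t > 1 / 2" if "- pi / 4 \<le> t" "t \<le> pi / 4" for t
  proof -
    have "cos (pi / 4) \<le> cos \<bar>t\<bar>" using that by (intro cos_monotone_0_pi_le) auto
    then show ?thesis by (simp add: cos_45) (use h in linarith)
  qed
  have sin_ge: "sin t > 1 / 2" if "pi / 4 \<le> t" "t \<le> 3 * pi / 4" for t
    using cos_ge[of "t - pi / 2"] that by (simp add: cos_diff)
  have inc: "g s < g t" if "- pi / 4 \<le> s" "s < t" "t \<le> pi / 4" for s t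
  proof (rule DERIV_pos_imp_increasing[OF \<open>s < t\<close>])
    fix x assume "s \<le> x" "x \<le> t"
    then have x: "- pi / 4 \<le> x" "x \<le> pi / 4" using that by linarith+
    have "g' x > 0" using c[OF x] cos_ge[OF x] by linarith
    then show "\<exists>y. (g has_real_derivative y) (at x) \<and> 0 < y" using d[OF x] by blast
  qed
  have neg: "g (- pi / 4) < 0"
  proof -
    have "\<bar>g (- pi / 4) - sin (- pi / 4)\<bar> < 1 / 2" using pi_gt_zero by (intro s) linarith+
    moreover have "sin (- pi / 4) = - sqrt 2 / 2" by (simp add: sin_45)
    ultimately show ?thesis using h by linarith
  qed
  have pos: "g t > 0" if "pi / 4 \<le> t" "t \<le> 3 * pi / 4" for t
  proof -
    have "\<bar>g t - sin t\<bar> < 1 / 2" using that pi_gt_zero by (intro s) linarith+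
    then show ?thesis using sin_ge[OF that] by linarith
  qed
  have "\<exists>\<tau>. - pi / 4 \<le> \<tau> \<and> \<tau> \<le> pi / 4 \<and> g \<tau> = 0"
    using neg pos[of "pi / 4"] d by (intro IVT) (auto intro!: DERIV_isCont[OF d])
  then obtain \<tau> where \<tau>: "- pi / 4 \<le> \<tau>" "\<tau> \<le> pi / 4" "g \<tau> = 0" by blast
  have "\<tau> \<noteq> - pi / 4" "\<tau> \<noteq> pi / 4" using \<tau>(3) neg pos[of "pi/4"] pi_gt_zero by force+
  moreover have "t = \<tau>" if "- pi / 4 \<le> t" "t \<le> 3 * pi / 4" "g t = 0" for t
  proof (cases "t \<le> pi / 4")
    case True
    then show ?thesis using inc[of t \<tau>] inc[of \<tau> t] \<tau> that by (cases t \<tau> rule: linorder_cases) auto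
  next
    case False
    then show ?thesis using pos[of t] that by simp
  qed
  ultimately show ?thesis using \<tau> by (intro exI[of _ \<tau>]) (auto simp: order.order_iff_strict)
qed

text \<open>Numbering starts at 1 while lists and z start at 0: hence position p - 1 in the list,
  and z 0 at index \<open>card F + 1\<close>.\<close>

lemma enumerate_prepend:
  fixes z :: "nat \<Rightarrow> real"
  assumes F: "finite F" "\<And>x n. x \<in> F \<Longrightarrow> x < z n" and z: "strict_mono z"
    and zeros: "{x. 0 < x \<and> f x = 0} = F \<union> range z"
  shows "enumerates_positive_zeros f
     (\<lambda>p. if p \<le> card F then sorted_list_of_set F ! (p - 1) else z (p - card F - 1))"
proof -
  define L where "L = sorted_list_of_set F"
  define k where "k p = (if p \<le> card F then L ! (p - 1) else z (p - card F - 1))" for p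
  have L: "length L = card F" "set L = F" "sorted_wrt (<) L"
    using F by (auto simp: L_def)
  have "strict_mono_on {1..} k"
  proof (rule strict_mono_onI)
    fix p q :: nat assume pq: "p \<in> {1..}" "q \<in> {1..}" "p < q"
    consider "q \<le> card F" | "p \<le> card F" "card F < q" | "card F < p" by linarith
    then show "k p < k q"
    proof cases
      case 1
      then show ?thesis using pq L by (auto simp: k_def intro!: sorted_wrt_nth_less[OF L(3)])
    next
      case 2
      then have "L ! (p - 1) \<in> F" using L pq nth_mem[of "p - 1" L] by auto
      then show ?thesis using 2 F by (simp add: k_def)
    next
      case 3
      then show ?thesis using pq z by (auto simp: k_def strict_mono_less)
    qed
  qed
  moreover have "k ` {1..} = F \<union> range z"
  proof (intro set_eqI iffI)
    fix x assume "x \<in> k ` {1..}"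
    then obtain p where p: "p \<ge> 1" "x = k p" by auto
    show "x \<in> F \<union> range z"
    proof (cases "p \<le> card F")
      case True
      then have "L ! (p - 1) \<in> F" using L p nth_mem[of "p - 1" L] by auto
      then show ?thesis using True p by (simp add: k_def)
    qed (auto simp: p k_def)
  next
    fix x assume "x \<in> F \<union> range z"
    then show "x \<in> k ` {1..}"
    proof
      assume "x \<in> F"
      then obtain i where "i < card F" "x = L ! i" using L by (metis in_set_conv_nth)
      then show ?thesis by (intro image_eqI[of _ _ "Suc i"]) (auto simp: k_def)
    next
      assume "x \<in> range z"
      then obtain i where "x = z i" by auto
      then show ?thesis by (intro image_eqI[of _ _ "card F + 1 + i"]) (auto simp: k_def)
    qed
  qed
  ultimately show ?thesis
    unfolding enumerates_positive_zeros_def zeros k_def[abs_def] L_def by blast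
qed

text \<open>Translates of one window by multiples of pi tile a half line on which the errors are
  below 1/2, and each holds one zero; below it finiteness takes over. The integer j is the offset
  between the number of a window and the index of its zero. That zero approaches \<phi> + n pi,
  since there the error f - sin equals the sine of the deviation up to sign.\<close>

lemma sine_like_zeros:
  fixes f f' :: "real \<Rightarrow> real"
  assumes d: "\<And>x. x > 0 \<Longrightarrow> (f has_real_derivative f' x) (at x)"
    and s: "((\<lambda>x. f x - sin (x - \<phi>)) \<longlongrightarrow> 0) at_top"
    and c: "((\<lambda>x. f' x - cos (x - \<phi>)) \<longlongrightarrow> 0) at_top"
    and fin: "\<And>M. finite {x. 0 < x \<and> x \<le> M \<and> f x = 0}"
  shows "\<exists>k j. enumerates_positive_zeros f k \<and>
     (\<lambda>p. k p - (\<phi> + (real p + of_int j) * pi)) \<longlonglongrightarrow> 0"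
proof -
  have "eventually (\<lambda>x. x > 0 \<and> \<bar>f x - sin (x - \<phi>)\<bar> < 1 / 2 \<and> \<bar>f' x - cos (x - \<phi>)\<bar> < 1 / 2) at_top"
    using tendstoD[OF s, of "1/2"] tendstoD[OF c, of "1/2"]
    by (intro eventually_conj eventually_gt_at_top) (auto simp: dist_norm)
  then obtain X where X: "\<And>x. x \<ge> X \<Longrightarrow> x > 0 \<and> \<bar>f x - sin (x - \<phi>)\<bar> < 1 / 2 \<and> \<bar>f' x - cos (x - \<phi>)\<bar> < 1 / 2"
    by (auto simp: eventually_at_top_linorder)
  define N where "N = nat \<lceil>(X - \<phi>) / pi + 1\<rceil>"
  have "(X - \<phi>) / pi + 1 \<le> real N" unfolding N_def by linarith
  then have N: "X \<le> \<phi> + real N * pi - pi / 4"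
    by (simp add: field_simps) (use pi_gt_zero in linarith)
  define I where "I n t = \<phi> + real n * pi + t" for n t
  have I: "I n t \<ge> X" if "n \<ge> N" "t \<ge> - pi / 4" for n t
  proof -
    have "real N * pi \<le> real n * pi" using that by simp
    then show ?thesis unfolding I_def using N that by linarith
  qed
  have sc: "sin (I n t - \<phi>) = (-1) ^ n * sin t" "cos (I n t - \<phi>) = (-1) ^ n * cos t" for n t
    by (simp_all add: I_def sin_add cos_add mult.commute)
  have one: "\<bar>(-1) ^ n * a - b\<bar> = \<bar>a - (-1) ^ n * b\<bar>" for a b :: real and n :: nat
    by (cases "even n") auto
  have "\<exists>\<tau>. -pi/4 < \<tau> \<and> \<tau> < pi/4 \<and> (\<forall>t. - pi / 4 \<le> t \<and> t \<le> 3 * pi / 4 \<longrightarrow> ((-1) ^ n * f (I n t) = 0 \<longleftrightarrow> t = \<tau>))"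
    if n: "n \<ge> N" for n
  proof (rule exactly_one_zero)
    fix t :: real assume t: "- pi / 4 \<le> t"
    show "\<bar>(-1) ^ n * f (I n t) - sin t\<bar> < 1 / 2"
      using X[OF I[OF n t]] by (simp only: one sc)
    show "\<bar>(-1) ^ n * f' (I n t) - cos t\<bar> < 1 / 2"
      using X[OF I[OF n t]] by (simp only: one sc)
    have "(I n has_real_derivative 1) (at t)"
      unfolding I_def[abs_def] by (auto intro!: derivative_eq_intros)
    then have "((\<lambda>t. f (I n t)) has_real_derivative f' (I n t) * 1) (at t)"
      using X[OF I[OF n t]] by (intro DERIV_chain2[OF d]) auto
    then show "((\<lambda>t. (-1) ^ n * f (I n t)) has_real_derivative (-1) ^ n * f' (I n t)) (at t)"
      by (intro DERIV_cmult) simp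
  qed
  then have "\<exists>\<tau>. \<forall>n\<ge>N. -pi/4 < \<tau> n \<and> \<tau> n < pi/4 \<and> (\<forall>t. - pi / 4 \<le> t \<and> t \<le> 3 * pi / 4 \<longrightarrow> (f (I n t) = 0 \<longleftrightarrow> t = \<tau> n))"
    by (intro choice) auto
  then obtain \<tau> where \<tau>: "\<And>n. n \<ge> N \<Longrightarrow> -pi/4 < \<tau> n" "\<And>n. n \<ge> N \<Longrightarrow> \<tau> n < pi/4"
    "\<And>n t. n \<ge> N \<Longrightarrow> - pi / 4 \<le> t \<Longrightarrow> t \<le> 3 * pi / 4 \<Longrightarrow> f (I n t) = 0 \<longleftrightarrow> t = \<tau> n"
    by blast
  define z where "z i = I (N + i) (\<tau> (N + i))" for i
  define F where "F = {x. 0 < x \<and> x < \<phi> + real N * pi - pi / 4 \<and> f x = 0}"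
  have z0: "f (z i) = 0" for i
    unfolding z_def using \<tau>(1,2)[of "N+i"] \<tau>(3)[of "N + i" "\<tau> (N + i)"] pi_gt_zero by auto
  have zX: "z i \<ge> X" for i unfolding z_def using I \<tau>(1)[of "N+i"] by simp
  have "strict_mono z"
  proof (rule strict_mono_Suc_iff[THEN iffD2], rule allI)
    fix i
    show "z i < z (Suc i)"
    proof -
      have "\<tau> (N + i) < pi + \<tau> (N + Suc i)"
        using \<tau>(1)[of "N + Suc i"] \<tau>(2)[of "N + i"] pi_gt_zero by linarith
      then show ?thesis by (simp add: z_def I_def algebra_simps)
    qed
  qed
  moreover have "finite F"
    by (rule finite_subset[OF _ fin[of "\<phi> + real N * pi - pi / 4"]]) (auto simp: F_def)
  moreover have "x < z n" if "x \<in> F" for x n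
  proof -
    have "real N * pi \<le> real (N + n) * pi" by simp
    moreover have "- pi / 4 < \<tau> (N + n)" by (intro \<tau>(1)) simp
    moreover have "x < \<phi> + real N * pi - pi / 4" using that by (simp add: F_def)
    ultimately show ?thesis unfolding z_def I_def by linarith
  qed
  moreover have "{x. 0 < x \<and> f x = 0} = F \<union> range z"
  proof (intro set_eqI iffI)
    fix x assume "x \<in> F \<union> range z"
    then show "x \<in> {x. 0 < x \<and> f x = 0}"
      using z0 zX X by (auto simp: F_def)
  next
    fix x assume x: "x \<in> {x. 0 < x \<and> f x = 0}"
    show "x \<in> F \<union> range z"
    proof (cases "x < \<phi> + real N * pi - pi / 4")
      case True
      then show ?thesis using x by (simp add: F_def)
    next
      case False
      \<comment> \<open>Measured from the left ends of the windows, the integer part of r is the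
        number of the window containing x.\<close>
      define r where "r = (x - \<phi> + pi / 4) / pi"
      define n where "n = nat \<lfloor>r\<rfloor>"
      have "r \<ge> real N" using False unfolding r_def by (simp add: field_simps)
      then have n: "n \<ge> N" "real n \<le> r" "r < real n + 1"
        unfolding n_def by linarith+
      have xr: "x = \<phi> - pi / 4 + r * pi" by (simp add: r_def)
      define t where "t = x - \<phi> - real n * pi"
      have "real n * pi \<le> r * pi" "r * pi < (real n + 1) * pi"
        using n by auto
      then have t: "- pi / 4 \<le> t" "t \<le> 3 * pi / 4"
        unfolding t_def xr by (auto simp: algebra_simps)
      have xI: "x = I n t" by (simp add: t_def I_def)
      then have "t = \<tau> n" using \<tau>(3)[OF n(1) t] x by simp
      then have "x = z (n - N)" using n xI by (simp add: z_def)
      then show ?thesis by simp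
    qed
  qed
  ultimately have enum: "enumerates_positive_zeros f
     (\<lambda>p. if p \<le> card F then sorted_list_of_set F ! (p - 1) else z (p - card F - 1))"
    (is "enumerates_positive_zeros f ?k") by (intro enumerate_prepend)
  have z_lim: "filterlim z at_top sequentially"
  proof (rule filterlim_at_top_mono)
    show "filterlim (\<lambda>i. \<phi> + real (N + i) * pi - pi / 4) at_top sequentially"
      by real_asymp
    show "eventually (\<lambda>i. \<phi> + real (N + i) * pi - pi / 4 \<le> z i) sequentially"
      using \<tau>(1) by (intro always_eventually allI) (simp add: z_def I_def less_imp_le)
  qed
  have "(\<lambda>i. \<tau> (N + i)) \<longlonglongrightarrow> 0"
  proof -
    have "(\<lambda>i. f (z i) - sin (z i - \<phi>)) \<longlonglongrightarrow> 0"
      by (rule filterlim_compose[OF s z_lim])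
    then have "(\<lambda>i. \<bar>f (z i) - sin (z i - \<phi>)\<bar>) \<longlonglongrightarrow> 0" by (rule tendsto_rabs_zero)
    moreover have "\<bar>f (z i) - sin (z i - \<phi>)\<bar> = \<bar>sin (\<tau> (N + i))\<bar>" for i
      by (simp add: z0) (simp add: z_def sc abs_mult power_abs)
    ultimately have "(\<lambda>i. sin (\<tau> (N + i))) \<longlonglongrightarrow> 0" by (simp add: tendsto_rabs_zero_iff)
    then have "(\<lambda>i. arcsin (sin (\<tau> (N + i)))) \<longlonglongrightarrow> arcsin 0"
      by (intro isCont_tendsto_compose[OF isCont_arcsin]) auto
    moreover have "arcsin (sin (\<tau> (N + i))) = \<tau> (N + i)" for i
      using \<tau>(1,2)[of "N + i"] pi_gt_zero by (intro arcsin_sin) auto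
    ultimately show ?thesis by simp
  qed
  then have "(\<lambda>i. z i - (\<phi> + real (N + i) * pi)) \<longlonglongrightarrow> 0"
    by (simp add: z_def I_def)
  \<comment> \<open>The first index past F is \<open>card F + 1\<close> and belongs to window N,
    whence j = N - card F - 1.\<close>
  moreover have "?k (i + (card F + 1)) - (\<phi> + (real (i + (card F + 1)) + of_int (int N - int (card F) - 1)) * pi)
      = z i - (\<phi> + real (N + i) * pi)" for i
    by (simp add: algebra_simps)
  ultimately have "(\<lambda>i. ?k (i + (card F + 1)) - (\<phi> + (real (i + (card F + 1)) + of_int (int N - int (card F) - 1)) * pi)) \<longlonglongrightarrow> 0"
    by (simp only:)
  then have "(\<lambda>p. ?k p - (\<phi> + (real p + of_int (int N - int (card F) - 1)) * pi)) \<longlonglongrightarrow> 0"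
    by (rule LIMSEQ_offset)
  with enum show ?thesis by blast
qed


section \<open>Zeros of \<open>u' + (b/x) u\<close>\<close>

text \<open>By periodicity the function is constant along 2 pi n and along pi/2 + 2 pi n, with
  values Im L and Re L. Thus u alone, without u', determines K.\<close>

lemma tendsto_zero_of_Im_cis_multiple:
  assumes "((\<lambda>x. Im (L * cis x)) \<longlongrightarrow> 0) at_top"
  shows "L = 0"
proof -
  have t: "filterlim (\<lambda>n. c + 2 * real n * pi) at_top sequentially" for c
    by real_asymp
  have "(\<lambda>n. Im (L * cis (0 + 2 * real n * pi))) \<longlonglongrightarrow> 0"
    by (rule filterlim_compose[OF assms t])
  then have "Im L = 0" by (simp add: cos_add sin_add tendsto_const_iff)
  have "(\<lambda>n. Im (L * cis (pi / 2 + 2 * real n * pi))) \<longlonglongrightarrow> 0"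
    by (rule filterlim_compose[OF assms t])
  then have "Re L = 0" by (simp add: cos_add sin_add tendsto_const_iff)
  with \<open>Im L = 0\<close> show ?thesis by (simp add: complex_eq_iff)
qed

lemma oscillates_like_Re_Im:
  assumes "oscillates_like K u v"
  shows "((\<lambda>x. u x - Im (K * cis x)) \<longlongrightarrow> 0) at_top" "((\<lambda>x. v x - Re (K * cis x)) \<longlongrightarrow> 0) at_top"
  using tendsto_Im[OF assms[unfolded oscillates_like_def]] tendsto_Re[OF assms[unfolded oscillates_like_def]]
  by simp_all

lemma oscillates_like_cos_sin:
  assumes "oscillates_like (of_real A * \<i> * cis (- \<phi>)) u v"
  shows "((\<lambda>x. u x - A * cos (x - \<phi>)) \<longlongrightarrow> 0) at_top" "((\<lambda>x. v x + A * sin (x - \<phi>)) \<longlongrightarrow> 0) at_top"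
proof -
  have eq: "of_real A * \<i> * cis (- \<phi>) * cis x = of_real A * \<i> * cis (x - \<phi>)" for x
    unfolding mult.assoc cis_mult by simp
  have "Im (of_real A * \<i> * cis (- \<phi>) * cis x) = A * cos (x - \<phi>)"
    "Re (of_real A * \<i> * cis (- \<phi>) * cis x) = - A * sin (x - \<phi>)" for x
    unfolding eq by simp_all
  with oscillates_like_Re_Im[OF assms]
  show "((\<lambda>x. u x - A * cos (x - \<phi>)) \<longlongrightarrow> 0) at_top" "((\<lambda>x. v x + A * sin (x - \<phi>)) \<longlongrightarrow> 0) at_top"
    by (simp_all only: mult_minus_left minus_diff_eq diff_minus_eq_add)
qed

lemma oscillates_like_divide:
  assumes "oscillates_like K u v"
  shows "((\<lambda>x. c / x * u x) \<longlongrightarrow> 0) at_top" "((\<lambda>x. c / x * v x) \<longlongrightarrow> 0) at_top"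
proof -
  have c: "((\<lambda>x. c / x) \<longlongrightarrow> 0) at_top" by real_asymp
  have b: "Bfun (\<lambda>x. Im (K * cis x)) at_top" "Bfun (\<lambda>x. Re (K * cis x)) at_top"
    by (rule BfunI[of _ "norm K"], rule always_eventually, rule allI,
        use abs_Im_le_cmod[of "K * cis _"] abs_Re_le_cmod[of "K * cis _"] in \<open>simp add: norm_mult\<close>)+
  show "((\<lambda>x. c / x * u x) \<longlongrightarrow> 0) at_top"
    using tendsto_add[OF tendsto_mult_zero[OF c oscillates_like_Re_Im(1)[OF assms]] Bfun_zero_mult[OF c b(1)]]
    by (simp add: right_diff_distrib)
  show "((\<lambda>x. c / x * v x) \<longlongrightarrow> 0) at_top"
    using tendsto_add[OF tendsto_mult_zero[OF c oscillates_like_Re_Im(2)[OF assms]] Bfun_zero_mult[OF c b(2)]]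
    by (simp add: right_diff_distrib)
qed

text \<open>A bootstrap: |sin \<delta>| \<ge> |\<delta>|/2 first gives the crude bound |\<delta>|
  \<le> 2(|b| + D)/z. Then replacing sin \<delta> by \<delta> costs a cube of this, and replacing
  cos \<delta> by 1 costs its square times b/z, both of order z^-3.\<close>

lemma phase_error_bound:
  fixes \<delta> z b D :: real
  assumes z: "z \<ge> 1" and \<delta>: "\<bar>\<delta>\<bar> \<le> 1" and e: "\<bar>sin \<delta> - b / z * cos \<delta>\<bar> \<le> D / z ^ 3"
  shows "\<bar>\<delta> - b / z\<bar> \<le> (D + (2 * (\<bar>b\<bar> + D)) ^ 3 + \<bar>b\<bar> * (2 * (\<bar>b\<bar> + D))\<^sup>2) / z ^ 3"
proof -
  define C where "C = 2 * (\<bar>b\<bar> + D)"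
  have "0 \<le> D / z ^ 3" using e by linarith
  then have D: "D \<ge> 0" using z by (simp add: zero_le_divide_iff)
  have s3: "\<bar>sin \<delta> - \<delta>\<bar> \<le> \<bar>\<delta>\<bar> ^ 3 / 6"
    using Maclaurin_sin_bound[of \<delta> 3] by (simp add: sin_coeff_def eval_nat_numeral)
  have c2: "\<bar>cos \<delta> - 1\<bar> \<le> \<delta>\<^sup>2"
  proof -
    have "cos \<delta> - 1 = - 2 * (sin (\<delta> / 2))\<^sup>2" using cos_double_sin[of "\<delta> / 2"] by simp
    moreover have "(sin (\<delta> / 2))\<^sup>2 \<le> (\<delta> / 2)\<^sup>2"
      by (rule abs_le_square_iff[THEN iffD1, OF abs_sin_x_le_abs_x])
    ultimately show ?thesis
      by (simp add: power_divide) (use zero_le_power2[of "sin (\<delta> / 2)"] in linarith)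
  qed
  have zz: "1 / z ^ 3 \<le> 1 / z" using z by (intro divide_left_mono) (auto simp: self_le_power)
  have "\<bar>\<delta>\<bar> ^ 3 \<le> \<bar>\<delta>\<bar> ^ 1" using \<delta> by (intro power_decreasing) auto
  then have "\<bar>\<delta>\<bar> / 2 \<le> \<bar>sin \<delta>\<bar>" using s3 by (simp only: power_one_right)
  also have "\<bar>sin \<delta>\<bar> \<le> \<bar>b / z * cos \<delta>\<bar> + D / z ^ 3"
    using order_trans[OF abs_triangle_ineq2 e] by (simp only: diff_le_eq add.commute)
  also have "\<bar>b / z * cos \<delta>\<bar> \<le> \<bar>b\<bar> / z * 1"
    unfolding abs_mult using z by (intro mult_mono) auto
  also have "D / z ^ 3 \<le> D / z" using mult_left_mono[OF zz D] by simp
  finally have dz: "\<bar>\<delta>\<bar> \<le> C / z" by (simp add: C_def algebra_simps add_divide_distrib)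
  have "\<bar>\<delta>\<bar> ^ 3 \<le> (C / z) ^ 3" using dz by (intro power_mono) auto
  then have t1: "\<bar>sin \<delta> - \<delta>\<bar> \<le> C ^ 3 / z ^ 3"
    using s3 abs_ge_zero[of "sin \<delta> - \<delta>"] unfolding power_divide by linarith
  have "\<bar>\<delta>\<bar>\<^sup>2 \<le> (C / z)\<^sup>2" using dz by (intro power_mono) auto
  then have "\<bar>cos \<delta> - 1\<bar> \<le> C\<^sup>2 / z\<^sup>2" using c2 by (simp add: power_divide)
  then have "\<bar>b / z\<bar> * \<bar>cos \<delta> - 1\<bar> \<le> \<bar>b\<bar> / z * (C\<^sup>2 / z\<^sup>2)"
    using z by (intro mult_mono) auto
  then have t2: "\<bar>b / z * (cos \<delta> - 1)\<bar> \<le> \<bar>b\<bar> * C\<^sup>2 / z ^ 3"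
    by (simp add: abs_mult power2_eq_square power3_eq_cube)
  have "\<delta> - b / z = (sin \<delta> - b / z * cos \<delta>) - (sin \<delta> - \<delta>) + b / z * (cos \<delta> - 1)"
    by (simp add: algebra_simps)
  then have "\<bar>\<delta> - b / z\<bar> \<le> D / z ^ 3 + C ^ 3 / z ^ 3 + \<bar>b\<bar> * C\<^sup>2 / z ^ 3"
    using e t1 t2 by linarith
  then show ?thesis by (simp add: C_def add_divide_distrib)
qed

text \<open>Again in two rounds, with \<Delta> = y - z. The crude bound \<Delta> \<le> 4 gives
  \<Delta> = pi + O(1/z). Then 1/y - 1/z = -\<Delta>/z^2 + \<Delta>^2/(z^2 y), where \<Delta> may be
  replaced by pi at a cost of order z^-3.\<close>

lemma spacing_bound:
  fixes y z c r s C :: real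
  assumes z: "1 \<le> z" "z \<le> y" and d: "y - z \<le> 4"
    and eq: "y - z = pi + c * (1 / y - 1 / z) + (s - r)"
    and r: "\<bar>r\<bar> \<le> C / z ^ 3" and s: "\<bar>s\<bar> \<le> C / z ^ 3"
  shows "\<bar>y - z - pi * (1 - c / z\<^sup>2)\<bar> \<le> (2 * C + \<bar>c\<bar> * (4 * \<bar>c\<bar> + 2 * C) + 16 * \<bar>c\<bar>) / z ^ 3"
proof -
  define \<Delta> where "\<Delta> = y - z"
  have \<Delta>: "0 \<le> \<Delta>" "\<Delta> \<le> 4" using z d by (simp_all add: \<Delta>_def)
  have y: "y > 0" using z by simp
  have "0 \<le> C / z ^ 3" using r by linarith
  then have C: "C \<ge> 0" using z by (simp add: zero_le_divide_iff)
  have p: "z * z \<le> z * y" "1 \<le> z ^ 2" "z \<le> z * z" using z by (auto simp: power2_eq_square mult_left_mono intro: order_trans[of 1 z])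
  have q1: "1 / y - 1 / z = - (\<Delta> / (z * y))"
    using z y by (simp add: \<Delta>_def field_simps)
  have q2: "1 / y - 1 / z = - \<Delta> / z\<^sup>2 + \<Delta>\<^sup>2 / (z\<^sup>2 * y)"
    using z y by (simp add: \<Delta>_def field_simps power2_eq_square)
  have zz: "C / z ^ 3 \<le> C / z"
    using z C by (intro divide_left_mono) (auto simp: self_le_power)
  have "\<bar>c * (1 / y - 1 / z)\<bar> = \<bar>c\<bar> * (\<Delta> / (z * y))"
    using z y \<Delta> by (simp add: q1 abs_mult)
  also have "\<dots> \<le> \<bar>c\<bar> * (4 / z)"
    using z y \<Delta> p by (intro mult_left_mono frac_le) auto
  finally have "\<bar>c * (1 / y - 1 / z)\<bar> \<le> 4 * \<bar>c\<bar> / z" by simp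
  then have "\<bar>\<Delta> - pi\<bar> \<le> 4 * \<bar>c\<bar> / z + C / z + C / z"
    using eq r s zz unfolding \<Delta>_def by linarith
  then have dp: "\<bar>\<Delta> - pi\<bar> \<le> (4 * \<bar>c\<bar> + 2 * C) / z" by (simp add: add_divide_distrib)
  have "\<bar>c\<bar> / z\<^sup>2 * \<bar>\<Delta> - pi\<bar> \<le> \<bar>c\<bar> / z\<^sup>2 * ((4 * \<bar>c\<bar> + 2 * C) / z)"
    using dp by (intro mult_left_mono) auto
  then have t1: "\<bar>c / z\<^sup>2 * (\<Delta> - pi)\<bar> \<le> \<bar>c\<bar> * (4 * \<bar>c\<bar> + 2 * C) / z ^ 3"
    using z by (simp add: abs_mult power2_eq_square power3_eq_cube)
  have "\<Delta>\<^sup>2 \<le> 4\<^sup>2" using \<Delta> by (intro power_mono) auto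
  then have "\<bar>c\<bar> * (\<Delta>\<^sup>2 / (z\<^sup>2 * y)) \<le> \<bar>c\<bar> * (16 / z ^ 3)"
    using z y by (intro mult_left_mono frac_le) (auto simp: power2_eq_square power3_eq_cube intro: mult_left_mono)
  then have t2: "\<bar>c * (\<Delta>\<^sup>2 / (z\<^sup>2 * y))\<bar> \<le> 16 * \<bar>c\<bar> / z ^ 3"
    using z y by (simp add: abs_mult mult.commute)
  have "y - z - pi * (1 - c / z\<^sup>2) = c * (1 / y - 1 / z) + (s - r) + pi * c / z\<^sup>2"
    unfolding eq by (simp add: algebra_simps)
  also have "\<dots> = (s - r) - c / z\<^sup>2 * (\<Delta> - pi) + c * (\<Delta>\<^sup>2 / (z\<^sup>2 * y))"
    unfolding q2 by (simp add: algebra_simps diff_divide_distrib)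
  finally have yz: "y - z - pi * (1 - c / z\<^sup>2) = (s - r) - c / z\<^sup>2 * (\<Delta> - pi) + c * (\<Delta>\<^sup>2 / (z\<^sup>2 * y))" .
  have tri: "\<bar>(s - r) - e + f\<bar> \<le> s' + r' + e' + f'"
    if "\<bar>s\<bar> \<le> s'" "\<bar>r\<bar> \<le> r'" "\<bar>e\<bar> \<le> e'" "\<bar>f\<bar> \<le> f'" for s r e f s' r' e' f' :: real
    using that by linarith
  have "\<bar>y - z - pi * (1 - c / z\<^sup>2)\<bar> \<le>
      C / z ^ 3 + C / z ^ 3 + \<bar>c\<bar> * (4 * \<bar>c\<bar> + 2 * C) / z ^ 3 + 16 * \<bar>c\<bar> / z ^ 3"
    unfolding yz by (rule tri[OF s r t1 t2])
  then show ?thesis by (simp add: add_divide_distrib)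
qed

lemma enumerates_positive_zeros_spacing_tendsto:
  assumes "(\<lambda>p. k p - (\<phi> + (real p + of_int j) * pi)) \<longlonglongrightarrow> 0"
  shows "(\<lambda>p. k (p + 1) - k p) \<longlonglongrightarrow> pi"
proof -
  have "(\<lambda>p. (k (p + 1) - (\<phi> + (real (p + 1) + of_int j) * pi)) - (k p - (\<phi> + (real p + of_int j) * pi)) + pi) \<longlonglongrightarrow> 0 - 0 + pi"
    by (intro tendsto_intros assms LIMSEQ_ignore_initial_segment[OF assms, of 1])
  then show ?thesis by (simp add: algebra_simps)
qed

lemma small_perturbation_asymptotics:
  fixes c :: real
  shows "(\<lambda>x. exp (- c / (4 * x\<^sup>2)) - 1) \<in> O(\<lambda>x. 1 / x\<^sup>2)" (is ?A)
    and "(\<lambda>x. exp (- c / (4 * x\<^sup>2))) \<in> O(\<lambda>_. 1)" (is ?B)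
    and "(\<lambda>x. cos (c / (2 * x)) - 1) \<in> O(\<lambda>x. 1 / x\<^sup>2)" (is ?C)
    and "(\<lambda>x. sin (c / (2 * x)) - c / (2 * x)) \<in> O(\<lambda>x. 1 / x\<^sup>2)" (is ?D)
    and "(\<lambda>x. sin (c / (2 * x))) \<in> O(\<lambda>x. 1 / x)" (is ?E)
proof -
  consider "c < 0" | "c = 0" | "c > 0" by linarith
  then have "?A \<and> ?B \<and> ?C \<and> ?D \<and> ?E"
  proof cases
    case 1
    then show ?thesis by (intro conjI; real_asymp)
  next
    case 3
    then show ?thesis by (intro conjI; real_asymp)
  qed auto
  then show ?A ?B ?C ?D ?E by blast+
qed

section \<open>Zeros and expansion of v + (b/x) u\<close>

context perturbed_oscillator
begin

text \<open>Some K exists in any case; comparing the imaginary parts of the two descriptions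
  identifies it.\<close>

lemma oscillates_like_if_cos:
  assumes "((\<lambda>x. u x - A * cos (x - \<phi>)) \<longlongrightarrow> 0) at_top"
  shows "oscillates_like (of_real A * \<i> * cis (- \<phi>)) u v"
proof -
  obtain K where K: "oscillates_like K u v" using ex_oscillates_like by blast
  have eq: "of_real A * \<i> * cis (- \<phi>) * cis x = of_real A * \<i> * cis (x - \<phi>)" for x
    unfolding mult.assoc cis_mult by simp
  have "Im ((K - of_real A * \<i> * cis (- \<phi>)) * cis x) =
     (u x - A * cos (x - \<phi>)) - (u x - Im (K * cis x))" for x
    unfolding left_diff_distrib eq by simp
  then have "((\<lambda>x. Im ((K - of_real A * \<i> * cis (- \<phi>)) * cis x)) \<longlongrightarrow> 0) at_top"
    using tendsto_diff[OF assms oscillates_like_Re_Im(1)[OF K]] by (simp only: diff_zero)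
  then have "K - of_real A * \<i> * cis (- \<phi>) = 0" by (rule tendsto_zero_of_Im_cis_multiple)
  then show ?thesis using K by simp
qed

lemma mixed_deriv:
  assumes "x > 0"
  shows "((\<lambda>x. v x + b / x * u x) has_real_derivative
     - (1 - lam / x\<^sup>2) * u x + b / x * v x - b / x\<^sup>2 * u x) (at x)"
  using assms by (auto intro!: derivative_eq_intros du dv simp: field_simps power2_eq_square)

lemma mixed_tendsto:
  assumes K: "oscillates_like (of_real A * \<i> * cis (- \<phi>)) u v"
  shows "((\<lambda>x. - (v x + b / x * u x) - A * sin (x - \<phi>)) \<longlongrightarrow> 0) at_top"
    and "((\<lambda>x. - (- (1 - lam / x\<^sup>2) * u x + b / x * v x - b / x\<^sup>2 * u x) - A * cos (x - \<phi>)) \<longlongrightarrow> 0) at_top"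
proof -
  note cs = oscillates_like_cos_sin[OF K] and dv = oscillates_like_divide[OF K]
  have "((\<lambda>x. - (v x + A * sin (x - \<phi>)) - b / x * u x) \<longlongrightarrow> - 0 - 0) at_top"
    by (intro tendsto_intros cs dv)
  then show "((\<lambda>x. - (v x + b / x * u x) - A * sin (x - \<phi>)) \<longlongrightarrow> 0) at_top"
    by (simp add: algebra_simps)
  have i: "((\<lambda>x::real. 1 / x) \<longlongrightarrow> 0) at_top" by real_asymp
  have "((\<lambda>x. (u x - A * cos (x - \<phi>)) + 1 / x * ((b - lam) / x * u x) - b / x * v x) \<longlongrightarrow> 0 + 0 * 0 - 0) at_top"
    by (intro tendsto_intros cs dv i)
  moreover have "(u x - A * cos (x - \<phi>)) + 1 / x * ((b - lam) / x * u x) - b / x * v x =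
      - (- (1 - lam / x\<^sup>2) * u x + b / x * v x - b / x\<^sup>2 * u x) - A * cos (x - \<phi>)" for x
    by (simp add: algebra_simps diff_divide_distrib power2_eq_square)
  ultimately show "((\<lambda>x. - (- (1 - lam / x\<^sup>2) * u x + b / x * v x - b / x\<^sup>2 * u x) - A * cos (x - \<phi>)) \<longlongrightarrow> 0) at_top"
    by (simp only: mult_zero_left add_0 diff_zero)
qed

lemma mixed_zeros:
  assumes K: "oscillates_like (of_real A * \<i> * cis (- \<phi>)) u v" and A: "A > 0"
    and fin: "\<And>M. finite {x. 0 < x \<and> x \<le> M \<and> v x + b / x * u x = 0}"
  shows "\<exists>k j. enumerates_positive_zeros (\<lambda>x. v x + b / x * u x) k \<and>
     (\<lambda>p. k p - (\<phi> + (real p + of_int j) * pi)) \<longlonglongrightarrow> 0"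
proof -
  define f where "f x = - (v x + b / x * u x) / A" for x
  define f' where "f' x = - (- (1 - lam / x\<^sup>2) * u x + b / x * v x - b / x\<^sup>2 * u x) / A" for x
  have "\<exists>k j. enumerates_positive_zeros f k \<and> (\<lambda>p. k p - (\<phi> + (real p + of_int j) * pi)) \<longlonglongrightarrow> 0"
  proof (rule sine_like_zeros)
    show "(f has_real_derivative f' x) (at x)" if "x > 0" for x
      unfolding f_def[abs_def] f'_def
      by (intro DERIV_cdivide DERIV_minus mixed_deriv that)
    have "((\<lambda>x. (- (v x + b / x * u x) - A * sin (x - \<phi>)) / A) \<longlongrightarrow> 0 / A) at_top"
      by (intro tendsto_divide mixed_tendsto[OF K] tendsto_const) (use A in simp)
    then show "((\<lambda>x. f x - sin (x - \<phi>)) \<longlongrightarrow> 0) at_top"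
      using A by (simp add: f_def diff_divide_distrib)
    have "((\<lambda>x. (- (- (1 - lam / x\<^sup>2) * u x + b / x * v x - b / x\<^sup>2 * u x) - A * cos (x - \<phi>)) / A) \<longlongrightarrow> 0 / A) at_top"
      by (intro tendsto_divide mixed_tendsto[OF K] tendsto_const) (use A in simp)
    then show "((\<lambda>x. f' x - cos (x - \<phi>)) \<longlongrightarrow> 0) at_top"
      using A unfolding f'_def diff_divide_distrib[of _ "A * _"] by simp
    show "finite {x. 0 < x \<and> x \<le> M \<and> f x = 0}" for M
      using fin[of M] A unfolding f_def divide_eq_0_iff neg_equal_0_iff_equal by simp
  qed
  moreover have "enumerates_positive_zeros f = enumerates_positive_zeros (\<lambda>x. v x + b / x * u x)"
    using A unfolding enumerates_positive_zeros_def[abs_def] f_def divide_eq_0_iff neg_equal_0_iff_equal by simp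
  ultimately show ?thesis by simp
qed

lemma mixed_spacing:
  assumes K: "oscillates_like (of_real A * \<i> * cis (- \<phi>)) u v" and A: "A > 0"
    and k: "enumerates_positive_zeros (\<lambda>x. v x + b / x * u x) k"
    and lim: "(\<lambda>p. k p - (\<phi> + (real p + of_int j) * pi)) \<longlonglongrightarrow> 0"
  shows "\<exists>C. eventually (\<lambda>p. \<bar>k (p + 1) - k p - pi * (1 - (b - lam / 2) / (k p)\<^sup>2)\<bar> \<le> C / (k p) ^ 3) sequentially"
proof -
  obtain D where D: "\<And>x. x \<ge> 1 \<Longrightarrow>
    \<bar>exp (lam / (4 * x\<^sup>2)) * (v x + b / x * u x) -
       A * (b / x * cos (x - \<phi> + lam / (2 * x)) - sin (x - \<phi> + lam / (2 * x)))\<bar> \<le> D / x ^ 3"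
    using mixed_derivative_bound[OF K] by blast
  have zero: "v (k p) + b / k p * u (k p) = 0" and mono: "k p < k (p + 1)" if "p \<ge> 1" for p
    using k that unfolding enumerates_positive_zeros_def strict_mono_on_def by auto
  \<comment> \<open>The distance of the corrected phase from a multiple of pi. At a zero it is b/k +
    O(k^-3), so solving its definition for \<open>k p\<close> gives the expansion with coefficient b
    - lam/2.\<close>
  define \<delta> where "\<delta> p = k p - \<phi> + lam / (2 * k p) - (real p + of_int j) * pi" for p
  have k_top: "filterlim k at_top sequentially"
  proof -
    have "filterlim (\<lambda>p. (k p - (\<phi> + (real p + of_int j) * pi)) + (\<phi> + (real p + of_int j) * pi)) at_top sequentially"
      by (rule filterlim_tendsto_add_at_top[OF lim]) real_asymp
    then show ?thesis by simp
  qed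
  have "((\<lambda>x. lam / (2 * x)) \<longlongrightarrow> 0) at_top" by real_asymp
  then have "(\<lambda>p. (k p - (\<phi> + (real p + of_int j) * pi)) + lam / (2 * k p)) \<longlonglongrightarrow> 0 + 0"
    by (intro tendsto_add lim filterlim_compose[OF _ k_top])
  then have \<delta>_lim: "\<delta> \<longlonglongrightarrow> 0" by (simp add: \<delta>_def[abs_def] algebra_simps)
  define C where "C = D / A + (2 * (\<bar>b\<bar> + D / A)) ^ 3 + \<bar>b\<bar> * (2 * (\<bar>b\<bar> + D / A))\<^sup>2"
  have \<delta>_bound: "\<bar>\<delta> p - b / k p\<bar> \<le> C / k p ^ 3" if p: "p \<ge> 1" "k p \<ge> 1" "\<bar>\<delta> p\<bar> \<le> 1" for p
  proof -
    define T where "T = k p - \<phi> + lam / (2 * k p)"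
    define n where "n = int p + j"
    have T: "T = \<delta> p + of_int n * pi" by (simp add: T_def \<delta>_def n_def)
    \<comment> \<open>A shift by a multiple of pi multiplies sine and cosine by the same sign, which
      the absolute value removes.\<close>
    have sc: "\<bar>sin \<delta>' - c * cos \<delta>'\<bar> = \<bar>sin (\<delta>' + of_int n * pi) - c * cos (\<delta>' + of_int n * pi)\<bar>" for \<delta>' c
    proof -
      define N where "N = of_int n * pi"
      have sN: "sin N = 0" unfolding N_def by (metis sin_zero_iff_int2)
      then have cN: "\<bar>cos N\<bar> = 1"
        using sin_cos_squared_add[of N] by (auto simp: power2_eq_1_iff)
      have "sin (\<delta>' + N) - c * cos (\<delta>' + N) = (sin \<delta>' - c * cos \<delta>') * cos N"
        by (simp add: sin_add cos_add sN algebra_simps)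
      then show ?thesis using cN by (simp add: abs_mult flip: N_def)
    qed
    have "\<bar>A * (b / k p * cos T - sin T)\<bar> \<le> D / k p ^ 3"
      using D[OF p(2)] zero[OF p(1)] by (simp add: T_def)
    then have "A * \<bar>sin T - b / k p * cos T\<bar> \<le> D / k p ^ 3"
      using A by (simp add: abs_mult abs_minus_commute)
    then have "\<bar>sin T - b / k p * cos T\<bar> \<le> D / k p ^ 3 / A"
      using A by (simp only: pos_le_divide_eq mult.commute)
    then have "\<bar>sin T - b / k p * cos T\<bar> \<le> D / A / k p ^ 3"
      by (simp only: divide_divide_eq_left mult.commute)
    then have "\<bar>sin (\<delta> p) - b / k p * cos (\<delta> p)\<bar> \<le> D / A / k p ^ 3"
      unfolding sc[of "\<delta> p" "b / k p"] T .
    from phase_error_bound[OF p(2,3) this] show ?thesis unfolding C_def .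
  qed
  define c where "c = b - lam / 2"
  have "eventually (\<lambda>p. p \<ge> 1 \<and> k p \<ge> 1 \<and> \<bar>\<delta> p\<bar> \<le> 1 \<and> \<bar>\<delta> (p + 1)\<bar> \<le> 1 \<and> k (p + 1) - k p \<le> 4) sequentially"
  proof (intro eventually_conj eventually_ge_at_top)
    show "eventually (\<lambda>p. k p \<ge> 1) sequentially"
      using k_top by (simp add: filterlim_at_top)
    have d: "eventually (\<lambda>p. \<bar>\<delta> p\<bar> \<le> 1) sequentially"
      using tendstoD[OF \<delta>_lim, of 1] by (auto elim!: eventually_mono simp: dist_norm)
    then show "eventually (\<lambda>p. \<bar>\<delta> p\<bar> \<le> 1) sequentially" .
    show "eventually (\<lambda>p. \<bar>\<delta> (p + 1)\<bar> \<le> 1) sequentially"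
      using d by (subst eventually_sequentially_seg)
    show "eventually (\<lambda>p. k (p + 1) - k p \<le> 4) sequentially"
      using order_tendstoD(2)[OF enumerates_positive_zeros_spacing_tendsto[OF lim] pi_less_4]
      by (auto elim!: eventually_mono)
  qed
  then have "eventually (\<lambda>p. \<bar>k (p + 1) - k p - pi * (1 - c / (k p)\<^sup>2)\<bar> \<le>
      (2 * C + \<bar>c\<bar> * (4 * \<bar>c\<bar> + 2 * C) + 16 * \<bar>c\<bar>) / (k p) ^ 3) sequentially"
  proof eventually_elim
    case (elim p)
    have kp: "k p < k (p + 1)" using elim by (intro mono) auto
    have s1: "\<bar>\<delta> (p + 1) - b / k (p + 1)\<bar> \<le> C / k (p + 1) ^ 3"
      using elim kp by (intro \<delta>_bound) auto
    \<comment> \<open>The sign of C is read off from the bound itself; as k increases, the estimate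
      at p + 1 then becomes one in terms of \<open>k p\<close>.\<close>
    have "0 \<le> C / k (p + 1) ^ 3" using s1 by linarith
    then have "C \<ge> 0" using elim kp by (auto simp: zero_le_divide_iff)
    then have "C / k (p + 1) ^ 3 \<le> C / k p ^ 3"
      using elim kp by (intro divide_left_mono power_mono) auto
    with s1 have s: "\<bar>\<delta> (p + 1) - b / k (p + 1)\<bar> \<le> C / k p ^ 3" by linarith
    have r: "\<bar>\<delta> p - b / k p\<bar> \<le> C / k p ^ 3" using elim by (intro \<delta>_bound) auto
    show ?case
    proof (rule spacing_bound[OF _ _ _ _ r s])
      show "k (p + 1) - k p = pi + c * (1 / k (p + 1) - 1 / k p) + (\<delta> (p + 1) - b / k (p + 1) - (\<delta> p - b / k p))"
        by (simp add: \<delta>_def c_def algebra_simps)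
    qed (use elim kp in auto)
  qed
  then show ?thesis unfolding c_def by blast
qed

text \<open>At accuracy x^-2 the exponential may be replaced by 1, and the addition formulas move
  the phase correction lam/(2x) into the coefficient of the cosine, changing b to b - lam/2.\<close>

lemma mixed_expansion:
  assumes K: "oscillates_like (of_real A * \<i> * cis (- \<phi>)) u v" and A: "A > 0"
  shows "(\<lambda>x. - (v x + b / x * u x) / A - (sin (x - \<phi>) - (b - lam / 2) / x * cos (x - \<phi>))) \<in> O(\<lambda>x. 1 / x\<^sup>2)"
proof -
  define e where "e x = exp (- lam / (4 * x\<^sup>2))" for x
  define \<epsilon> where "\<epsilon> x = lam / (2 * x)" for x
  define T where "T x = sin (x - \<phi> + \<epsilon> x) - b / x * cos (x - \<phi> + \<epsilon> x)" for x
  define h where "h x = - (v x + b / x * u x)" for x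
  have bd: "(\<lambda>x. sin (x - \<phi>)) \<in> O(\<lambda>_. 1 :: real)" "(\<lambda>x. cos (x - \<phi>)) \<in> O(\<lambda>_. 1 :: real)"
     "(\<lambda>x. sin (x - \<phi> + \<epsilon> x)) \<in> O(\<lambda>_. 1 :: real)" "(\<lambda>x. cos (x - \<phi> + \<epsilon> x)) \<in> O(\<lambda>_. 1 :: real)"
    by (rule bigoI[of _ 1]; simp)+
  have e_asymp: "(\<lambda>x. e x - 1) \<in> O(\<lambda>x. 1 / x\<^sup>2)" and e1: "e \<in> O(\<lambda>_. 1)"
    and c_asymp: "(\<lambda>x. cos (\<epsilon> x) - 1) \<in> O(\<lambda>x. 1 / x\<^sup>2)"
    and s_asymp: "(\<lambda>x. sin (\<epsilon> x) - \<epsilon> x) \<in> O(\<lambda>x. 1 / x\<^sup>2)"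
    and s1_asymp: "(\<lambda>x. sin (\<epsilon> x)) \<in> O(\<lambda>x. 1 / x)"
    unfolding e_def[abs_def] \<epsilon>_def using small_perturbation_asymptotics[of lam] by auto
  have b_asymp1: "(\<lambda>x. b / x) \<in> O(\<lambda>x. 1 / x)"
    by (rule bigoI[of _ "\<bar>b\<bar>"]) simp
  have "(\<lambda>x::real. 1 / x) \<in> O(\<lambda>x. 1)" by real_asymp
  note b_asymp = b_asymp1 landau_o.big.trans[OF b_asymp1 this]
  obtain D where D: "\<And>x. x \<ge> 1 \<Longrightarrow>
    \<bar>exp (lam / (4 * x\<^sup>2)) * (v x + b / x * u x) -
       A * (b / x * cos (x - \<phi> + lam / (2 * x)) - sin (x - \<phi> + lam / (2 * x)))\<bar> \<le> D / x ^ 3"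
    using mixed_derivative_bound[OF K] by blast
  have r: "(\<lambda>x. exp (lam / (4 * x\<^sup>2)) * h x / A - T x) \<in> O(\<lambda>x. 1 / x\<^sup>2)"
  proof (rule bigoI[of _ "D / A"])
    show "eventually (\<lambda>x. norm (exp (lam / (4 * x\<^sup>2)) * h x / A - T x) \<le> D / A * norm (1 / x\<^sup>2)) at_top"
      using eventually_ge_at_top[of 1]
    proof eventually_elim
      case (elim x)
      have "A * (exp (lam / (4 * x\<^sup>2)) * h x / A - T x) =
        - (exp (lam / (4 * x\<^sup>2)) * (v x + b / x * u x) -
       A * (b / x * cos (x - \<phi> + lam / (2 * x)) - sin (x - \<phi> + lam / (2 * x))))"
        using A by (simp add: h_def T_def \<epsilon>_def right_diff_distrib) (simp add: field_simps)
      then have "\<bar>A * (exp (lam / (4 * x\<^sup>2)) * h x / A - T x)\<bar> \<le> D / x ^ 3"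
        using D[OF elim] by (simp only: abs_minus_cancel)
      moreover have "D / x ^ 3 \<le> D / x\<^sup>2"
      proof (rule divide_left_mono)
        have "0 \<le> D / x ^ 3" using D[OF elim] by linarith
        then show "0 \<le> D" using elim by (simp add: zero_le_divide_iff)
      qed (use elim in \<open>auto intro: power_increasing\<close>)
      ultimately have "A * \<bar>exp (lam / (4 * x\<^sup>2)) * h x / A - T x\<bar> \<le> D / x\<^sup>2"
        using A unfolding abs_mult by simp
      then show ?case using A elim by (simp add: field_simps)
    qed
  qed
  have T1: "T \<in> O(\<lambda>_. 1)"
    unfolding T_def[abs_def] using landau_o.big.mult[OF b_asymp(2) bd(4)]
    by (intro sum_in_bigo bd) simp
  have main: "h x / A - (sin (x - \<phi>) - (b - lam / 2) / x * cos (x - \<phi>)) =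
     e x * (exp (lam / (4 * x\<^sup>2)) * h x / A - T x) + (e x - 1) * T x
      + (cos (\<epsilon> x) - 1) * sin (x - \<phi>) + (sin (\<epsilon> x) - \<epsilon> x) * cos (x - \<phi>)
      - (b / x * ((cos (\<epsilon> x) - 1) * cos (x - \<phi>)) - b / x * sin (\<epsilon> x) * sin (x - \<phi>))" for x
  proof -
    have ee: "e x * exp (lam / (4 * x\<^sup>2)) = 1" by (simp add: e_def flip: exp_add)
    have "e x * (exp (lam / (4 * x\<^sup>2)) * h x / A - T x) = (e x * exp (lam / (4 * x\<^sup>2))) * (h x / A) - e x * T x"
      by (simp add: algebra_simps)
    also have "\<dots> = h x / A - e x * T x" unfolding ee by simp
    finally have e: "e x * (exp (lam / (4 * x\<^sup>2)) * h x / A - T x) = h x / A - e x * T x" .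
    have T: "T x = sin (x - \<phi>) * cos (\<epsilon> x) + cos (x - \<phi>) * sin (\<epsilon> x) -
        b / x * (cos (x - \<phi>) * cos (\<epsilon> x) - sin (x - \<phi>) * sin (\<epsilon> x))"
      by (simp only: T_def sin_add cos_add)
    have bl: "(b - lam / 2) / x = b / x - \<epsilon> x" by (simp add: \<epsilon>_def diff_divide_distrib)
    have "q - (s - (\<beta> - \<eta>) * c) = (q - e' * t) + (e' - 1) * t + (c' - 1) * s + (s' - \<eta>) * c -
        (\<beta> * ((c' - 1) * c) - \<beta> * s' * s)"
      if "t = s * c' + c * s' - \<beta> * (c * c' - s * s')" for q s c s' c' \<beta> \<eta> t e' :: real
      unfolding that by (simp add: algebra_simps)
    from this[OF T] show ?thesis unfolding bl e .
  qed
  have o: "(\<lambda>x. e x * (exp (lam / (4 * x\<^sup>2)) * h x / A - T x)) \<in> O(\<lambda>x. 1 / x\<^sup>2)"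
    "(\<lambda>x. (e x - 1) * T x) \<in> O(\<lambda>x. 1 / x\<^sup>2)"
    "(\<lambda>x. (cos (\<epsilon> x) - 1) * sin (x - \<phi>)) \<in> O(\<lambda>x. 1 / x\<^sup>2)"
    "(\<lambda>x. (cos (\<epsilon> x) - 1) * cos (x - \<phi>)) \<in> O(\<lambda>x. 1 / x\<^sup>2)"
    "(\<lambda>x. (sin (\<epsilon> x) - \<epsilon> x) * cos (x - \<phi>)) \<in> O(\<lambda>x. 1 / x\<^sup>2)"
    "(\<lambda>x. b / x * sin (\<epsilon> x) * sin (x - \<phi>)) \<in> O(\<lambda>x. 1 / x\<^sup>2)"
    using landau_o.big.mult[OF e1 r] landau_o.big.mult[OF e_asymp T1]
      landau_o.big.mult[OF c_asymp bd(1)] landau_o.big.mult[OF c_asymp bd(2)]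
      landau_o.big.mult[OF s_asymp bd(2)]
      landau_o.big.mult[OF landau_o.big.mult[OF b_asymp(1) s1_asymp] bd(1)]
    by (simp_all add: power2_eq_square)
  have o': "(\<lambda>x. b / x * ((cos (\<epsilon> x) - 1) * cos (x - \<phi>))) \<in> O(\<lambda>x. 1 / x\<^sup>2)"
    using landau_o.big.mult[OF b_asymp(2) o(4)] by simp
  have "(\<lambda>x. h x / A - (sin (x - \<phi>) - (b - lam / 2) / x * cos (x - \<phi>))) \<in> O(\<lambda>x. 1 / x\<^sup>2)"
    unfolding main by (intro sum_in_bigo o o')
  then show ?thesis unfolding h_def .
qed

end


section \<open>Amplitude and phase of Bessel functions\<close>

definition scaled_bessel :: "real \<Rightarrow> real \<Rightarrow> real" where
  "scaled_bessel \<mu> x = sqrt x * bessel_J \<mu> x"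

text \<open>The derivative of \<open>scaled_bessel \<mu>\<close>, written through the next order, so
  that passing between orders is pure algebra.\<close>

definition scaled_bessel' :: "real \<Rightarrow> real \<Rightarrow> real" where
  "scaled_bessel' \<mu> x = (\<mu> + 1 / 2) / x * scaled_bessel \<mu> x - scaled_bessel (\<mu> + 1) x"

lemma scaled_bessel_deriv:
  assumes "x > 0"
  shows "(scaled_bessel \<mu> has_real_derivative scaled_bessel' \<mu> x) (at x)"
proof -
  have "((\<lambda>x. sqrt x * bessel_J \<mu> x) has_real_derivative
      inverse (sqrt x) / 2 * bessel_J \<mu> x + (\<mu> / x * bessel_J \<mu> x - bessel_J (\<mu> + 1) x) * sqrt x) (at x)"
    by (rule DERIV_mult[OF DERIV_real_sqrt[OF assms] bessel_J_deriv[OF assms]])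
  moreover have "inverse (sqrt x) / 2 = sqrt x / (2 * x)"
    using assms by (simp add: field_simps)
  ultimately show ?thesis
    using assms by (simp add: scaled_bessel_def[abs_def] scaled_bessel'_def algebra_simps add_divide_distrib)
qed

lemma scaled_bessel'_Suc:
  assumes "x > 0"
  shows "scaled_bessel' (\<mu> + 1) x = scaled_bessel \<mu> x - (\<mu> + 1 / 2) / x * scaled_bessel (\<mu> + 1) x"
proof -
  have "\<mu> + 1 + 1 = \<mu> + 2" by simp
  then show ?thesis
    unfolding scaled_bessel'_def scaled_bessel_def
    by (simp only: bessel_J_rec[OF assms]) (simp add: algebra_simps add_divide_distrib)
qed

lemma scaled_bessel'_deriv:
  assumes "x > 0"
  shows "(scaled_bessel' \<mu> has_real_derivative - (1 - (\<mu>\<^sup>2 - 1 / 4) / x\<^sup>2) * scaled_bessel \<mu> x) (at x)"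
proof -
  have "((\<lambda>x. (\<mu> + 1 / 2) / x * scaled_bessel \<mu> x - scaled_bessel (\<mu> + 1) x) has_real_derivative
     - (\<mu> + 1 / 2) / x\<^sup>2 * scaled_bessel \<mu> x + (\<mu> + 1 / 2) / x * scaled_bessel' \<mu> x - scaled_bessel' (\<mu> + 1) x) (at x)"
  proof (rule DERIV_diff[OF DERIV_cong[OF DERIV_mult]])
    show "((\<lambda>x. (\<mu> + 1 / 2) / x) has_real_derivative - (\<mu> + 1 / 2) / x\<^sup>2) (at x)"
      using assms by (auto intro!: derivative_eq_intros simp: power2_eq_square)
  qed (use assms in \<open>auto intro: scaled_bessel_deriv\<close>)
  moreover have "- (\<mu> + 1 / 2) / x\<^sup>2 * scaled_bessel \<mu> x + (\<mu> + 1 / 2) / x * scaled_bessel' \<mu> x - scaled_bessel' (\<mu> + 1) x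
     = - (1 - (\<mu>\<^sup>2 - 1 / 4) / x\<^sup>2) * scaled_bessel \<mu> x"
    unfolding scaled_bessel'_Suc[OF assms] scaled_bessel'_def[of \<mu>]
    using assms by (simp add: field_simps) (simp add: algebra_simps eval_nat_numeral)
  ultimately show ?thesis by (simp only: scaled_bessel'_def[abs_def])
qed

interpretation bessel: perturbed_oscillator "\<mu>\<^sup>2 - 1 / 4" "scaled_bessel \<mu>" "scaled_bessel' \<mu>" for \<mu>
  by unfold_locales (rule scaled_bessel_deriv scaled_bessel'_deriv; assumption)+

text \<open>Up to terms O(1/x), raising the order by one replaces the pair (u', u) by (u, -u'). In
  complex form this is multiplication by -\<i>.\<close>

lemma oscillates_like_bessel_Suc:
  assumes K: "oscillates_like K (scaled_bessel \<mu>) (scaled_bessel' \<mu>)"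
  shows "oscillates_like (- \<i> * K) (scaled_bessel (\<mu> + 1)) (scaled_bessel' (\<mu> + 1))"
proof -
  define c where "c = \<mu> + 1 / 2"
  let ?u = "scaled_bessel \<mu>" and ?v = "scaled_bessel' \<mu>"
  note dv = oscillates_like_divide[OF K, of c]
  have i: "((\<lambda>x. c / x) \<longlongrightarrow> 0) at_top" by real_asymp
  have "((\<lambda>x. Complex (- (c / x * (c / x * ?u x)) + c / x * ?v x) (c / x * ?u x)) \<longlongrightarrow> Complex (- (0 * 0) + 0) 0) at_top"
    by (intro tendsto_Complex tendsto_intros dv i)
  then have "((\<lambda>x. - \<i> * (Complex (?v x) (?u x) - K * cis x) +
      Complex (- (c / x * (c / x * ?u x)) + c / x * ?v x) (c / x * ?u x)) \<longlongrightarrow> - \<i> * 0 + Complex (- (0 * 0) + 0) 0) at_top"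
    by (intro tendsto_add tendsto_mult tendsto_const K[unfolded oscillates_like_def])
  then have lim: "((\<lambda>x. - \<i> * (Complex (?v x) (?u x) - K * cis x) +
      Complex (- (c / x * (c / x * ?u x)) + c / x * ?v x) (c / x * ?u x)) \<longlongrightarrow> 0) at_top"
    by (simp flip: zero_complex.code)
  have "- \<i> * (Complex (?v x) (?u x) - K * cis x) + Complex (- (c / x * (c / x * ?u x)) + c / x * ?v x) (c / x * ?u x) =
      Complex (scaled_bessel' (\<mu> + 1) x) (scaled_bessel (\<mu> + 1) x) - (- \<i> * K) * cis x" if x: "x > 0" for x
  proof -
    have w: "scaled_bessel (\<mu> + 1) x = c / x * ?u x - ?v x" by (simp add: scaled_bessel'_def c_def)
    have v: "scaled_bessel' (\<mu> + 1) x = ?u x - c / x * (c / x * ?u x - ?v x)"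
      unfolding scaled_bessel'_Suc[OF x] w c_def by simp
    show ?thesis unfolding w v by (simp add: complex_eq_iff right_diff_distrib)
  qed
  then show ?thesis
    unfolding oscillates_like_def
    by (intro Lim_transform_eventually[OF lim] eventually_mono[OF eventually_gt_at_top[of 0]]) auto
qed

lemma rGamma_half: "rGamma (real m + 1 / 2) = 4 ^ m * fact m / (fact (2 * m) * sqrt pi)"
proof (induction m)
  case 0
  then show ?case by (simp add: rGamma_inverse_Gamma Gamma_one_half_real inverse_eq_divide)
next
  case (Suc m)
  have "(real m + 1 / 2) * rGamma (real (Suc m) + 1 / 2) = rGamma (real m + 1 / 2)"
    using rGamma_plus1[of "real m + 1 / 2"] by (simp add: algebra_simps)
  then have "rGamma (real (Suc m) + 1 / 2) = rGamma (real m + 1 / 2) / (real m + 1 / 2)"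
    by (simp add: field_simps add_pos_nonneg)
  also have "\<dots> = 4 ^ Suc m * fact (Suc m) / (fact (2 * Suc m) * sqrt pi)"
    unfolding Suc by (simp add: divide_simps) (simp add: algebra_simps)
  finally show ?case .
qed

lemma bessel_J_minus_half:
  assumes "x > 0"
  shows "sqrt x * bessel_J (- 1 / 2) x = sqrt (2 / pi) * cos x"
proof -
  have "bessel_coeff (- 1 / 2) m * ((x / 2)\<^sup>2) ^ m = (- 1) ^ m / fact (2 * m) * x ^ (2 * m) / sqrt pi" for m
  proof -
    have "((x / 2)\<^sup>2) ^ m = x ^ (2 * m) / 4 ^ m"
      by (simp add: power_divide power_mult)
    then show ?thesis
      using rGamma_half[of m] by (simp add: bessel_coeff_def add.commute field_simps)
  qed
  then have "bessel_series (- 1 / 2) ((x / 2)\<^sup>2) = cos x / sqrt pi"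
    unfolding bessel_series_def using sums_divide[OF cos_paired[of x], of "sqrt pi"]
    by (simp add: sums_iff)
  moreover have "(x / 2) powr (- 1 / 2) = sqrt 2 / sqrt x"
  proof -
    have "(x / 2) powr (- (1 / 2)) = inverse ((x / 2) powr (1 / 2))" by (rule powr_minus)
    also have "(x / 2) powr (1 / 2) = sqrt (x / 2)" using assms by (intro powr_half_sqrt) simp
    finally show ?thesis by (simp add: real_sqrt_divide)
  qed
  ultimately show ?thesis
    using assms by (simp add: bessel_J_series real_sqrt_divide)
qed

text \<open>Integer and half-integer orders form two separate ladders with step 1, hence the
  induction by two in n with bases -1/2 and 0. Each step contributes -\<i> = cis(-pi/2), matching
  the growth of \<mu> pi/2.\<close>

lemma oscillates_like_bessel_half_integer:
  fixes n :: nat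
  defines "\<mu> \<equiv> (real n - 1) / 2"
  shows "oscillates_like (of_real (sqrt (2 / pi)) * \<i> * cis (- (\<mu> * pi / 2 + pi / 4))) (scaled_bessel \<mu>) (scaled_bessel' \<mu>)"
  unfolding \<mu>_def
proof (induction n rule: induct_nat_012)
  case 0
  have "((\<lambda>x. scaled_bessel ((real 0 - 1) / 2) x - sqrt (2 / pi) * cos (x - ((real 0 - 1) / 2 * pi / 2 + pi / 4))) \<longlongrightarrow> 0) at_top"
    by (rule tendsto_eventually, rule eventually_mono[OF eventually_gt_at_top[of 0]])
       (use bessel_J_minus_half in \<open>simp add: scaled_bessel_def\<close>)
  then show ?case by (rule bessel.oscillates_like_if_cos)
next
  case 1
  have "((\<lambda>x. scaled_bessel ((real (Suc 0) - 1) / 2) x - sqrt (2 / pi) * cos (x - ((real (Suc 0) - 1) / 2 * pi / 2 + pi / 4))) \<longlongrightarrow> 0) at_top"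
    using bessel_J_0_asymptotics by (simp add: scaled_bessel_def)
  then show ?case by (rule bessel.oscillates_like_if_cos)
next
  case (ge2 n)
  define \<nu> where "\<nu> = (real n - 1) / 2"
  have \<nu>: "(real (Suc (Suc n)) - 1) / 2 = \<nu> + 1" by (simp add: \<nu>_def field_simps)
  have "- \<i> * (of_real (sqrt (2 / pi)) * \<i> * cis (- (\<nu> * pi / 2 + pi / 4))) =
     of_real (sqrt (2 / pi)) * \<i> * (cis (- (pi / 2)) * cis (- (\<nu> * pi / 2 + pi / 4)))"
    by (simp add: complex_eq_iff)
  also have "cis (- (pi / 2)) * cis (- (\<nu> * pi / 2 + pi / 4)) = cis (- ((\<nu> + 1) * pi / 2 + pi / 4))"
    unfolding cis_mult by (rule arg_cong[where f = cis]) (simp add: field_simps)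
  finally show ?case
    using oscillates_like_bessel_Suc[OF ge2(1)[folded \<nu>_def]] unfolding \<nu> by simp
qed

section \<open>Analyticity and finiteness of zeros\<close>

lemma bessel_series_holomorphic:
  assumes "f holomorphic_on S"
  shows "(\<lambda>z. bessel_series \<mu> (f z)) holomorphic_on S"
proof -
  have "bessel_series \<mu> holomorphic_on (UNIV :: complex set)"
    by (intro holomorphic_onI) (use bessel_series_deriv field_differentiable_at_within field_differentiable_def in blast)
  then have "bessel_series \<mu> \<circ> f holomorphic_on S"
    by (rule holomorphic_on_compose_gen[OF assms]) simp
  then show ?thesis by (simp add: o_def)
qed

text \<open>The closed disc is compact and contains 0, so the identity theorem also excludes
  accumulation at 0, where f itself need not be regular.\<close>

lemma finite_zeros_of_entire:
  fixes f :: "real \<Rightarrow> real"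
  assumes g: "g holomorphic_on UNIV" and a: "g (of_real a) \<noteq> (0 :: complex)"
    and f: "\<And>x. x > 0 \<Longrightarrow> f x = 0 \<Longrightarrow> g (of_real x) = 0"
  shows "finite {x. 0 < x \<and> x \<le> M \<and> f x = 0}"
proof (cases "g constant_on UNIV")
  case True
  then have "{x. 0 < x \<and> x \<le> M \<and> f x = 0} = {}"
    using a f unfolding constant_on_def by fastforce
  then show ?thesis by (simp only: finite.emptyI)
next
  case False
  have "finite {z \<in> cball 0 M. g z = 0}"
    by (rule holomorphic_compact_finite_zeros[OF g]) (use False in auto)
  then have "finite (complex_of_real -` {z \<in> cball 0 M. g z = 0})"
    by (rule finite_vimageI) (rule inj_of_real)
  then show ?thesis by (rule finite_subset[rotated]) (use f in auto)
qed

text \<open>The value at 0 is 1/Gamma(\<sigma> + 1), which vanishes for negative integers \<sigma>.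
  If the series vanished for all t > 0, so would its derivatives, that is, the series of all higher
  orders, and by continuity their values at 0; but 1/Gamma is nonzero at positive arguments.\<close>

lemma bessel_series_nontrivial:
  obtains t where "t > 0" "bessel_series \<sigma> (t :: real) \<noteq> 0"
proof (rule ccontr)
  assume "\<not> thesis"
  with that have 0: "bessel_series \<sigma> t = 0" if "t > 0" for t :: real using \<open>t > 0\<close> by blast
  have all: "\<forall>t>0. bessel_series (\<sigma> + real n) t = (0 :: real)" for n
  proof (induction n)
    case 0
    show ?case using \<open>\<And>t. t > 0 \<Longrightarrow> bessel_series \<sigma> t = 0\<close> by simp
  next
    case (Suc n)
    show ?case
    proof (intro allI impI)
      fix t :: real assume t: "t > 0"
      have "((\<lambda>_. 0) has_real_derivative - bessel_series (\<sigma> + real n + 1) t) (at t)"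
        by (rule has_field_derivative_transform_within_open[OF bessel_series_deriv, of "{0<..}"])
           (use t Suc in auto)
      then show "bessel_series (\<sigma> + real (Suc n)) t = 0"
        using DERIV_unique[OF _ DERIV_const] by (fastforce simp: add_ac)
    qed
  qed
  define n where "n = nat \<lceil>\<bar>\<sigma>\<bar>\<rceil>"
  have n: "\<sigma> + real n + 1 > 0" unfolding n_def by linarith
  have "isCont (bessel_series (\<sigma> + real n)) (0 :: real)" by (rule DERIV_isCont[OF bessel_series_deriv])
  then have "(bessel_series (\<sigma> + real n) \<longlongrightarrow> bessel_series (\<sigma> + real n) 0) (at_right (0 :: real))"
    by (simp add: isCont_def filterlim_at_split)
  moreover have "(bessel_series (\<sigma> + real n) \<longlongrightarrow> 0) (at_right (0 :: real))"
    by (rule tendsto_eventually) (use all in \<open>auto simp: eventually_at_right_less eventually_at_filter\<close>)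
  ultimately have "bessel_series (\<sigma> + real n) 0 = (0 :: real)"
    using tendsto_unique trivial_limit_at_right_real by blast
  moreover have "bessel_series (\<sigma> + real n) (0 :: real) = bessel_coeff (\<sigma> + real n) 0"
    unfolding bessel_series_def using powser_zero[of "bessel_coeff (\<sigma> + real n)"] by simp
  ultimately have "rGamma (\<sigma> + real n + 1) = 0" by (simp add: bessel_coeff_def)
  then show False using Gamma_real_pos[OF n] by (simp add: rGamma_inverse_Gamma)
qed


section \<open>Zeros of Bessel functions and of the Robin determinant\<close>

text \<open>For general order K is not known explicitly. Only K \<noteq> 0 is needed: dividing by
  its modulus gives a sine-like function with phase Arg K, and the limiting spacing does not depend
  on that phase.\<close>

lemma bessel_J_zeros:
  "\<exists>j. enumerates_positive_zeros (bessel_J \<sigma>) j \<and> (\<lambda>p. j (p + 1) - j p) \<longlonglongrightarrow> pi"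
proof -
  obtain K where K: "oscillates_like K (scaled_bessel \<sigma>) (scaled_bessel' \<sigma>)"
    using bessel.ex_oscillates_like by blast
  obtain t where t: "t > 0" "bessel_series \<sigma> (t :: real) \<noteq> 0" by (rule bessel_series_nontrivial)
  define a where "a = 2 * sqrt t"
  have a: "a > 0" "(a / 2)\<^sup>2 = t" using t by (simp_all add: a_def)
  then have "scaled_bessel \<sigma> a \<noteq> 0"
    using t by (simp add: scaled_bessel_def bessel_J_series)
  then have K0: "K \<noteq> 0" using bessel.oscillates_like_nonzero[OF K a(1)] by blast
  have Kcis: "K * cis x = of_real (norm K) * cis (x + Arg K)" for x
  proof -
    have "K = of_real (norm K) * cis (Arg K)"
      using rcis_cmod_Arg[of K] by (simp add: rcis_def)
    then have "K * cis x = of_real (norm K) * (cis (Arg K) * cis x)" by (metis mult.assoc)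
    then show ?thesis by (simp add: cis_mult add.commute)
  qed
  have "\<exists>k j. enumerates_positive_zeros (\<lambda>x. scaled_bessel \<sigma> x / norm K) k \<and>
     (\<lambda>p. k p - (- Arg K + (real p + of_int j) * pi)) \<longlonglongrightarrow> 0"
  proof (rule sine_like_zeros)
    show "((\<lambda>x. scaled_bessel \<sigma> x / norm K) has_real_derivative scaled_bessel' \<sigma> x / norm K) (at x)" if "x > 0" for x
      by (intro DERIV_cdivide scaled_bessel_deriv that)
    have "((\<lambda>x. (scaled_bessel \<sigma> x - Im (K * cis x)) / norm K) \<longlongrightarrow> 0 / norm K) at_top"
      by (intro tendsto_divide oscillates_like_Re_Im[OF K] tendsto_const) (use K0 in simp)
    then show "((\<lambda>x. scaled_bessel \<sigma> x / norm K - sin (x - - Arg K)) \<longlongrightarrow> 0) at_top"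
      using K0 unfolding Kcis by (simp add: diff_divide_distrib)
    have "((\<lambda>x. (scaled_bessel' \<sigma> x - Re (K * cis x)) / norm K) \<longlongrightarrow> 0 / norm K) at_top"
      by (intro tendsto_divide oscillates_like_Re_Im[OF K] tendsto_const) (use K0 in simp)
    then show "((\<lambda>x. scaled_bessel' \<sigma> x / norm K - cos (x - - Arg K)) \<longlongrightarrow> 0) at_top"
      using K0 unfolding Kcis by (simp add: diff_divide_distrib)
    show "finite {x. 0 < x \<and> x \<le> M \<and> scaled_bessel \<sigma> x / norm K = 0}" for M
    proof (rule finite_zeros_of_entire[where g = "\<lambda>z. bessel_series \<sigma> ((z / 2)\<^sup>2)" and a = a])
      show "(\<lambda>z. bessel_series \<sigma> ((z / 2)\<^sup>2)) holomorphic_on (UNIV :: complex set)"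
        by (intro bessel_series_holomorphic holomorphic_intros) auto
      have r: "bessel_series \<sigma> ((complex_of_real x / 2)\<^sup>2) = of_real (bessel_series \<sigma> ((x / 2)\<^sup>2))" for x
        using bessel_series_of_real[of \<sigma> "(x / 2)\<^sup>2"] by simp
      show "bessel_series \<sigma> ((complex_of_real a / 2)\<^sup>2) \<noteq> 0"
        unfolding r a using t by simp
      fix x :: real assume "x > 0" "scaled_bessel \<sigma> x / norm K = 0"
      then show "bessel_series \<sigma> ((complex_of_real x / 2)\<^sup>2) = 0"
        unfolding r using K0 by (simp add: scaled_bessel_def bessel_J_series)
    qed
  qed
  then obtain k j where k: "enumerates_positive_zeros (\<lambda>x. scaled_bessel \<sigma> x / norm K) k"
    and lim: "(\<lambda>p. k p - (- Arg K + (real p + of_int j) * pi)) \<longlonglongrightarrow> 0"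
    by blast
  have "enumerates_positive_zeros (bessel_J \<sigma>) (\<lambda>p. k p / 1)"
    by (rule enumerates_positive_zeros_scale[OF k]) (use K0 in \<open>auto simp: scaled_bessel_def\<close>)
  then show ?thesis
    using enumerates_positive_zeros_spacing_tendsto[OF lim] by auto
qed

text \<open>Removing the nonvanishing factor sqrt x (x/2)^\<mu> / x leaves an even entire function
  g. It is not identically zero, since otherwise A sin(x - \<phi>) would tend to 0.\<close>

lemma finite_mixed_zeros:
  assumes K: "oscillates_like (of_real A * \<i> * cis (- \<phi>)) (scaled_bessel \<mu>) (scaled_bessel' \<mu>)" and A: "A > 0"
  shows "finite {x. 0 < x \<and> x \<le> M \<and> scaled_bessel' \<mu> x + b / x * scaled_bessel \<mu> x = 0}"
proof -
  define c where "c = b + \<mu> + 1 / 2"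
  define g where "g z = of_real c * bessel_series \<mu> ((z / 2)\<^sup>2) - z\<^sup>2 / 2 * bessel_series (\<mu> + 1) ((z / 2)\<^sup>2)" for z :: complex
  have r: "bessel_series \<nu> ((complex_of_real x / 2)\<^sup>2) = of_real (bessel_series \<nu> ((x / 2)\<^sup>2))" for x \<nu>
    using bessel_series_of_real[of \<nu> "(x / 2)\<^sup>2"] by simp
  have g: "of_real (scaled_bessel' \<mu> x + b / x * scaled_bessel \<mu> x) = of_real (sqrt x * (x / 2) powr \<mu> / x) * g (of_real x)"
    if x: "x > 0" for x
  proof -
    have "(x / 2) powr (\<mu> + 1) = (x / 2) powr \<mu> * (x / 2)" using x by (simp add: powr_add)
    then have "scaled_bessel' \<mu> x + b / x * scaled_bessel \<mu> x =
      sqrt x * (x / 2) powr \<mu> / x * (c * bessel_series \<mu> ((x / 2)\<^sup>2) - x\<^sup>2 / 2 * bessel_series (\<mu> + 1) ((x / 2)\<^sup>2))"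
      using x by (simp add: scaled_bessel'_def scaled_bessel_def bessel_J_series c_def field_simps power2_eq_square)
    then show ?thesis unfolding g_def r by simp
  qed
  have "\<exists>a>0. scaled_bessel' \<mu> a + b / a * scaled_bessel \<mu> a \<noteq> 0"
  proof (rule ccontr)
    assume "\<not> ?thesis"
    then have 0: "scaled_bessel' \<mu> x + b / x * scaled_bessel \<mu> x = 0" if "x > 0" for x using that by blast
    have im: "Im (- of_real A * cis (- \<phi>) * cis x) = - A * sin (x - \<phi>)" for x
      unfolding mult.assoc cis_mult by simp
    have "((\<lambda>x. Im (- of_real A * cis (- \<phi>) * cis x)) \<longlongrightarrow> 0) at_top"
      unfolding im
      by (rule Lim_transform_eventually[OF bessel.mixed_tendsto(1)[OF K, of b]],
          rule eventually_mono[OF eventually_gt_at_top[of 0]])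
         (simp only: 0 minus_zero diff_0 mult_minus_left)
    then have "- of_real A * cis (- \<phi>) = 0" by (rule tendsto_zero_of_Im_cis_multiple)
    then show False using A by simp
  qed
  then obtain a where a: "a > 0" "scaled_bessel' \<mu> a + b / a * scaled_bessel \<mu> a \<noteq> 0" by blast
  show ?thesis
  proof (rule finite_zeros_of_entire)
    show "g holomorphic_on UNIV"
      unfolding g_def by (intro bessel_series_holomorphic holomorphic_intros) auto
    show "g (of_real a) \<noteq> 0"
      using g[OF a(1)] a(2) by (metis mult_zero_right of_real_eq_0_iff)
    fix x :: real assume x: "x > 0" and z: "scaled_bessel' \<mu> x + b / x * scaled_bessel \<mu> x = 0"
    have "sqrt x * (x / 2) powr \<mu> / x \<noteq> 0" using x by simp
    then show "g (of_real x) = 0"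
      using g[OF x] unfolding z by (metis mult_eq_0_iff of_real_0 of_real_eq_0_iff)
  qed
qed

text \<open>Eliminating \<open>J\<^bsub>\<mu>+1\<^esub>\<close> by \<open>\<surd>x J\<^bsub>\<mu>+1\<^esub> = (\<mu> + 1/2)/x u - u'\<close> turns the coefficient \<open>\<alpha>R + l\<close> of \<open>u/x\<close> into this one.\<close>
definition robin_shift :: "nat \<Rightarrow> nat \<Rightarrow> real \<Rightarrow> real \<Rightarrow> real" where
  "robin_shift d l R \<alpha> = \<alpha> * R + real l - (mode_order d l + 1 / 2)"

lemma robin_det_scaled:
  assumes "R > 0" "k > 0"
  shows "robin_det d l R \<alpha> k = sqrt (k * R) / R *
     (scaled_bessel' (mode_order d l) (k * R) + robin_shift d l R \<alpha> / (k * R) * scaled_bessel (mode_order d l) (k * R))"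
proof -
  define s where "s = sqrt (k * R)"
  have s: "s * s = k * R" "s > 0" using assms by (simp_all add: s_def)
  have "s / R * (\<kappa> / (k * R) * (s * J) - s * J1 + (a - \<kappa>) / (k * R) * (s * J)) = (s * s) / R * (a / (k * R) * J - J1)" for \<kappa> J J1 a
    by (simp add: algebra_simps diff_divide_distrib)
  also have "(s * s) / R * (a / (k * R) * J - J1) = a / R * J - k * J1" for J J1 a
    unfolding s using assms by (simp add: field_simps)
  finally have eq: "s / R * (\<kappa> / (k * R) * (s * J) - s * J1 + (a - \<kappa>) / (k * R) * (s * J)) = a / R * J - k * J1" for \<kappa> J J1 a .
  show ?thesis
    unfolding robin_det_def scaled_bessel'_def scaled_bessel_def robin_shift_def s_def[symmetric] eq
    using assms by (simp add: add_divide_distrib)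
qed

text \<open>The constant of the theorem is b - lam/2 of the general results, because \<mu> + 1/2 +
  (\<mu>^2 - 1/4)/2 = ((2\<mu> + 2)^2 - 1)/8 and 2\<mu> + 2 = 2l + d.\<close>

lemma robin_const_eq:
  "robin_const d l R \<alpha> = robin_shift d l R \<alpha> - ((mode_order d l)\<^sup>2 - 1 / 4) / 2"
  by (simp add: robin_const_def robin_shift_def mode_order_def power2_eq_square field_simps)

lemma oscillates_like_mode:
  assumes "d \<ge> 1"
  shows "oscillates_like (of_real (sqrt (2 / pi)) * \<i> * cis (- (mode_order d l * pi / 2 + pi / 4)))
     (scaled_bessel (mode_order d l)) (scaled_bessel' (mode_order d l))"
proof -
  have eq: "mode_order d l = (real (2 * l + d - 1) - 1) / 2"
    using assms by (simp add: mode_order_def of_nat_diff field_simps)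
  show ?thesis unfolding eq by (rule oscillates_like_bessel_half_integer)
qed

lemma robin_zeros:
  fixes R \<alpha> :: real
  assumes d: "d \<ge> 1" and R: "R > 0"
  obtains z j where
    "enumerates_positive_zeros (\<lambda>x. scaled_bessel' (mode_order d l) x + robin_shift d l R \<alpha> / x * scaled_bessel (mode_order d l) x) z"
    "(\<lambda>p. z p - (mode_order d l * pi / 2 + pi / 4 + (real p + of_int j) * pi)) \<longlonglongrightarrow> 0"
    "enumerates_positive_zeros (robin_det d l R \<alpha>) (\<lambda>p. z p / R)"
proof -
  have "sqrt (2 / pi) > 0" by simp
  with bessel.mixed_zeros[OF oscillates_like_mode[OF d] this finite_mixed_zeros[OF oscillates_like_mode[OF d]]]
  obtain z j where
    z: "enumerates_positive_zeros (\<lambda>x. scaled_bessel' (mode_order d l) x + robin_shift d l R \<alpha> / x * scaled_bessel (mode_order d l) x) z"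
    and lim: "(\<lambda>p. z p - (mode_order d l * pi / 2 + pi / 4 + (real p + of_int j) * pi)) \<longlonglongrightarrow> 0"
    by blast
  have "enumerates_positive_zeros (robin_det d l R \<alpha>) (\<lambda>p. z p / R)"
    by (rule enumerates_positive_zeros_scale[OF z R]) (use R in \<open>simp add: robin_det_scaled\<close>)
  with z lim show ?thesis using that by blast
qed

lemma robin_spacing_tendsto:
  assumes "d \<ge> 1" "R > 0"
  shows "\<exists>k. enumerates_positive_zeros (robin_det d l R \<alpha>) k \<and> (\<lambda>p. k (p + 1) - k p) \<longlonglongrightarrow> pi / R"
proof -
  obtain z j where z: "(\<lambda>p. z p - (mode_order d l * pi / 2 + pi / 4 + (real p + of_int j) * pi)) \<longlonglongrightarrow> 0"
    "enumerates_positive_zeros (robin_det d l R \<alpha>) (\<lambda>p. z p / R)"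
    by (rule robin_zeros[OF assms])
  have "(\<lambda>p. (z (p + 1) - z p) / R) \<longlonglongrightarrow> pi / R"
    using assms by (intro tendsto_divide enumerates_positive_zeros_spacing_tendsto[OF z(1)] tendsto_const) simp
  then show ?thesis using z(2) by (intro exI[of _ "\<lambda>p. z p / R"]) (simp add: diff_divide_distrib)
qed

lemma robin_det_asymptotics:
  fixes R \<alpha> :: real
  assumes d: "d \<ge> 1" and R: "R > 0"
  shows "\<exists>E \<in> O[at_top](\<lambda>k. 1 / (k * R)^2). \<forall>k>0.
        robin_det d l R \<alpha> k =
          - sqrt (2 * k / (pi * R)) *
            (sin (phase d l (k * R))
              - robin_const d l R \<alpha> / (k * R) * cos (phase d l (k * R)) + E k)"
proof -
  define \<mu> where "\<mu> = mode_order d l"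
  define b where "b = robin_shift d l R \<alpha>"
  define A where "A = sqrt (2 / pi)"
  have A: "A > 0" by (simp add: A_def)
  define e where "e x = - (scaled_bessel' \<mu> x + b / x * scaled_bessel \<mu> x) / A -
     (sin (phase d l x) - robin_const d l R \<alpha> / x * cos (phase d l x))" for x
  have ph: "phase d l x = x - (\<mu> * pi / 2 + pi / 4)" for x by (simp add: phase_def \<mu>_def)
  have "e \<in> O(\<lambda>x. 1 / x\<^sup>2)"
    unfolding e_def[abs_def] ph robin_const_eq \<mu>_def b_def
    by (rule bessel.mixed_expansion[OF oscillates_like_mode[OF d, folded A_def] A])
  moreover have "filterlim (\<lambda>k. k * R) at_top at_top"
    using R by real_asymp
  ultimately have "(\<lambda>k. e (k * R)) \<in> O(\<lambda>k. 1 / (k * R)\<^sup>2)"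
    by (rule landau_o.big.compose)
  moreover have "robin_det d l R \<alpha> k = - sqrt (2 * k / (pi * R)) *
            (sin (phase d l (k * R)) - robin_const d l R \<alpha> / (k * R) * cos (phase d l (k * R)) + e (k * R))"
    if k: "k > 0" for k
  proof -
    have "sqrt (2 * k / (pi * R)) = A * sqrt (k * R) / R"
    proof -
      have "2 * k / (pi * R) = 2 / pi * (k * R) / R\<^sup>2" using R by (simp add: power2_eq_square)
      then show ?thesis using R by (simp only: A_def real_sqrt_divide[of _ "R\<^sup>2"] real_sqrt_mult[of "2 / pi"]) simp
    qed
    moreover define X where "X = scaled_bessel' \<mu> (k * R) + b / (k * R) * scaled_bessel \<mu> (k * R)"
    then have "sin (phase d l (k * R)) - robin_const d l R \<alpha> / (k * R) * cos (phase d l (k * R)) + e (k * R) = - X / A"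
      by (simp add: e_def)
    moreover have "robin_det d l R \<alpha> k = sqrt (k * R) / R * X"
      unfolding X_def \<mu>_def b_def by (rule robin_det_scaled[OF R k])
    ultimately show ?thesis using A by simp
  qed
  ultimately show ?thesis by (intro bexI[of _ "\<lambda>k. e (k * R)"]) auto
qed

lemma robin_spacing_asymptotics:
  fixes R \<alpha> :: real
  assumes d: "d \<ge> 1" and R: "R > 0" and k: "enumerates_positive_zeros (robin_det d l R \<alpha>) k"
  shows "\<exists>E \<in> O[at_top](\<lambda>p. 1 / (k p * R)^3). \<forall>p\<ge>1.
             k (p + 1) - k p =
               pi / R * (1 - robin_const d l R \<alpha> / (k p * R)^2 + E p)"
proof -
  obtain z j where
    z: "enumerates_positive_zeros (\<lambda>x. scaled_bessel' (mode_order d l) x + robin_shift d l R \<alpha> / x * scaled_bessel (mode_order d l) x) z"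
    and lim: "(\<lambda>p. z p - (mode_order d l * pi / 2 + pi / 4 + (real p + of_int j) * pi)) \<longlonglongrightarrow> 0"
    and rz: "enumerates_positive_zeros (robin_det d l R \<alpha>) (\<lambda>p. z p / R)"
    by (rule robin_zeros[OF d R])
  \<comment> \<open>Uniqueness identifies an arbitrary enumeration with the constructed one, except
    at the meaningless index 0.\<close>
  have kz: "k p * R = z p" if "p \<ge> 1" for p
    using enumerates_positive_zeros_unique[OF k rz that] R by simp
  have zpos: "z p > 0" if "p \<ge> 1" for p
    using z that by (auto simp: enumerates_positive_zeros_def)
  have A: "sqrt (2 / pi) > 0" by simp
  obtain C where C: "eventually (\<lambda>p. \<bar>z (p + 1) - z p - pi * (1 - robin_const d l R \<alpha> / (z p)\<^sup>2)\<bar> \<le> C / (z p) ^ 3) sequentially"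
    using bessel.mixed_spacing[OF oscillates_like_mode[OF d] A z lim] unfolding robin_const_eq by blast
  \<comment> \<open>The claimed equation solved for its error term: it then holds at every p, and
    only the size of E for large p remains.\<close>
  define E where "E p = (k (p + 1) - k p) * R / pi - (1 - robin_const d l R \<alpha> / (k p * R)\<^sup>2)" for p
  have "E \<in> O(\<lambda>p. 1 / (k p * R) ^ 3)"
  proof (rule bigoI[of _ "C / pi"])
    show "eventually (\<lambda>p. norm (E p) \<le> C / pi * norm (1 / (k p * R) ^ 3)) sequentially"
      using C eventually_ge_at_top[of 1]
    proof eventually_elim
      case (elim p)
      have "E p = (z (p + 1) - z p - pi * (1 - robin_const d l R \<alpha> / (z p)\<^sup>2)) / pi"
        using kz[of p] kz[of "p + 1"] elim by (simp add: E_def left_diff_distrib diff_divide_distrib)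
      then have "norm (E p) = \<bar>z (p + 1) - z p - pi * (1 - robin_const d l R \<alpha> / (z p)\<^sup>2)\<bar> / pi"
        by (simp only: real_norm_def abs_divide abs_of_pos[OF pi_gt_zero])
      also have "\<dots> \<le> C / z p ^ 3 / pi" using elim(1) by (rule divide_right_mono) simp
      finally have "norm (E p) \<le> C / z p ^ 3 / pi" .
      then show ?case
        using zpos[OF elim(2)] unfolding kz[OF elim(2)] by (simp add: mult.commute)
    qed
  qed
  moreover have "k (p + 1) - k p = pi / R * (1 - robin_const d l R \<alpha> / (k p * R)^2 + E p)" for p
    using R by (simp add: E_def)
  ultimately show ?thesis by blast
qed

text \<open>Existence of an enumeration is a separate conjunct, so the claim about all enumerations
  is not vacuous. The last two conjuncts express the universality of pi/R: they include the Neumann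
  case \<alpha>' = 0, and zeros of J divided by R are the Dirichlet wavenumbers.\<close>

theorem theorem5:
  fixes d l :: nat and R \<alpha> :: real
  assumes "d \<ge> 2" and "R > 0" and "\<alpha> > 0"
  shows
    "(\<exists>E \<in> O[at_top](\<lambda>k. 1 / (k * R)^2). \<forall>k>0.
        robin_det d l R \<alpha> k =
          - sqrt (2 * k / (pi * R)) *
            (sin (phase d l (k * R))
              - robin_const d l R \<alpha> / (k * R) * cos (phase d l (k * R)) + E k))
     \<and> (\<exists>k. enumerates_positive_zeros (robin_det d l R \<alpha>) k)
     \<and> (\<forall>k. enumerates_positive_zeros (robin_det d l R \<alpha>) k \<longrightarrow>
          (\<exists>E \<in> O[at_top](\<lambda>p. 1 / (k p * R)^3). \<forall>p\<ge>1.
             k (p + 1) - k p =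
               pi / R * (1 - robin_const d l R \<alpha> / (k p * R)^2 + E p)))
     \<and> (\<forall>\<alpha>'\<ge>0. \<forall>l'. \<exists>k. enumerates_positive_zeros (robin_det d l' R \<alpha>') k \<and>
          (\<lambda>p. k (p + 1) - k p) \<longlonglongrightarrow> pi / R)
     \<and> (\<forall>\<sigma>. \<exists>j. enumerates_positive_zeros (bessel_J \<sigma>) j \<and>
          (\<lambda>p. (j (p + 1) - j p) / R) \<longlonglongrightarrow> pi / R)"
proof (intro conjI allI impI)
  have d: "d \<ge> 1" using assms by simp
  show "\<exists>E \<in> O[at_top](\<lambda>k. 1 / (k * R)^2). \<forall>k>0.
        robin_det d l R \<alpha> k =
          - sqrt (2 * k / (pi * R)) *
            (sin (phase d l (k * R))
              - robin_const d l R \<alpha> / (k * R) * cos (phase d l (k * R)) + E k)"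
    by (rule robin_det_asymptotics[OF d assms(2)])
  show "\<exists>k. enumerates_positive_zeros (robin_det d l R \<alpha>) k"
    using robin_spacing_tendsto[OF d assms(2)] by blast
  show "\<exists>E \<in> O[at_top](\<lambda>p. 1 / (k p * R)^3). \<forall>p\<ge>1.
             k (p + 1) - k p = pi / R * (1 - robin_const d l R \<alpha> / (k p * R)^2 + E p)"
    if "enumerates_positive_zeros (robin_det d l R \<alpha>) k" for k
    by (rule robin_spacing_asymptotics[OF d assms(2) that])
  show "\<exists>k. enumerates_positive_zeros (robin_det d l' R \<alpha>') k \<and> (\<lambda>p. k (p + 1) - k p) \<longlonglongrightarrow> pi / R" for \<alpha>' l'
    by (rule robin_spacing_tendsto[OF d assms(2)])
  show "\<exists>j. enumerates_positive_zeros (bessel_J \<sigma>) j \<and> (\<lambda>p. (j (p + 1) - j p) / R) \<longlonglongrightarrow> pi / R" for \<sigma>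
  proof -
    obtain j where j: "enumerates_positive_zeros (bessel_J \<sigma>) j" "(\<lambda>p. j (p + 1) - j p) \<longlonglongrightarrow> pi"
      using bessel_J_zeros by blast
    have "(\<lambda>p. (j (p + 1) - j p) / R) \<longlonglongrightarrow> pi / R"
      using assms by (intro tendsto_divide j(2) tendsto_const) simp
    with j(1) show ?thesis by blast
  qed
qed

end
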